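(* Let $\sigma\in\mathcal{S}'(\mathbb{R}^2)$, let $\varphi(x)=e^{-\pi x^2}$, $x\in\mathbb{R}$, be the Gaussian function, and let $\Lambda=a\mathbb{Z}\times b\mathbb{Z}$ with arbitrary $a,b>0$. If $\hat\sigma$ is compactly supported and $$\langle\sigma^{KN}\pi(\mu)\varphi,\pi(\lambda)\varphi\rangle=0\quad\text{for all }\lambda,\mu\in\Lambda,$$ then $\sigma^{KN}$ is identically zero.
   Context: The Fourier transform is $\hat f(\xi)=\int f(x)e^{-2\pi i\xi\cdot x}\,dx$, extended to tempered distributions. For $z=(x,\xi)\in\mathbb{R}^2$, $\pi(z)f(t)=e^{2\pi i\xi t}f(t-x)$ for functions $f$ on $\mathbb{R}$. The Rihaczek distribution is $R(f,g)(x,\xi)=f(x)\overline{\hat g(\xi)}e^{-2\pi i x\xi}$. The brackets $\langle\cdot,\cdot\rangle$ denote the extension of the $L^2$ inner product (conjugate-linear in the second argument). For $\sigma\in\mathcal{S}'(\mathbb{R}^2)$ the pseudodifferential operator $\sigma^{KN}:\mathcal{S}(\mathbb{R})\to\mathcal{S}'(\mathbb{R})$ with Kohn-Nirenberg symbol $\sigma$ is defined by $\langle\sigma^{KN}f,g\rangle=\langle\sigma,R(g,f)\rangle$ for $f,g\in\mathcal{S}(\mathbb{R})$. *)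

theory Defs
  imports "HOL-Analysis.Analysis"
begin

section \<open>Schwartz functions\<close>

definition iter_deriv :: "'a::euclidean_space list \<Rightarrow> ('a \<Rightarrow> complex) \<Rightarrow> 'a \<Rightarrow> complex" where
  "iter_deriv vs f = foldr (\<lambda>v g x. frechet_derivative g (at x) v) vs f"

definition smooth :: "('a::euclidean_space \<Rightarrow> complex) \<Rightarrow> bool" where
  "smooth f \<longleftrightarrow> (\<forall>vs\<in>lists Basis. iter_deriv vs f differentiable_on UNIV)"

definition schwartz :: "('a::euclidean_space \<Rightarrow> complex) set" where
  "schwartz = {f. smooth f \<and>
     (\<forall>k. \<forall>vs\<in>lists Basis. bounded (range (\<lambda>x. norm x ^ k *\<^sub>R iter_deriv vs f x)))}"

text \<open>The supremum is finite on \<^const>\<open>schwartz\<close>; elsewhere the value is irrelevant.\<close>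

definition schwartz_seminorm ::
    "nat \<Rightarrow> 'a::euclidean_space list \<Rightarrow> ('a \<Rightarrow> complex) \<Rightarrow> real" where
  "schwartz_seminorm k vs f = (SUP x. norm x ^ k * norm (iter_deriv vs f x))"

definition schwartz_topology :: "('a::euclidean_space \<Rightarrow> complex) topology" where
  "schwartz_topology = topology_generated_by
     {{g \<in> schwartz. schwartz_seminorm k vs (\<lambda>x. g x - f x) < r} | f k vs r.
        f \<in> schwartz \<and> vs \<in> lists Basis \<and> r > 0}"

section \<open>Tempered distributions\<close>

text \<open>A distribution is represented by a complex-linear functional; only its values on
  \<^const>\<open>schwartz\<close> are meaningful.\<close>

type_synonym 'a distr = "('a \<Rightarrow> complex) \<Rightarrow> complex"

definition tempered :: "'a::euclidean_space distr \<Rightarrow> bool" where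
  "tempered u \<longleftrightarrow>
     (\<forall>f\<in>schwartz. \<forall>g\<in>schwartz. u (\<lambda>x. f x + g x) = u f + u g) \<and>
     (\<forall>c. \<forall>f\<in>schwartz. u (\<lambda>x. c * f x) = c * u f) \<and>
     continuous_map schwartz_topology euclidean u"

text \<open>The pairing extending the \<open>L\<^sup>2\<close> inner product, conjugate-linear in the second argument:
  a locally integrable \<open>h\<close> of polynomial growth is the functional \<open>f \<mapsto> \<integral> h f\<close>,
  so its pairing with \<open>g\<close> is the integral of \<open>h\<close> times the conjugate of \<open>g\<close>.\<close>

definition dist_inner :: "'a distr \<Rightarrow> ('a \<Rightarrow> complex) \<Rightarrow> complex" where
  "dist_inner u g = u (\<lambda>x. cnj (g x))"

definition vanishes_on :: "'a::euclidean_space distr \<Rightarrow> 'a set \<Rightarrow> bool" where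
  "vanishes_on u U \<longleftrightarrow>
     (\<forall>f. smooth f \<and> compact (closure (support_on UNIV f)) \<and> closure (support_on UNIV f) \<subseteq> U
        \<longrightarrow> u f = 0)"

definition dist_support :: "'a::euclidean_space distr \<Rightarrow> 'a set" where
  "dist_support u = - \<Union>{U. open U \<and> vanishes_on u U}"

section \<open>Fourier transform\<close>

definition fourier :: "('a::euclidean_space \<Rightarrow> complex) \<Rightarrow> 'a \<Rightarrow> complex" where
  "fourier f \<xi> = (LINT x|lborel. f x * cis (- 2 * pi * (\<xi> \<bullet> x)))"

definition dist_fourier :: "'a::euclidean_space distr \<Rightarrow> 'a distr" where
  "dist_fourier u = (\<lambda>f. u (fourier f))"

section \<open>Time-frequency analysis\<close>

definition tf_shift :: "real \<times> real \<Rightarrow> (real \<Rightarrow> complex) \<Rightarrow> real \<Rightarrow> complex" where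
  "tf_shift z f t = (case z of (x, \<xi>) \<Rightarrow> cis (2 * pi * \<xi> * t) * f (t - x))"

definition rihaczek ::
    "(real \<Rightarrow> complex) \<Rightarrow> (real \<Rightarrow> complex) \<Rightarrow> real \<times> real \<Rightarrow> complex" where
  "rihaczek f g = (\<lambda>(x, \<xi>). f x * cnj (fourier g \<xi>) * cis (- 2 * pi * x * \<xi>))"

text \<open>The linear functional whose pairing with \<open>g\<close> is that of \<open>\<sigma>\<close> with \<open>rihaczek g f\<close>;
  see \<open>dist_inner_kohn_nirenberg\<close>.\<close>

definition kohn_nirenberg ::
    "(real \<times> real) distr \<Rightarrow> (real \<Rightarrow> complex) \<Rightarrow> real distr" where
  "kohn_nirenberg \<sigma> f = (\<lambda>g. dist_inner \<sigma> (rihaczek (\<lambda>x. cnj (g x)) f))"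

lemma dist_inner_kohn_nirenberg:
  "dist_inner (kohn_nirenberg \<sigma> f) g = dist_inner \<sigma> (rihaczek g f)"
  by (simp add: dist_inner_def kohn_nirenberg_def)

definition gaussian :: "real \<Rightarrow> complex" where
  "gaussian x = of_real (exp (- pi * x\<^sup>2))"

definition rect_lattice :: "real \<Rightarrow> real \<Rightarrow> (real \<times> real) set" where
  "rect_lattice a b = {(a * of_int m, b * of_int n) | m n. True}"

end

theory Submission
  imports Defs "HOL-Probability.Probability" "HOL-Complex_Analysis.Complex_Analysis"
begin

text \<open>
  Write \<open>\<phi>\<close> for the Gaussian. Up to a nonzero factor, the conjugate of the Rihaczek distribution
  of two time-frequency shifts of \<open>\<phi>\<close> by \<open>(l\<^sub>1, l\<^sub>2)\<close> and \<open>(m\<^sub>1, m\<^sub>2)\<close> is the chirped Gaussian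
  \<open>E(z, w)(x, \<xi>) = exp (- \<pi> (x\<^sup>2 + \<xi>\<^sup>2) + 2 \<pi> i x \<xi> + 2 \<pi> z x + 2 \<pi> w \<xi>)\<close> with \<open>z = l\<^sub>1 - i l\<^sub>2\<close> and
  \<open>w = m\<^sub>2 - i m\<^sub>1\<close> (\<open>cnj_rihaczek_tf_shift\<close>). The four real parameters thus form two independent
  complex ones, and the hypothesis says that \<open>\<sigma> (E(z, w)) = 0\<close> whenever \<open>z\<close> lies in the lattice
  \<open>a\<int> + i b\<int>\<close> and \<open>w\<close> in the lattice \<open>b\<int> + i a\<int>\<close> of the complex plane.

  Up to a constant multiple of the exponential of a quadratic polynomial in \<open>z\<close> and \<open>w\<close>, the
  function \<open>E(z, w)\<close> is the Fourier transform of a fixed complex Gaussian times the exponential of a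
  linear form whose coefficients depend linearly
  on \<open>z\<close> and \<open>w\<close> (\<open>fourier_dual_gaussian\<close>). Up to the same nonvanishing factor, \<open>\<sigma> (E(z, w))\<close> is
  therefore a Laplace transform of the Fourier transform of \<open>\<sigma>\<close>. As the latter has compact
  support, this is an entire function of exponential type in each variable
  (\<open>laplace_entire_exponential_type\<close>). A nonzero entire function of exponential type has only \<open>O(r)\<close>
  zeros in the disc of radius \<open>r\<close>, whereas a lattice has about \<open>r\<^sup>2\<close> points there, so a zero at every
  lattice point forces the function to vanish (\<open>exponential_type_zero_on_lattice\<close>). Used first in
  \<open>z\<close> for the lattice values of \<open>w\<close> and then in \<open>w\<close>, this gives \<open>\<sigma> (E(z, w)) = 0\<close> for all complex
  \<open>z\<close> and \<open>w\<close>.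
  The count of zeros is quadratic however sparse the lattice is, so \<open>a\<close> and \<open>b\<close> can be arbitrary.

  For purely imaginary \<open>z\<close> and \<open>w\<close> the function \<open>E(z, w)\<close> is the chirp \<open>exp (2 \<pi> i x \<xi>)\<close> times a
  product of two modulated Gaussians. A continuous functional on \<open>S(\<real>)\<close> that annihilates all modulated
  Gaussians is zero (\<open>cfunctional_zero_of_modulated_gaussians\<close>). Used once in each variable, this
  shows that \<open>\<sigma>\<close> annihilates the chirp times \<open>g(x) k(\<xi>)\<close> for all Schwartz functions \<open>g\<close> and \<open>k\<close>; if \<open>k\<close>
  is the Fourier transform of \<open>f\<close>, this is the pairing in the conclusion.

  The analysis behind these steps rests on explicit estimates instead of a topology: a
  family of weighted bounds on derivatives (\<open>sbound\<close>) through which functionals and operators on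
  Schwartz space are continuous, and the continuity of the Fourier transform in this sense
  (\<open>coperator_fourier\<close>).
\<close>

section \<open>Iterated partial derivatives\<close>

definition pd :: "'a::euclidean_space \<Rightarrow> ('a \<Rightarrow> complex) \<Rightarrow> 'a \<Rightarrow> complex" where
  "pd v f x = frechet_derivative f (at x) v"

lemma iter_deriv_Nil [simp]: "iter_deriv [] f = f"
  by (simp add: iter_deriv_def)

lemma iter_deriv_Cons: "iter_deriv (v # vs) f = pd v (iter_deriv vs f)"
  by (simp add: iter_deriv_def pd_def fun_eq_iff)

lemma iter_deriv_append: "iter_deriv (vs @ ws) f = iter_deriv vs (iter_deriv ws f)"
  by (simp add: iter_deriv_def)

lemma iter_deriv_snoc: "iter_deriv (vs @ [v]) f = iter_deriv vs (pd v f)"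
  by (simp add: iter_deriv_append iter_deriv_Cons)

lemma pd_eqI: "(f has_derivative f') (at x) \<Longrightarrow> pd v f x = f' v"
  unfolding pd_def by (simp add: frechet_derivative_at[symmetric])

lemma has_derivative_pd:
  "f differentiable_on UNIV \<Longrightarrow> (f has_derivative (\<lambda>v. pd v f x)) (at x)"
  unfolding pd_def by (auto simp: differentiable_on_def frechet_derivative_works[symmetric])

lemma pd_const [simp]: "pd v (\<lambda>x. c) = (\<lambda>x. 0)"
  by (rule ext, rule pd_eqI[where f'="\<lambda>_. 0"]) (rule has_derivative_const)

lemma pd_add:
  assumes "f differentiable_on UNIV" "g differentiable_on UNIV"
  shows "pd v (\<lambda>x. f x + g x) = (\<lambda>x. pd v f x + pd v g x)"
  by (rule ext, rule pd_eqI)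
     (rule has_derivative_add[OF has_derivative_pd[OF assms(1)] has_derivative_pd[OF assms(2)]])

lemma pd_mult:
  assumes "f differentiable_on UNIV" "g differentiable_on UNIV"
  shows "pd v (\<lambda>x. f x * g x) = (\<lambda>x. pd v f x * g x + f x * pd v g x)"
  by (rule ext, rule trans[OF pd_eqI,
        OF has_derivative_mult[OF has_derivative_pd[OF assms(1)] has_derivative_pd[OF assms(2)]]])
     (simp add: algebra_simps)

lemma pd_bounded_linear:
  assumes "f differentiable_on UNIV" "bounded_linear L"
  shows "pd v (\<lambda>x. L (f x)) = (\<lambda>x. L (pd v f x))"
  by (rule ext, rule pd_eqI)
     (rule bounded_linear.has_derivative[OF assms(2) has_derivative_pd[OF assms(1)]])

lemma differentiable_bounded_linear:
  fixes f :: "'a::euclidean_space \<Rightarrow> complex" and L :: "complex \<Rightarrow> complex"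
  assumes "f differentiable_on UNIV" "bounded_linear L"
  shows "(\<lambda>x. L (f x)) differentiable_on UNIV"
  using bounded_linear.has_derivative[OF assms(2) has_derivative_pd[OF assms(1)]]
  unfolding differentiable_on_def differentiable_def by blast

text \<open>The multi-indices of order at most \<open>n\<close>. Each mixed derivative is represented by every order
  of differentiation, which keeps inductions over differentiation free of any reordering.\<close>

definition words :: "nat \<Rightarrow> 'a::euclidean_space list set" where
  "words n = {vs \<in> lists Basis. length vs \<le> n}"

lemma finite_words [simp]: "finite (words n)"
  unfolding words_def using finite_lists_length_le[OF finite_Basis, of n] by (simp add: in_lists_conv_set subset_eq)

lemma words_snoc: "vs @ [v] \<in> words n \<longleftrightarrow> v \<in> Basis \<and> n > 0 \<and> vs \<in> words (n - 1)"
  by (auto simp: words_def)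

lemma words_mono: "vs \<in> words m \<Longrightarrow> m \<le> n \<Longrightarrow> vs \<in> words n"
  by (auto simp: words_def)

lemma Nil_words [simp]: "[] \<in> words n"
  by (simp add: words_def)

lemma words_lists: "vs \<in> words n \<Longrightarrow> vs \<in> lists Basis"
  by (simp add: words_def)

text \<open>Grading smoothness by the number of derivatives turns the closure properties of smooth
  functions into inductions. Peeling off the innermost derivative first is what lets a product rule
  or a chain rule be applied once per step.\<close>

fun ksmooth :: "nat \<Rightarrow> ('a::euclidean_space \<Rightarrow> complex) \<Rightarrow> bool" where
  "ksmooth 0 f \<longleftrightarrow> True"
| "ksmooth (Suc n) f \<longleftrightarrow> f differentiable_on UNIV \<and> (\<forall>v\<in>Basis. ksmooth n (pd v f))"

lemma ksmooth_alt:
  "ksmooth n f \<longleftrightarrow> (\<forall>vs\<in>lists Basis. length vs < n \<longrightarrow> iter_deriv vs f differentiable_on UNIV)"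
proof (induction n arbitrary: f)
  case (Suc n)
  show ?case
  proof
    assume L: "ksmooth (Suc n) f"
    show "\<forall>vs\<in>lists Basis. length vs < Suc n \<longrightarrow> iter_deriv vs f differentiable_on UNIV"
    proof (intro ballI impI)
      fix vs :: "'a list" assume "vs \<in> lists Basis" "length vs < Suc n"
      then show "iter_deriv vs f differentiable_on UNIV"
        using L Suc.IH by (cases vs rule: rev_cases) (auto simp: iter_deriv_snoc)
    qed
  next
    assume R: "\<forall>vs\<in>lists Basis. length vs < Suc n \<longrightarrow> iter_deriv vs f differentiable_on UNIV"
    have "iter_deriv vs (pd v f) differentiable_on UNIV"
      if "vs \<in> lists Basis" "length vs < n" "v \<in> Basis" for vs v
      using R[rule_format, of "vs @ [v]"] that by (simp add: iter_deriv_snoc)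
    moreover have "f differentiable_on UNIV" using R[rule_format, of "[]"] by simp
    ultimately show "ksmooth (Suc n) f" using Suc.IH by auto
  qed
qed simp

lemma smooth_iff_ksmooth: "smooth f \<longleftrightarrow> (\<forall>n. ksmooth n f)"
  unfolding smooth_def ksmooth_alt by auto

lemma ksmooth_mono: "ksmooth n f \<Longrightarrow> m \<le> n \<Longrightarrow> ksmooth m f"
  unfolding ksmooth_alt by auto

lemma ksmooth_Suc: "ksmooth (Suc n) f \<Longrightarrow> ksmooth n f"
  by (rule ksmooth_mono[of "Suc n"]) (simp_all del: ksmooth.simps)

lemma smooth_differentiable: "smooth f \<Longrightarrow> f differentiable_on UNIV"
  using smooth_iff_ksmooth ksmooth.simps(2) by blast

lemma smooth_pd: "smooth f \<Longrightarrow> v \<in> Basis \<Longrightarrow> smooth (pd v f)"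
  using smooth_iff_ksmooth ksmooth.simps(2) by blast

lemma smooth_iter_deriv: "smooth f \<Longrightarrow> vs \<in> lists Basis \<Longrightarrow> smooth (iter_deriv vs f)"
  by (induction vs) (auto simp: iter_deriv_Cons smooth_pd)

lemma smoothI: "f differentiable_on UNIV \<Longrightarrow> (\<And>v. v \<in> Basis \<Longrightarrow> smooth (pd v f)) \<Longrightarrow> smooth f"
  unfolding smooth_iff_ksmooth by (metis ksmooth.elims(3))

lemma smooth_continuous: "smooth f \<Longrightarrow> continuous_on UNIV f"
  using smooth_differentiable differentiable_imp_continuous_on by blast

lemma smooth_measurable: "smooth f \<Longrightarrow> f \<in> borel_measurable borel"
  using smooth_continuous borel_measurable_continuous_onI by blast

lemma ksmooth_const: "ksmooth n (\<lambda>x. c)"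
  by (induction n arbitrary: c) auto

lemma ksmooth_add: "ksmooth n f \<Longrightarrow> ksmooth n g \<Longrightarrow> ksmooth n (\<lambda>x. f x + g x)"
  by (induction n arbitrary: f g) (auto simp: pd_add differentiable_on_add)

lemma ksmooth_mult: "ksmooth n f \<Longrightarrow> ksmooth n g \<Longrightarrow> ksmooth n (\<lambda>x. f x * g x)"
proof (induction n arbitrary: f g)
  case (Suc n)
  then show ?case
    using ksmooth_Suc[OF Suc.prems(1)] ksmooth_Suc[OF Suc.prems(2)]
    by (auto simp: pd_mult intro!: ksmooth_add Suc.IH differentiable_on_mult)
qed simp

lemma ksmooth_bounded_linear:
  "ksmooth n f \<Longrightarrow> bounded_linear L \<Longrightarrow> ksmooth n (\<lambda>x. L (f x))"
  by (induction n arbitrary: f) (auto simp: pd_bounded_linear differentiable_bounded_linear)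

lemma smooth_const: "smooth (\<lambda>x. c)"
  by (simp add: smooth_iff_ksmooth ksmooth_const)

lemma smooth_add: "smooth f \<Longrightarrow> smooth g \<Longrightarrow> smooth (\<lambda>x. f x + g x)"
  by (simp add: smooth_iff_ksmooth ksmooth_add)

lemma smooth_mult: "smooth f \<Longrightarrow> smooth g \<Longrightarrow> smooth (\<lambda>x. f x * g x)"
  by (simp add: smooth_iff_ksmooth ksmooth_mult)

lemma smooth_bounded_linear: "smooth f \<Longrightarrow> bounded_linear L \<Longrightarrow> smooth (\<lambda>x. L (f x))"
  by (simp add: smooth_iff_ksmooth ksmooth_bounded_linear)

lemma smooth_diff: "smooth f \<Longrightarrow> smooth g \<Longrightarrow> smooth (\<lambda>x. f x - g x)"
  using smooth_add[OF _ smooth_bounded_linear[OF _ bounded_linear_minus[OF bounded_linear_ident]]]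
  by fastforce

lemma smooth_cnj: "smooth f \<Longrightarrow> smooth (\<lambda>x. cnj (f x))"
  by (rule smooth_bounded_linear[OF _ bounded_linear_cnj])

lemma smooth_sum: "(\<And>i. i \<in> I \<Longrightarrow> smooth (f i)) \<Longrightarrow> smooth (\<lambda>x. \<Sum>i\<in>I. f i x)"
  by (induction I rule: infinite_finite_induct) (auto intro: smooth_add simp: smooth_const)

lemma smooth_linear:
  assumes "bounded_linear L" shows "smooth (L :: 'a::euclidean_space \<Rightarrow> complex)"
proof (rule smoothI)
  show "L differentiable_on UNIV"
    using bounded_linear_imp_has_derivative[OF assms] 
    unfolding differentiable_on_def differentiable_def by blast
  fix v :: 'a
  have "pd v L = (\<lambda>x. L v)"
    by (rule ext, rule pd_eqI, rule bounded_linear_imp_has_derivative[OF assms])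
  then show "smooth (pd v L)" by (simp add: smooth_const)
qed

text \<open>Multiplication by \<open>exp Q\<close> intertwines the partial derivative in direction \<open>v\<close> with this operator,
  so derivatives of \<open>g exp Q\<close> never leave the form \<open>h exp Q\<close>.\<close>

abbreviation exp_step ::
  "'a::euclidean_space \<Rightarrow> ('a \<Rightarrow> complex) \<Rightarrow> ('a \<Rightarrow> complex) \<Rightarrow> 'a \<Rightarrow> complex" where
  "exp_step v Q g \<equiv> (\<lambda>x. pd v g x + g x * pd v Q x)"

lemma has_derivative_mult_exp:
  assumes "g differentiable_on UNIV" "Q differentiable_on UNIV"
  shows "((\<lambda>x. g x * exp (Q x)) has_derivative (\<lambda>v. exp_step v Q g x * exp (Q x))) (at x)"
proof -
  have "((\<lambda>x. exp (Q x)) has_derivative (\<lambda>v. pd v Q x * exp (Q x))) (at x)"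
    using has_derivative_compose[OF has_derivative_pd[OF assms(2)]
        DERIV_exp[unfolded has_field_derivative_def]]
    by (simp add: mult.commute)
  from has_derivative_mult[OF has_derivative_pd[OF assms(1)] this]
  show ?thesis by (simp add: algebra_simps)
qed

lemma pd_mult_exp:
  assumes "g differentiable_on UNIV" "Q differentiable_on UNIV"
  shows "pd v (\<lambda>x. g x * exp (Q x)) = (\<lambda>x. exp_step v Q g x * exp (Q x))"
  by (rule ext, rule pd_eqI, rule has_derivative_mult_exp[OF assms])

lemma ksmooth_mult_exp:
  assumes Q: "smooth Q"
  shows "ksmooth n g \<Longrightarrow> ksmooth n (\<lambda>x. g x * exp (Q x))"
proof (induction n arbitrary: g)
  case (Suc n)
  have Qd: "Q differentiable_on UNIV" by (rule smooth_differentiable[OF Q])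
  have gd: "g differentiable_on UNIV" using Suc.prems by simp
  have 1: "(\<lambda>x. g x * exp (Q x)) differentiable_on UNIV"
    using has_derivative_mult_exp[OF gd Qd] unfolding differentiable_on_def differentiable_def by blast
  have "ksmooth n (pd v (\<lambda>x. g x * exp (Q x)))" if v: "v \<in> Basis" for v
    unfolding pd_mult_exp[OF gd Qd]
    using Suc.prems v smooth_pd[OF Q v]
    by (intro Suc.IH ksmooth_add ksmooth_mult) (auto simp: smooth_iff_ksmooth intro: ksmooth_Suc)
  with 1 show ?case by simp
qed simp

lemma smooth_mult_exp: "smooth g \<Longrightarrow> smooth Q \<Longrightarrow> smooth (\<lambda>x. g x * exp (Q x))"
  using ksmooth_mult_exp smooth_iff_ksmooth by blast

lemma smooth_exp: "smooth Q \<Longrightarrow> smooth (\<lambda>x. exp (Q x))"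
  using smooth_mult_exp[OF smooth_const[of 1]] by simp

text \<open>The amplitude that the chain rule produces in front of \<open>s'(q(x))\<close> when \<open>g(x) s(q(x))\<close> is
  differentiated.\<close>

abbreviation comp_step :: "'a::euclidean_space \<Rightarrow> ('a \<Rightarrow> real) \<Rightarrow> ('a \<Rightarrow> complex) \<Rightarrow> 'a \<Rightarrow> complex" where
  "comp_step v q g \<equiv> (\<lambda>x. g x * pd v (\<lambda>x. of_real (q x)) x)"

lemma has_derivative_mult_comp:
  assumes g: "g differentiable_on UNIV" and s: "s differentiable_on UNIV"
    and q: "(\<lambda>x. complex_of_real (q x)) differentiable_on UNIV"
  shows "((\<lambda>x. g x * s (q x)) has_derivative
     (\<lambda>v. pd v g x * s (q x) + comp_step v q g x * pd 1 s (q x))) (at x)"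
proof -
  let ?q' = "\<lambda>v. pd v (\<lambda>x. complex_of_real (q x)) x"
  have Re: "(q has_derivative (\<lambda>v. Re (?q' v))) (at x)"
    using bounded_linear.has_derivative[OF bounded_linear_Re has_derivative_pd[OF q, of x]] by simp
  have Req: "?q' v = of_real (Re (?q' v))" for v
    using pd_eqI[OF bounded_linear.has_derivative[OF bounded_linear_of_real Re], of v] by simp
  have s': "(s has_derivative (\<lambda>v. pd v s (q x))) (at (q x))"
    by (rule has_derivative_pd[OF s])
  have s1: "pd h s (q x) = of_real h * pd 1 s (q x)" for h
    using linear_scale[OF has_derivative_linear[OF s'], of h 1] by (simp add: scaleR_conv_of_real)
  have "((\<lambda>x. s (q x)) has_derivative (\<lambda>v. ?q' v * pd 1 s (q x))) (at x)"
    using has_derivative_compose[OF Re s'] by (subst Req) (subst (asm) s1, simp)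
  from has_derivative_mult[OF has_derivative_pd[OF g] this]
  show ?thesis by (simp add: algebra_simps)
qed

lemma pd_mult_comp:
  assumes "g differentiable_on UNIV" "s differentiable_on UNIV"
    and "(\<lambda>x. complex_of_real (q x)) differentiable_on UNIV"
  shows "pd v (\<lambda>x. g x * s (q x)) = (\<lambda>x. pd v g x * s (q x) + comp_step v q g x * pd 1 s (q x))"
  by (rule ext, rule pd_eqI, rule has_derivative_mult_comp[OF assms])

lemma ksmooth_mult_comp:
  assumes q: "smooth (\<lambda>x. complex_of_real (q x))"
  shows "smooth s \<Longrightarrow> ksmooth n g \<Longrightarrow> ksmooth n (\<lambda>x. g x * s (q x))"
proof (induction n arbitrary: g s)
  case (Suc n)
  have qd: "(\<lambda>x. complex_of_real (q x)) differentiable_on UNIV" by (rule smooth_differentiable[OF q])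
  have sd: "s differentiable_on UNIV" by (rule smooth_differentiable[OF Suc.prems(1)])
  have gd: "g differentiable_on UNIV" using Suc.prems by simp
  have 1: "(\<lambda>x. g x * s (q x)) differentiable_on UNIV"
    using has_derivative_mult_comp[OF gd sd qd] unfolding differentiable_on_def differentiable_def by blast
  have "ksmooth n (pd v (\<lambda>x. g x * s (q x)))" if v: "v \<in> Basis" for v
    unfolding pd_mult_comp[OF gd sd qd]
    using Suc.prems v smooth_pd[OF q v] smooth_pd[OF Suc.prems(1), of 1]
    by (intro Suc.IH ksmooth_add ksmooth_mult) (auto simp: smooth_iff_ksmooth intro: ksmooth_Suc)
  with 1 show ?case by simp
qed simp

lemma smooth_comp:
  "smooth s \<Longrightarrow> smooth (\<lambda>x. complex_of_real (q x)) \<Longrightarrow> smooth (\<lambda>x. s (q x))"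
  using ksmooth_mult_comp[of q s _ "\<lambda>_. 1"] by (simp add: smooth_iff_ksmooth ksmooth_const)

lemma iter_deriv_add:
  assumes "smooth f" "smooth g" "vs \<in> lists Basis"
  shows "iter_deriv vs (\<lambda>x. f x + g x) = (\<lambda>x. iter_deriv vs f x + iter_deriv vs g x)"
  using assms(3)
  by (induction vs)
     (simp_all add: iter_deriv_Cons pd_add smooth_differentiable smooth_iter_deriv assms)

lemma iter_deriv_bounded_linear:
  assumes "smooth f" "bounded_linear L" "vs \<in> lists Basis"
  shows "iter_deriv vs (\<lambda>x. L (f x)) = (\<lambda>x. L (iter_deriv vs f x))"
  using assms(3)
  by (induction vs)
     (simp_all add: iter_deriv_Cons pd_bounded_linear smooth_differentiable smooth_iter_deriv assms)

lemma iter_deriv_cmult: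
  "smooth f \<Longrightarrow> vs \<in> lists Basis \<Longrightarrow> iter_deriv vs (\<lambda>x. c * f x) = (\<lambda>x. c * iter_deriv vs f x)"
  by (rule iter_deriv_bounded_linear[OF _ bounded_linear_mult_right])

lemma iter_deriv_minus:
  "smooth f \<Longrightarrow> vs \<in> lists Basis \<Longrightarrow> iter_deriv vs (\<lambda>x. - f x) = (\<lambda>x. - iter_deriv vs f x)"
  by (rule iter_deriv_bounded_linear[OF _ bounded_linear_minus[OF bounded_linear_ident]])

lemma iter_deriv_diff:
  assumes "smooth f" "smooth g" "vs \<in> lists Basis"
  shows "iter_deriv vs (\<lambda>x. f x - g x) = (\<lambda>x. iter_deriv vs f x - iter_deriv vs g x)"
  using iter_deriv_add[OF assms(1) smooth_bounded_linear[OF assms(2)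
        bounded_linear_minus[OF bounded_linear_ident]] assms(3)] iter_deriv_minus[OF assms(2,3)]
  by simp

text \<open>By the product rule each differentiation at most doubles the number of terms, hence the factor
  \<open>2 ^ n\<close>. The bounds are required at the point \<open>x\<close> only, so that weights depending on \<open>x\<close> can be
  inserted for \<open>A\<close> and \<open>B\<close>.\<close>

lemma iter_deriv_mult_bound:
  assumes "smooth f" "smooth g" "vs \<in> words n"
    and "\<And>ws. ws \<in> words n \<Longrightarrow> norm (iter_deriv ws f x) \<le> A"
    and "\<And>ws. ws \<in> words n \<Longrightarrow> norm (iter_deriv ws g x) \<le> B"
  shows "norm (iter_deriv vs (\<lambda>x. f x * g x) x) \<le> 2 ^ n * (A * B)"
  using assms
proof (induction n arbitrary: f g vs)
  case 0
  then have "vs = []" by (simp add: words_def)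
  moreover have "norm (f x) \<le> A" "norm (g x) \<le> B"
    using 0(4)[of "[]"] 0(5)[of "[]"] by simp_all
  ultimately show ?case by (auto simp: norm_mult intro!: mult_mono order_trans[OF norm_ge_zero])
next
  case (Suc n)
  have A0: "0 \<le> A" using Suc.prems(4)[of "[]"] norm_ge_zero order_trans by (simp, blast)
  have B0: "0 \<le> B" using Suc.prems(5)[of "[]"] norm_ge_zero order_trans by (simp, blast)
  have sub: "ws \<in> words n \<Longrightarrow> ws \<in> words (Suc n)" for ws :: "'a list"
    by (rule words_mono) auto
  show ?case
  proof (cases vs rule: rev_cases)
    case Nil
    have "norm (f x) \<le> A" "norm (g x) \<le> B"
      using Suc.prems(4)[of "[]"] Suc.prems(5)[of "[]"] by simp_all
    then have "norm (f x * g x) \<le> A * B" using A0 by (auto simp: norm_mult intro!: mult_mono)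
    also have "\<dots> \<le> 2 ^ Suc n * (A * B)"
      using mult_right_mono[of 1 "2 ^ Suc n" "A * B"] A0 B0 by (simp add: one_le_power del: power_Suc)
    finally show ?thesis using Nil by simp
  next
    case (snoc us v)
    have v: "v \<in> Basis" and us: "us \<in> words n" using Suc.prems(3) snoc by (auto simp: words_snoc)
    have sm: "smooth (pd v f)" "smooth (pd v g)" using Suc.prems v smooth_pd by auto
    have 1: "norm (iter_deriv us (\<lambda>x. pd v f x * g x) x) \<le> 2 ^ n * (A * B)"
      using Suc.prems(4)[of "_ @ [v]"] Suc.prems v sm sub us
      by (intro Suc.IH) (auto simp: iter_deriv_snoc words_snoc)
    have 2: "norm (iter_deriv us (\<lambda>x. f x * pd v g x) x) \<le> 2 ^ n * (A * B)"
      using Suc.prems(5)[of "_ @ [v]"] Suc.prems v sm sub us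
      by (intro Suc.IH) (auto simp: iter_deriv_snoc words_snoc)
    have "iter_deriv vs (\<lambda>x. f x * g x) x =
        iter_deriv us (\<lambda>x. pd v f x * g x) x + iter_deriv us (\<lambda>x. f x * pd v g x) x"
      using Suc.prems sm us unfolding snoc iter_deriv_snoc
      by (simp add: pd_mult smooth_differentiable iter_deriv_add smooth_mult words_lists)
    then show ?thesis using norm_triangle_mono[OF 1 2] by (simp add: algebra_simps)
  qed
qed

section \<open>Slowly increasing functions\<close>

text \<open>Smooth functions all of whose derivatives grow at most polynomially: the multipliers of Schwartz
  space. The natural index makes the bounds uniform along a sequence, as needed for cutoffs that
  exhaust the space; a single function is a constant sequence.\<close>

definition slow :: "(nat \<Rightarrow> 'a::euclidean_space \<Rightarrow> complex) \<Rightarrow> bool" where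
  "slow g \<longleftrightarrow> (\<forall>n. smooth (g n)) \<and>
     (\<forall>N. \<exists>C k. \<forall>n. \<forall>vs\<in>words N. \<forall>x. norm (iter_deriv vs (g n) x) \<le> C * (1 + norm x) ^ k)"

lemma slow_smooth: "slow g \<Longrightarrow> smooth (g n)"
  by (simp add: slow_def)

lemma slowD:
  assumes "slow g"
  shows "\<exists>C k. C \<ge> 0 \<and>
    (\<forall>n. \<forall>vs\<in>words N. \<forall>x. norm (iter_deriv vs (g n) x) \<le> C * (1 + norm x) ^ k)"
proof -
  obtain C k where C: "\<forall>n. \<forall>vs\<in>words N. \<forall>x. norm (iter_deriv vs (g n) x) \<le> C * (1 + norm x) ^ k"
    using assms unfolding slow_def by blast
  have "norm (iter_deriv [] (g 0) 0) \<le> C * (1 + norm (0::'a)) ^ k" using C Nil_words by blast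
  then have "norm (g 0 0) \<le> C" by simp
  then have "C \<ge> 0" using norm_ge_zero[of "g 0 0"] by linarith
  then show ?thesis using C by blast
qed

lemma slowI:
  assumes "\<And>n. smooth (g n)"
    and "\<And>vs. vs \<in> lists Basis \<Longrightarrow> \<exists>C k. \<forall>n x. norm (iter_deriv vs (g n) x) \<le> C * (1 + norm x) ^ k"
  shows "slow g"
  unfolding slow_def
proof (intro conjI allI assms(1))
  fix N :: nat
  obtain C k where Ck: "\<And>vs n x. vs \<in> lists Basis \<Longrightarrow>
      norm (iter_deriv vs (g n) x) \<le> C vs * (1 + norm x) ^ k vs"
    using assms(2) by metis
  have "norm (iter_deriv vs (g n) x) \<le> (\<Sum>ws\<in>words N. \<bar>C ws\<bar>) * (1 + norm x) ^ (\<Sum>ws\<in>words N. k ws)"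
    if "vs \<in> words N" for n vs and x :: 'a
  proof -
    have "norm (iter_deriv vs (g n) x) \<le> C vs * (1 + norm x) ^ k vs"
      using Ck that words_lists by blast
    also have "\<dots> \<le> \<bar>C vs\<bar> * (1 + norm x) ^ k vs" by (intro mult_right_mono) auto
    also have "\<dots> \<le> (\<Sum>ws\<in>words N. \<bar>C ws\<bar>) * (1 + norm x) ^ (\<Sum>ws\<in>words N. k ws)"
      using that by (intro mult_mono power_increasing member_le_sum sum_nonneg) auto
    finally show ?thesis .
  qed
  then show "\<exists>C k. \<forall>n. \<forall>vs\<in>words N. \<forall>x. norm (iter_deriv vs (g n) x) \<le> C * (1 + norm x) ^ k"
    by blast
qed

lemma slow_step:
  assumes d: "\<And>n. g n differentiable_on UNIV"
    and b: "\<And>n x. norm (g n x) \<le> C * (1 + norm x) ^ k"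
    and p: "\<And>v. v \<in> Basis \<Longrightarrow> slow (\<lambda>n. pd v (g n))"
  shows "slow g"
proof (rule slowI)
  show "smooth (g n)" for n using d p smoothI slow_smooth by blast
  fix vs :: "'a list" assume vs: "vs \<in> lists Basis"
  show "\<exists>C k. \<forall>n x. norm (iter_deriv vs (g n) x) \<le> C * (1 + norm x) ^ k"
  proof (cases vs rule: rev_cases)
    case Nil
    then show ?thesis using b by auto
  next
    case (snoc us v)
    then have "us \<in> words (length us)" "v \<in> Basis" using vs by (auto simp: words_def)
    moreover obtain C k where "\<And>n vs x. vs \<in> words (length us) \<Longrightarrow>
        norm (iter_deriv vs (pd v (g n)) x) \<le> C * (1 + norm x) ^ k"
      using slowD[OF p[OF \<open>v \<in> Basis\<close>], of "length us"] by blast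
    ultimately have "norm (iter_deriv us (pd v (g n)) x) \<le> C * (1 + norm x) ^ k" for n x by blast
    then show ?thesis unfolding snoc iter_deriv_snoc by blast
  qed
qed

lemma slow_pd: "slow g \<Longrightarrow> v \<in> Basis \<Longrightarrow> slow (\<lambda>n. pd v (g n))"
proof (rule slowI)
  assume g: "slow g" and v: "v \<in> Basis"
  then show "smooth (pd v (g n))" for n using slow_smooth smooth_pd by blast
  fix vs :: "'a list" assume "vs \<in> lists Basis"
  then have "vs @ [v] \<in> words (Suc (length vs))" using v by (auto simp: words_def)
  moreover obtain C k where "\<And>n ws x. ws \<in> words (Suc (length vs)) \<Longrightarrow>
      norm (iter_deriv ws (g n) x) \<le> C * (1 + norm x) ^ k"
    using slowD[OF g, of "Suc (length vs)"] by blast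
  ultimately have "norm (iter_deriv (vs @ [v]) (g n) x) \<le> C * (1 + norm x) ^ k" for n x by blast
  then show "\<exists>C k. \<forall>n x. norm (iter_deriv vs (pd v (g n)) x) \<le> C * (1 + norm x) ^ k"
    unfolding iter_deriv_snoc by blast
qed

lemma slow_zero: "slow (\<lambda>n x. 0)"
proof (rule slowI)
  fix vs :: "'a list" assume "vs \<in> lists Basis"
  then have "iter_deriv vs (\<lambda>x. 0) = (\<lambda>x. 0)"
    by (induction vs) (auto simp: iter_deriv_Cons)
  then show "\<exists>C k. \<forall>n x. norm (iter_deriv vs (\<lambda>x. 0) (x::'a)) \<le> C * (1 + norm x) ^ k"
    by (intro exI[of _ 0]) auto
qed (rule smooth_const)

lemma slow_const: "slow (\<lambda>n x. c)"
  by (rule slow_step[where C="norm c" and k=0]) (auto simp: slow_zero)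

lemma slow_bounded_linear:
  assumes "bounded_linear L" shows "slow (\<lambda>n. L :: 'a::euclidean_space \<Rightarrow> complex)"
proof -
  obtain K where K: "\<And>x. norm (L x) \<le> norm x * K" "K \<ge> 0"
    using bounded_linear.nonneg_bounded[OF assms] by blast
  have pd: "pd v L = (\<lambda>x. L v)" for v
    by (rule ext, rule pd_eqI, rule bounded_linear_imp_has_derivative[OF assms])
  show ?thesis
  proof (rule slow_step)
    show "L differentiable_on UNIV" using smooth_linear[OF assms] smooth_differentiable by blast
    show "norm (L x) \<le> K * (1 + norm x) ^ 1" for x
      using K(1)[of x] K(2) by (simp add: algebra_simps)
  qed (simp add: pd slow_const)
qed

lemma slow_add:
  assumes "slow f" "slow g" shows "slow (\<lambda>n x. f n x + g n x)"
proof (rule slowI)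
  show "smooth (\<lambda>x. f n x + g n x)" for n by (intro smooth_add slow_smooth assms)
  fix vs :: "'a list" assume vs: "vs \<in> lists Basis"
  then have w: "vs \<in> words (length vs)" by (simp add: words_def)
  obtain C k where C: "C \<ge> 0" "\<And>n x. norm (iter_deriv vs (f n) x) \<le> C * (1 + norm x) ^ k"
    using slowD[OF assms(1), of "length vs"] w by blast
  obtain D l where D: "D \<ge> 0" "\<And>n x. norm (iter_deriv vs (g n) x) \<le> D * (1 + norm x) ^ l"
    using slowD[OF assms(2), of "length vs"] w by blast
  have "norm (iter_deriv vs (\<lambda>x. f n x + g n x) x) \<le> (C + D) * (1 + norm x) ^ (k + l)" for n x
  proof -
    have "norm (iter_deriv vs (\<lambda>x. f n x + g n x) x) \<le> C * (1 + norm x) ^ k + D * (1 + norm x) ^ l"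
      using C(2)[of n x] D(2)[of n x] vs assms
      by (simp add: iter_deriv_add slow_smooth norm_triangle_mono)
    also have "\<dots> \<le> C * (1 + norm x) ^ (k + l) + D * (1 + norm x) ^ (k + l)"
      using C(1) D(1) by (intro add_mono mult_left_mono power_increasing) auto
    finally show ?thesis by (simp add: algebra_simps)
  qed
  then show "\<exists>C k. \<forall>n x. norm (iter_deriv vs (\<lambda>x. f n x + g n x) x) \<le> C * (1 + norm x) ^ k" by blast
qed

lemma slow_mult:
  assumes "slow f" "slow g" shows "slow (\<lambda>n x. f n x * g n x)"
proof (rule slowI)
  show "smooth (\<lambda>x. f n x * g n x)" for n by (intro smooth_mult slow_smooth assms)
  fix vs :: "'a list" assume vs: "vs \<in> lists Basis"
  let ?N = "length vs"
  have w: "vs \<in> words ?N" using vs by (simp add: words_def)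
  obtain C k where C: "\<And>n vs x. vs \<in> words ?N \<Longrightarrow> norm (iter_deriv vs (f n) x) \<le> C * (1 + norm x) ^ k"
    using slowD[OF assms(1), of ?N] by blast
  obtain D l where D: "\<And>n vs x. vs \<in> words ?N \<Longrightarrow> norm (iter_deriv vs (g n) x) \<le> D * (1 + norm x) ^ l"
    using slowD[OF assms(2), of ?N] by blast
  have "norm (iter_deriv vs (\<lambda>x. f n x * g n x) x) \<le> (2 ^ ?N * C * D) * (1 + norm x) ^ (k + l)" for n x
    using iter_deriv_mult_bound[OF slow_smooth[OF assms(1)] slow_smooth[OF assms(2)] w C D]
    by (simp add: algebra_simps power_add)
  then show "\<exists>C k. \<forall>n x. norm (iter_deriv vs (\<lambda>x. f n x * g n x) x) \<le> C * (1 + norm x) ^ k" by blast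
qed

lemma slow_uminus: "slow f \<Longrightarrow> slow (\<lambda>n x. - f n x)"
  using slow_mult[OF slow_const[of "-1"]] by simp

lemma slow_diff: "slow f \<Longrightarrow> slow g \<Longrightarrow> slow (\<lambda>n x. f n x - g n x)"
  using slow_add[OF _ slow_uminus] by simp

lemma slow_power: "slow f \<Longrightarrow> slow (\<lambda>n x. f n x ^ k)"
  by (induction k) (auto intro: slow_mult slow_const)

lemma slow_sum: "(\<And>i. i \<in> I \<Longrightarrow> slow (f i)) \<Longrightarrow> slow (\<lambda>n x. \<Sum>i\<in>I. f i n x)"
  by (induction I rule: infinite_finite_induct) (auto intro: slow_add simp: slow_zero)

lemma slow_inner: "slow (\<lambda>n x. complex_of_real (x \<bullet> v))"
  by (intro slow_bounded_linear bounded_linear_compose[OF bounded_linear_of_real bounded_linear_inner_left])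

text \<open>This one estimate yields both the multiplier property of imaginary exponentials, where the last
  factor is \<open>1\<close>, and the Schwartz property of complex Gaussians, where it decays.\<close>

lemma iter_deriv_mult_exp_bound:
  assumes Q: "slow (\<lambda>n. Q)" and vs: "vs \<in> lists Basis"
  shows "slow (\<lambda>n. g) \<Longrightarrow> \<exists>C k. \<forall>x. norm (iter_deriv vs (\<lambda>x. g x * exp (Q x)) x)
            \<le> C * (1 + norm x) ^ k * exp (Re (Q x))"
  using vs
proof (induction vs arbitrary: g rule: rev_induct)
  case Nil
  obtain C k where "\<And>vs x. vs \<in> words 0 \<Longrightarrow> norm (iter_deriv vs g x) \<le> C * (1 + norm x) ^ k"
    using slowD[OF Nil(1), of 0] by blast
  from this[of "[]"] have "norm (g x) \<le> C * (1 + norm x) ^ k" for x by simp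
  then show ?case by (auto simp: norm_mult intro!: exI mult_right_mono)
next
  case (snoc v us)
  have v: "v \<in> Basis" and us: "us \<in> lists Basis" using snoc.prems by auto
  have d: "g differentiable_on UNIV" "Q differentiable_on UNIV"
    using slow_smooth[OF snoc.prems(1)] slow_smooth[OF Q] smooth_differentiable by auto
  have "slow (\<lambda>n. exp_step v Q g)"
    by (intro slow_add slow_mult slow_pd[OF _ v] Q snoc.prems)
  from snoc.IH[OF this us] show ?case
    by (simp add: iter_deriv_snoc pd_mult_exp[OF d])
qed

lemma slow_exp_imaginary:
  assumes "slow (\<lambda>n. Q)" "\<And>x. Re (Q x) = 0"
  shows "slow (\<lambda>n x. exp (Q x))"
proof (rule slowI)
  show "smooth (\<lambda>x. exp (Q x))" by (intro smooth_exp slow_smooth[OF assms(1)])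
  fix vs :: "'a list" assume "vs \<in> lists Basis"
  from iter_deriv_mult_exp_bound[OF assms(1) this slow_const[of 1]] assms(2)
  show "\<exists>C k. \<forall>n x. norm (iter_deriv vs (\<lambda>x. exp (Q x)) x) \<le> C * (1 + norm x) ^ k" by simp
qed

section \<open>Schwartz functions\<close>

text \<open>A bound on the \<open>N\<close>-th of an increasing sequence of norms that define the topology of Schwartz
  space, in which weight and order of differentiation grow together. As a predicate in the bound \<open>c\<close>
  it avoids suprema.\<close>

definition sbound :: "nat \<Rightarrow> real \<Rightarrow> ('a::euclidean_space \<Rightarrow> complex) \<Rightarrow> bool" where
  "sbound N c f \<longleftrightarrow> (\<forall>vs\<in>words N. \<forall>x. (1 + norm x) ^ N * norm (iter_deriv vs f x) \<le> c)"

lemma sboundD: "sbound N c f \<Longrightarrow> vs \<in> words N \<Longrightarrow> (1 + norm x) ^ N * norm (iter_deriv vs f x) \<le> c"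
  by (simp add: sbound_def)

lemma sbound_nonneg: "sbound N c f \<Longrightarrow> c \<ge> 0"
proof -
  assume "sbound N c f"
  from sboundD[OF this Nil_words, of 0] have "norm (f 0) \<le> c" by simp
  then show "c \<ge> 0" using norm_ge_zero[of "f 0"] by linarith
qed

lemma sbound_mono: "sbound N c f \<Longrightarrow> c \<le> d \<Longrightarrow> sbound N d f"
  unfolding sbound_def by (meson order_trans)

lemma sbound_mono_index:
  assumes "sbound N c f" "M \<le> N" shows "sbound M c f"
  unfolding sbound_def
proof (intro ballI allI)
  fix vs :: "'a list" and x :: 'a assume "vs \<in> words M"
  then have "vs \<in> words N" using assms(2) words_mono by blast
  have "(1 + norm x) ^ M * norm (iter_deriv vs f x) \<le> (1 + norm x) ^ N * norm (iter_deriv vs f x)"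
    using assms(2) by (intro mult_right_mono power_increasing) auto
  also have "\<dots> \<le> c" using sboundD[OF assms(1) \<open>vs \<in> words N\<close>] .
  finally show "(1 + norm x) ^ M * norm (iter_deriv vs f x) \<le> c" .
qed

lemma schwartz_iff_sbound: "f \<in> schwartz \<longleftrightarrow> smooth f \<and> (\<forall>N. \<exists>c. sbound N c f)"
proof (intro iffI conjI allI)
  assume f: "f \<in> schwartz"
  then show "smooth f" by (simp add: schwartz_def)
  fix N :: nat
  have "\<exists>B. \<forall>x. norm x ^ k * norm (iter_deriv vs f x) \<le> B" if "vs \<in> lists Basis" for k vs
  proof -
    have "bounded (range (\<lambda>x. norm x ^ k *\<^sub>R iter_deriv vs f x))"
      using f that by (simp add: schwartz_def)
    then show ?thesis unfolding bounded_iff by auto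
  qed
  then have "\<forall>k vs. \<exists>B. \<forall>x. vs \<in> lists Basis \<longrightarrow> norm x ^ k * norm (iter_deriv vs f x) \<le> B" by blast
  then obtain B where B: "\<And>k vs x. vs \<in> lists Basis \<Longrightarrow> norm x ^ k * norm (iter_deriv vs f x) \<le> B k vs"
    by metis
  have "sbound N (2 ^ N * (\<Sum>ws\<in>words N. \<bar>B 0 ws\<bar> + \<bar>B N ws\<bar>)) f"
    unfolding sbound_def
  proof (intro ballI allI)
    fix vs :: "'a list" and x :: 'a assume vs: "vs \<in> words N"
    have "(1 + norm x) ^ N \<le> (2 * max 1 (norm x)) ^ N" by (intro power_mono) auto
    also have "\<dots> = 2 ^ N * max 1 (norm x) ^ N" by (simp add: power_mult_distrib)
    also have "max 1 (norm x) ^ N \<le> 1 + norm x ^ N" by (auto simp: max_def)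
    finally have "(1 + norm x) ^ N * norm (iter_deriv vs f x) \<le>
        2 ^ N * (1 + norm x ^ N) * norm (iter_deriv vs f x)" by (simp add: mult_right_mono)
    also have "\<dots> = 2 ^ N * (norm x ^ 0 * norm (iter_deriv vs f x) + norm x ^ N * norm (iter_deriv vs f x))"
      by (simp add: algebra_simps)
    also have "\<dots> \<le> 2 ^ N * (\<bar>B 0 vs\<bar> + \<bar>B N vs\<bar>)"
      using B[OF words_lists[OF vs], of x 0] B[OF words_lists[OF vs], of x N]
      by (intro mult_left_mono add_mono) auto
    also have "\<dots> \<le> 2 ^ N * (\<Sum>ws\<in>words N. \<bar>B 0 ws\<bar> + \<bar>B N ws\<bar>)"
      using vs by (intro mult_left_mono member_le_sum[where f="\<lambda>ws. \<bar>B 0 ws\<bar> + \<bar>B N ws\<bar>"]) auto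
    finally show "(1 + norm x) ^ N * norm (iter_deriv vs f x) \<le> \<dots>" .
  qed
  then show "\<exists>c. sbound N c f" by blast
next
  assume f: "smooth f \<and> (\<forall>N. \<exists>c. sbound N c f)"
  show "f \<in> schwartz" unfolding schwartz_def
  proof (intro CollectI conjI allI ballI)
    show "smooth f" using f by simp
    fix k and vs :: "'a list" assume vs: "vs \<in> lists Basis"
    let ?N = "max k (length vs)"
    have w: "vs \<in> words ?N" using vs by (simp add: words_def)
    obtain c where c: "sbound ?N c f" using f by blast
    have "norm (norm x ^ k *\<^sub>R iter_deriv vs f x) \<le> c" for x
    proof -
      have "norm x ^ k \<le> (1 + norm x) ^ k" by (intro power_mono) auto
      also have "\<dots> \<le> (1 + norm x) ^ ?N" by (intro power_increasing) auto
      finally have "norm x ^ k * norm (iter_deriv vs f x) \<le> (1 + norm x) ^ ?N * norm (iter_deriv vs f x)"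
        by (intro mult_right_mono) auto
      then show ?thesis using sboundD[OF c w, of x] by simp
    qed
    then show "bounded (range (\<lambda>x. norm x ^ k *\<^sub>R iter_deriv vs f x))"
      unfolding bounded_iff by auto
  qed
qed

lemma schwartz_smooth: "f \<in> schwartz \<Longrightarrow> smooth f"
  by (simp add: schwartz_iff_sbound)

lemma schwartz_sbound: "f \<in> schwartz \<Longrightarrow> \<exists>c. sbound N c f"
  by (simp add: schwartz_iff_sbound)

lemma schwartzI_words:
  assumes "smooth f"
    and "\<And>vs k. vs \<in> lists Basis \<Longrightarrow> \<exists>C. \<forall>x. (1 + norm x) ^ k * norm (iter_deriv vs f x) \<le> C"
  shows "f \<in> schwartz"
  unfolding schwartz_iff_sbound
proof (intro conjI allI assms(1))
  fix N
  have "\<forall>k vs. \<exists>B. \<forall>x. vs \<in> lists Basis \<longrightarrow> (1 + norm x) ^ k * norm (iter_deriv vs f x) \<le> B"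
    using assms(2) by blast
  then obtain B where B: "\<And>k vs x. vs \<in> lists Basis \<Longrightarrow> (1 + norm x) ^ k * norm (iter_deriv vs f x) \<le> B k vs"
    by metis
  have "sbound N (\<Sum>ws\<in>words N. \<bar>B N ws\<bar>) f" unfolding sbound_def
  proof (intro ballI allI)
    fix vs :: "'a list" and x :: 'a assume vs: "vs \<in> words N"
    have "(1 + norm x) ^ N * norm (iter_deriv vs f x) \<le> \<bar>B N vs\<bar>"
      using B[OF words_lists[OF vs], of x N] by simp
    also have "\<dots> \<le> (\<Sum>ws\<in>words N. \<bar>B N ws\<bar>)" using vs by (intro member_le_sum) auto
    finally show "(1 + norm x) ^ N * norm (iter_deriv vs f x) \<le> \<dots>" .
  qed
  then show "\<exists>c. sbound N c f" by blast
qed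

lemma sbound_add:
  assumes "smooth f" "smooth g" "sbound N c f" "sbound N d g"
  shows "sbound N (c + d) (\<lambda>x. f x + g x)"
  unfolding sbound_def
proof (intro ballI allI)
  fix vs :: "'a list" and x :: 'a assume vs: "vs \<in> words N"
  have "(1 + norm x) ^ N * norm (iter_deriv vs (\<lambda>x. f x + g x) x) \<le>
     (1 + norm x) ^ N * (norm (iter_deriv vs f x) + norm (iter_deriv vs g x))"
    using iter_deriv_add[OF assms(1,2) words_lists[OF vs]] by (intro mult_left_mono) (auto simp: norm_triangle_ineq)
  also have "\<dots> \<le> c + d" using sboundD[OF assms(3) vs, of x] sboundD[OF assms(4) vs, of x]
    by (simp add: algebra_simps)
  finally show "(1 + norm x) ^ N * norm (iter_deriv vs (\<lambda>x. f x + g x) x) \<le> c + d" .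
qed

lemma sbound_cmult:
  assumes "smooth f" "sbound N c f" shows "sbound N (norm a * c) (\<lambda>x. a * f x)"
  unfolding sbound_def
proof (intro ballI allI)
  fix vs :: "'a list" and x :: 'a assume vs: "vs \<in> words N"
  have "(1 + norm x) ^ N * norm (iter_deriv vs (\<lambda>x. a * f x) x) = 
     norm a * ((1 + norm x) ^ N * norm (iter_deriv vs f x))"
    using iter_deriv_cmult[OF assms(1) words_lists[OF vs]] by (simp add: norm_mult algebra_simps)
  also have "\<dots> \<le> norm a * c" using sboundD[OF assms(2) vs, of x] by (intro mult_left_mono) auto
  finally show "(1 + norm x) ^ N * norm (iter_deriv vs (\<lambda>x. a * f x) x) \<le> norm a * c" .
qed

lemma sbound_cnj:
  assumes "smooth f" "sbound N c f" shows "sbound N c (\<lambda>x. cnj (f x))"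
  using assms unfolding sbound_def
  by (simp add: iter_deriv_bounded_linear[OF _ bounded_linear_cnj] words_lists)

lemma schwartz_add: "f \<in> schwartz \<Longrightarrow> g \<in> schwartz \<Longrightarrow> (\<lambda>x. f x + g x) \<in> schwartz"
  unfolding schwartz_iff_sbound using sbound_add smooth_add by blast

lemma schwartz_cmult: "f \<in> schwartz \<Longrightarrow> (\<lambda>x. a * f x) \<in> schwartz"
  unfolding schwartz_iff_sbound using sbound_cmult smooth_mult[OF smooth_const] by blast

lemma schwartz_diff: "f \<in> schwartz \<Longrightarrow> g \<in> schwartz \<Longrightarrow> (\<lambda>x. f x - g x) \<in> schwartz"
  using schwartz_add[OF _ schwartz_cmult[of g "-1"]] by simp

lemma schwartz_cnj: "f \<in> schwartz \<Longrightarrow> (\<lambda>x. cnj (f x)) \<in> schwartz"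
  unfolding schwartz_iff_sbound using sbound_cnj smooth_cnj by blast

lemma schwartz_zero: "(\<lambda>x. 0) \<in> schwartz"
proof (rule schwartzI_words[OF smooth_const])
  fix vs :: "'a list" and k assume vs: "vs \<in> lists Basis"
  have "iter_deriv vs (\<lambda>x. 0) = (\<lambda>x. 0)" using iter_deriv_cmult[OF smooth_const[of 0] vs, of 0] by simp
  then show "\<exists>C. \<forall>x. (1 + norm x) ^ k * norm (iter_deriv vs (\<lambda>x. 0) x) \<le> C" by auto
qed

lemma sbound_pd:
  assumes "sbound (Suc N) c f" "v \<in> Basis" shows "sbound N c (pd v f)"
  unfolding sbound_def
proof (intro ballI allI)
  fix vs :: "'a list" and x :: 'a assume "vs \<in> words N"
  then have w: "vs @ [v] \<in> words (Suc N)" using assms(2) by (simp add: words_snoc)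
  have "(1 + norm x) ^ N * norm (iter_deriv vs (pd v f) x) \<le> (1 + norm x) ^ Suc N * norm (iter_deriv vs (pd v f) x)"
    by (intro mult_right_mono power_increasing) auto
  also have "\<dots> \<le> c" using sboundD[OF assms(1) w] by (simp add: iter_deriv_snoc)
  finally show "(1 + norm x) ^ N * norm (iter_deriv vs (pd v f) x) \<le> c" .
qed

lemma schwartz_pd: "f \<in> schwartz \<Longrightarrow> v \<in> Basis \<Longrightarrow> pd v f \<in> schwartz"
  unfolding schwartz_iff_sbound using smooth_pd sbound_pd by blast

lemma sbound_mult_slow:
  assumes "slow m"
  shows "\<exists>C M. C \<ge> 0 \<and>
    (\<forall>n f c. smooth f \<longrightarrow> sbound M c f \<longrightarrow> sbound N (C * c) (\<lambda>x. m n x * f x))"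
proof -
  obtain C k where C: "C \<ge> 0"
    "\<And>n vs x. vs \<in> words N \<Longrightarrow> norm (iter_deriv vs (m n) x) \<le> C * (1 + norm x) ^ k"
    using slowD[OF assms, of N] by blast
  show ?thesis
  proof (intro exI[of _ "2 ^ N * C"] exI[of _ "N + k"] conjI allI impI)
    show "2 ^ N * C \<ge> 0" using C by simp
    fix n c and f :: "'a \<Rightarrow> complex" assume f: "smooth f" and b: "sbound (N + k) c f"
    show "sbound N (2 ^ N * C * c) (\<lambda>x. m n x * f x)" unfolding sbound_def
    proof (intro ballI allI)
      fix vs :: "'a list" and x :: 'a assume vs: "vs \<in> words N"
      have pos: "(1 + norm x) > 0" using norm_ge_zero[of x] by linarith
      have "norm (iter_deriv ws f x) \<le> c / (1 + norm x) ^ (N + k)" if "ws \<in> words N" for ws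
        using sboundD[OF b words_mono[OF that]] pos by (simp add: field_simps)
      from iter_deriv_mult_bound[OF slow_smooth[OF assms] f vs C(2) this]
      have "norm (iter_deriv vs (\<lambda>x. m n x * f x) x) \<le>
        2 ^ N * (C * (1 + norm x) ^ k * (c / (1 + norm x) ^ (N + k)))" .
      also have "\<dots> = 2 ^ N * C * c / (1 + norm x) ^ N" using pos by (simp add: power_add)
      finally show "(1 + norm x) ^ N * norm (iter_deriv vs (\<lambda>x. m n x * f x) x) \<le> 2 ^ N * C * c"
        using pos by (simp add: field_simps)
    qed
  qed
qed

lemma schwartz_mult_slow:
  assumes "slow m" "f \<in> schwartz" shows "(\<lambda>x. m n x * f x) \<in> schwartz"
  unfolding schwartz_iff_sbound
proof (intro conjI allI)
  show "smooth (\<lambda>x. m n x * f x)" using assms slow_smooth schwartz_smooth smooth_mult by blast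
  show "\<exists>c. sbound N c (\<lambda>x. m n x * f x)" for N
    using sbound_mult_slow[OF assms(1), of N] schwartz_sbound[OF assms(2)] schwartz_smooth[OF assms(2)]
    by blast
qed

section \<open>Continuous functionals and operators on Schwartz space\<close>

text \<open>Linearity and continuity on Schwartz space, the continuity being expressed by one of the norms
  behind \<^const>\<open>sbound\<close>.\<close>

definition cfunctional :: "'a::euclidean_space distr \<Rightarrow> bool" where
  "cfunctional u \<longleftrightarrow>
     (\<forall>f\<in>schwartz. \<forall>g\<in>schwartz. u (\<lambda>x. f x + g x) = u f + u g) \<and>
     (\<forall>c. \<forall>f\<in>schwartz. u (\<lambda>x. c * f x) = c * u f) \<and>
     (\<exists>N C. \<forall>f\<in>schwartz. \<forall>c. sbound N c f \<longrightarrow> norm (u f) \<le> C * c)"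

definition coperator ::
  "(('a::euclidean_space \<Rightarrow> complex) \<Rightarrow> ('b::euclidean_space \<Rightarrow> complex)) \<Rightarrow> bool" where
  "coperator A \<longleftrightarrow> (\<forall>f\<in>schwartz. A f \<in> schwartz) \<and>
     (\<forall>f\<in>schwartz. \<forall>g\<in>schwartz. A (\<lambda>x. f x + g x) = (\<lambda>x. A f x + A g x)) \<and>
     (\<forall>c. \<forall>f\<in>schwartz. A (\<lambda>x. c * f x) = (\<lambda>x. c * A f x)) \<and>
     (\<forall>N. \<exists>M C. \<forall>f\<in>schwartz. \<forall>c. sbound M c f \<longrightarrow> sbound N (C * c) (A f))"

lemma cfunctional_add:
  "cfunctional u \<Longrightarrow> f \<in> schwartz \<Longrightarrow> g \<in> schwartz \<Longrightarrow> u (\<lambda>x. f x + g x) = u f + u g"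
  by (simp add: cfunctional_def)

lemma cfunctional_cmult: "cfunctional u \<Longrightarrow> f \<in> schwartz \<Longrightarrow> u (\<lambda>x. c * f x) = c * u f"
  by (simp add: cfunctional_def)

lemma cfunctional_diff:
  "cfunctional u \<Longrightarrow> f \<in> schwartz \<Longrightarrow> g \<in> schwartz \<Longrightarrow> u (\<lambda>x. f x - g x) = u f - u g"
  using cfunctional_add[of u f "\<lambda>x. (-1) * g x"] cfunctional_cmult[of u g "-1"] schwartz_cmult[of g "-1"]
  by simp

lemma cfunctional_zero: "cfunctional u \<Longrightarrow> u (\<lambda>x. 0) = 0"
  using cfunctional_cmult[of u "\<lambda>x. 0" 0] schwartz_zero by simp

lemma cfunctional_sum:
  assumes "cfunctional u" "\<And>i. i \<in> I \<Longrightarrow> f i \<in> schwartz" "finite I"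
  shows "u (\<lambda>x. \<Sum>i\<in>I. f i x) = (\<Sum>i\<in>I. u (f i))" and "(\<lambda>x. \<Sum>i\<in>I. f i x) \<in> schwartz"
proof -
  have "u (\<lambda>x. \<Sum>i\<in>I. f i x) = (\<Sum>i\<in>I. u (f i)) \<and> (\<lambda>x. \<Sum>i\<in>I. f i x) \<in> schwartz"
    using assms(3,2)
    by (induction I) (auto simp: cfunctional_zero[OF assms(1)] schwartz_zero schwartz_add cfunctional_add[OF assms(1)])
  then show "u (\<lambda>x. \<Sum>i\<in>I. f i x) = (\<Sum>i\<in>I. u (f i))" "(\<lambda>x. \<Sum>i\<in>I. f i x) \<in> schwartz" by auto
qed

lemma cfunctional_bound:
  assumes "cfunctional u"
  shows "\<exists>N C. C \<ge> 0 \<and> (\<forall>f\<in>schwartz. \<forall>c. sbound N c f \<longrightarrow> norm (u f) \<le> C * c)"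
proof -
  obtain N C where C: "\<And>f c. f \<in> schwartz \<Longrightarrow> sbound N c f \<Longrightarrow> norm (u f) \<le> C * c"
    using assms unfolding cfunctional_def by blast
  have "norm (u f) \<le> \<bar>C\<bar> * c" if "f \<in> schwartz" "sbound N c f" for f c
    using C[OF that] sbound_nonneg[OF that(2)] mult_right_mono[of C "\<bar>C\<bar>" c] by linarith
  then show ?thesis by (intro exI[of _ N] exI[of _ "\<bar>C\<bar>"]) auto
qed

lemma coperator_schwartz: "coperator A \<Longrightarrow> f \<in> schwartz \<Longrightarrow> A f \<in> schwartz"
  by (simp add: coperator_def)

lemma cfunctional_comp:
  fixes A :: "('a::euclidean_space \<Rightarrow> complex) \<Rightarrow> ('b::euclidean_space \<Rightarrow> complex)"
  assumes "cfunctional u" "coperator A" shows "cfunctional (\<lambda>f. u (A f))"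
  unfolding cfunctional_def
proof (intro conjI ballI allI)
  fix f g :: "'a \<Rightarrow> complex" assume "f \<in> schwartz" "g \<in> schwartz"
  then show "u (A (\<lambda>x. f x + g x)) = u (A f) + u (A g)"
    using assms by (simp add: coperator_def cfunctional_def)
next
  fix c and f :: "'a \<Rightarrow> complex" assume "f \<in> schwartz"
  then show "u (A (\<lambda>x. c * f x)) = c * u (A f)"
    using assms by (simp add: coperator_def cfunctional_def)
next
  obtain N C where C: "\<And>f c. f \<in> schwartz \<Longrightarrow> sbound N c f \<Longrightarrow> norm (u f) \<le> C * c"
    using cfunctional_bound[OF assms(1)] by blast
  obtain M D where D: "\<And>f c. f \<in> schwartz \<Longrightarrow> sbound M c f \<Longrightarrow> sbound N (D * c) (A f)"
    using assms(2) unfolding coperator_def by blast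
  have "\<forall>f\<in>schwartz. \<forall>c. sbound M c f \<longrightarrow> norm (u (A f)) \<le> (C * D) * c"
    unfolding mult.assoc using C D coperator_schwartz[OF assms(2)] by blast
  then show "\<exists>N C. \<forall>f\<in>schwartz. \<forall>c. sbound N c f \<longrightarrow> norm (u (A f)) \<le> C * c" by blast
qed

lemma coperator_comp:
  assumes "coperator A" "coperator B" shows "coperator (\<lambda>f. B (A f))"
  unfolding coperator_def
proof (intro conjI ballI allI)
  fix N
  obtain M D where D: "\<And>f c. f \<in> schwartz \<Longrightarrow> sbound M c f \<Longrightarrow> sbound N (D * c) (B f)"
    using assms(2) unfolding coperator_def by blast
  obtain L C where C: "\<And>f c. f \<in> schwartz \<Longrightarrow> sbound L c f \<Longrightarrow> sbound M (C * c) (A f)"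
    using assms(1) unfolding coperator_def by blast
  have "\<forall>f\<in>schwartz. \<forall>c. sbound L c f \<longrightarrow> sbound N ((D * C) * c) (B (A f))"
    unfolding mult.assoc using C D coperator_schwartz[OF assms(1)] by blast
  then show "\<exists>M C. \<forall>f\<in>schwartz. \<forall>c. sbound M c f \<longrightarrow> sbound N (C * c) (B (A f))" by blast
qed (use assms in \<open>auto simp: coperator_def\<close>)

lemma coperator_mult:
  assumes "slow m" shows "coperator (\<lambda>f x. m n x * f x)"
  unfolding coperator_def
proof (intro conjI ballI allI)
  fix N
  show "\<exists>M C. \<forall>f\<in>schwartz. \<forall>c. sbound M c f \<longrightarrow> sbound N (C * c) (\<lambda>x. m n x * f x)"
    using sbound_mult_slow[OF assms, of N] schwartz_smooth by blast
next
  fix f :: "'a \<Rightarrow> complex" assume "f \<in> schwartz"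
  then show "(\<lambda>x. m n x * f x) \<in> schwartz" by (rule schwartz_mult_slow[OF assms])
qed (auto simp: algebra_simps)

lemma cfunctional_tendsto_zero:
  assumes "cfunctional u" "\<And>n. f n \<in> schwartz"
    and "\<And>N. \<exists>c. c \<longlonglongrightarrow> 0 \<and> (\<forall>n. sbound N (c n) (f n))"
  shows "(\<lambda>n. u (f n)) \<longlonglongrightarrow> 0"
proof -
  obtain N C where C: "\<And>f c. f \<in> schwartz \<Longrightarrow> sbound N c f \<Longrightarrow> norm (u f) \<le> C * c"
    using cfunctional_bound[OF assms(1)] by blast
  obtain c where c: "c \<longlonglongrightarrow> 0" "\<And>n. sbound N (c n) (f n)" using assms(3) by blast
  show ?thesis
  proof (rule tendsto_0_le[where K=1])
    show "(\<lambda>n. C * c n) \<longlonglongrightarrow> 0" using tendsto_mult_right_zero[OF c(1)] .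
    show "\<forall>\<^sub>F n in sequentially. norm (u (f n)) \<le> norm (C * c n) * 1"
      using C[OF assms(2) c(2)] by (intro always_eventually allI) (simp add: order_trans[OF _ abs_ge_self])
  qed
qed

text \<open>Finite intersections of subbasic sets shrink to a ball of a single norm because the norms
  behind \<^const>\<open>sbound\<close> increase with their index.\<close>

lemma schwartz_neighbourhood_zero:
  assumes "generate_topology_on
     {{g \<in> schwartz. schwartz_seminorm k vs (\<lambda>x. g x - f x) < r} | f k vs r.
        f \<in> schwartz \<and> vs \<in> lists Basis \<and> r > 0} U" "(\<lambda>x::'a::euclidean_space. 0) \<in> U"
  shows "\<exists>N \<delta>. \<delta> > 0 \<and> (\<forall>g\<in>schwartz. sbound N \<delta> g \<longrightarrow> g \<in> U)"
  using assms
proof (induction rule: generate_topology_on.induct)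
  case Empty
  then show ?case by simp
next
  case (Int a b)
  then obtain N \<delta> M \<epsilon> where *: "\<delta> > 0" "\<forall>g\<in>schwartz. sbound N \<delta> g \<longrightarrow> g \<in> a"
    "\<epsilon> > 0" "\<forall>g\<in>schwartz. sbound M \<epsilon> g \<longrightarrow> g \<in> b" by auto
  have "\<forall>g\<in>schwartz. sbound (max N M) (min \<delta> \<epsilon>) g \<longrightarrow> g \<in> a \<inter> b"
  proof (intro ballI impI)
    fix g :: "'a \<Rightarrow> complex" assume g: "g \<in> schwartz" "sbound (max N M) (min \<delta> \<epsilon>) g"
    have "sbound N \<delta> g" "sbound M \<epsilon> g"
      using sbound_mono[OF sbound_mono_index[OF g(2)]] by auto
    then show "g \<in> a \<inter> b" using * g(1) by blast
  qed
  moreover have "min \<delta> \<epsilon> > 0" using * by simp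
  ultimately show ?case by blast
next
  case (UN K)
  then obtain k where "k \<in> K" "(\<lambda>x. 0) \<in> k" by blast
  with UN.IH obtain N \<delta> where "\<delta> > 0" "\<forall>g\<in>schwartz. sbound N \<delta> g \<longrightarrow> g \<in> k" by blast
  with \<open>k \<in> K\<close> show ?case by blast
next
  case (Basis s)
  then obtain f k vs r where s: "s = {g \<in> schwartz. schwartz_seminorm k vs (\<lambda>x. g x - f x) < r}"
    and f: "f \<in> schwartz" and vs: "vs \<in> lists Basis" by blast
  let ?f = "\<lambda>x. 0 - f x"
  have fS: "?f \<in> schwartz" using schwartz_diff[OF schwartz_zero f] .
  have less: "schwartz_seminorm k vs ?f < r" using Basis(2) s by simp
  define \<delta> where "\<delta> = (r - schwartz_seminorm k vs ?f) / 2"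
  let ?N = "max k (length vs)"
  have w: "vs \<in> words ?N" using vs by (simp add: words_def)
  have weight: "norm x ^ k * norm (iter_deriv vs g x) \<le> c" if "sbound ?N c g" for g c and x :: 'a
  proof -
    have "norm x ^ k \<le> (1 + norm x) ^ k" by (intro power_mono) auto
    also have "\<dots> \<le> (1 + norm x) ^ ?N" by (intro power_increasing) auto
    finally have "norm x ^ k * norm (iter_deriv vs g x) \<le> (1 + norm x) ^ ?N * norm (iter_deriv vs g x)"
      by (intro mult_right_mono) auto
    then show ?thesis using sboundD[OF that w, of x] by linarith
  qed
  obtain c where c: "sbound ?N c ?f" using schwartz_sbound[OF fS] by blast
  have bdd: "bdd_above (range (\<lambda>x. norm x ^ k * norm (iter_deriv vs ?f x)))"
    using weight[OF c] by (auto intro!: bdd_aboveI)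
  have "g \<in> s" if g: "g \<in> schwartz" "sbound ?N \<delta> g" for g
  proof -
    have eq: "(\<lambda>x. g x - f x) = (\<lambda>x. g x + ?f x)" by simp
    have "schwartz_seminorm k vs (\<lambda>x. g x - f x) \<le> \<delta> + schwartz_seminorm k vs ?f"
      unfolding schwartz_seminorm_def
    proof (rule cSUP_least)
      fix x :: 'a
      have "norm x ^ k * norm (iter_deriv vs (\<lambda>x. g x - f x) x) \<le>
         norm x ^ k * (norm (iter_deriv vs g x) + norm (iter_deriv vs ?f x))"
        unfolding eq using iter_deriv_add[OF schwartz_smooth[OF g(1)] schwartz_smooth[OF fS] vs]
        by (intro mult_left_mono) (auto simp: norm_triangle_ineq simp del: diff_0)
      also have "\<dots> = norm x ^ k * norm (iter_deriv vs g x) + norm x ^ k * norm (iter_deriv vs ?f x)"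
        by (simp add: distrib_left)
      also have "\<dots> \<le> \<delta> + (SUP x. norm x ^ k * norm (iter_deriv vs ?f x))"
        by (intro add_mono weight[OF g(2)] cSUP_upper[OF _ bdd]) auto
      finally show "norm x ^ k * norm (iter_deriv vs (\<lambda>x. g x - f x) x) \<le> \<dots>" .
    qed simp
    also have "\<dots> < r" using less unfolding \<delta>_def by (simp add: field_simps)
    finally show ?thesis using g s by simp
  qed
  moreover have "\<delta> > 0" using less unfolding \<delta>_def by simp
  ultimately show ?case by blast
qed

text \<open>A continuous linear functional is bounded on a ball around zero; scaling turns this into a
  linear estimate.\<close>

lemma tempered_imp_cfunctional:
  assumes "tempered u" shows "cfunctional (u :: 'a::euclidean_space distr)"
proof -
  have sc: "u (\<lambda>x. c * f x) = c * u f" if "f \<in> schwartz" for f c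
    using assms that by (simp add: tempered_def)
  have u0: "u (\<lambda>x. 0) = 0" using sc[OF schwartz_zero, of 0] by simp
  let ?U = "{f \<in> topspace schwartz_topology. u f \<in> ball 0 1}"
  have "openin schwartz_topology ?U"
    using assms by (intro openin_continuous_map_preimage) (auto simp: tempered_def)
  then have gen: "generate_topology_on
     {{g \<in> schwartz. schwartz_seminorm k vs (\<lambda>x. g x - f x) < r} | f k vs r.
        f \<in> schwartz \<and> vs \<in> lists Basis \<and> r > 0} ?U"
    unfolding schwartz_topology_def by (rule openin_topology_generated_by)
  have sn: "schwartz_seminorm 0 [] (\<lambda>x::'a. 0 - (0::complex)) = 0" by (simp add: schwartz_seminorm_def)
  have "(\<lambda>x::'a. 0::complex) \<in> {g \<in> schwartz. schwartz_seminorm 0 [] (\<lambda>x. g x - 0) < 1}"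
    using sn schwartz_zero by simp
  then have "(\<lambda>x::'a. 0::complex) \<in> topspace schwartz_topology"
    unfolding schwartz_topology_def topology_generated_by_topspace
    using schwartz_zero by (intro UnionI[of "{g \<in> schwartz. schwartz_seminorm 0 [] (\<lambda>x. g x - 0) < 1}"]) fastforce+
  then obtain N \<delta> where d: "\<delta> > 0" "\<And>g. g \<in> schwartz \<Longrightarrow> sbound N \<delta> g \<Longrightarrow> norm (u g) < 1"
    using schwartz_neighbourhood_zero[OF gen] u0 by auto
  have "norm (u f) \<le> (1 / \<delta>) * c" if f: "f \<in> schwartz" "sbound N c f" for f c
  proof (rule field_le_epsilon)
    fix e :: real assume "e > 0"
    \<comment> \<open>The additional \<open>\<delta> e\<close> keeps \<open>t\<close> positive even if \<open>c\<close> is zero.\<close>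
    define t where "t = c + \<delta> * e"
    have t: "t > 0" "sbound N t f"
      using sbound_nonneg[OF f(2)] \<open>e > 0\<close> d(1) sbound_mono[OF f(2), of t] by (auto simp: t_def intro: add_nonneg_pos)
    have "sbound N (norm (complex_of_real (\<delta> / t)) * t) (\<lambda>x. of_real (\<delta> / t) * f x)"
      using sbound_cmult[OF schwartz_smooth[OF f(1)] t(2)] .
    then have "sbound N \<delta> (\<lambda>x. of_real (\<delta> / t) * f x)" using t d(1) by (simp add: norm_divide)
    from d(2)[OF schwartz_cmult[OF f(1)] this] have "norm (of_real (\<delta> / t) * u f) < 1"
      unfolding sc[OF f(1)] .
    then have "norm (u f) < t / \<delta>" using t d(1) by (simp add: norm_mult norm_divide field_simps)
    then show "norm (u f) \<le> 1 / \<delta> * c + e" using d(1) by (simp add: t_def add_divide_distrib)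
  qed
  then show ?thesis using assms unfolding cfunctional_def tempered_def by blast
qed

section \<open>Test functions and cutoffs\<close>

lemma pd_cong_open:
  assumes "f differentiable_on UNIV" "open U" "\<And>y. y \<in> U \<Longrightarrow> f y = g y" "x \<in> U"
  shows "pd v f x = pd v g x"
  using has_derivative_transform_within_open[OF has_derivative_pd[OF assms(1)] assms(2,4,3)]
  by (simp add: pd_eqI)

lemma iter_deriv_cong_open:
  assumes "smooth f" "smooth g" "open U" "\<And>y. y \<in> U \<Longrightarrow> f y = g y" "vs \<in> lists Basis" "x \<in> U"
  shows "iter_deriv vs f x = iter_deriv vs g x"
  using assms(5,6)
proof (induction vs arbitrary: x)
  case (Cons v vs)
  then show ?case unfolding iter_deriv_Cons
    using assms(1,3) by (intro pd_cong_open[of _ U]) (auto intro: smooth_differentiable smooth_iter_deriv)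
qed (use assms(4) in simp)

lemma iter_deriv_zero: "vs \<in> lists Basis \<Longrightarrow> iter_deriv vs (\<lambda>x. 0) = (\<lambda>x. 0)"
  using iter_deriv_cmult[OF smooth_const[of 0], of vs 0] by simp

lemma iter_deriv_zero_open:
  assumes "smooth f" "open U" "\<And>y. y \<in> U \<Longrightarrow> f y = 0" "vs \<in> lists Basis" "x \<in> U"
  shows "iter_deriv vs f x = 0"
  using iter_deriv_cong_open[OF assms(1) smooth_const[of 0] assms(2,3,4,5)] iter_deriv_zero[OF assms(4)]
  by simp

definition test :: "('a::euclidean_space \<Rightarrow> complex) set" where
  "test = {f. smooth f \<and> (\<exists>R. \<forall>x. norm x > R \<longrightarrow> f x = 0)}"

lemma test_schwartz:
  assumes "f \<in> test" shows "f \<in> schwartz"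
proof -
  obtain R where f: "smooth f" and R: "\<And>x. norm x > R \<Longrightarrow> f x = 0"
    using assms unfolding test_def by blast
  show ?thesis
  proof (rule schwartzI_words[OF f])
    fix vs :: "'a list" and k assume vs: "vs \<in> lists Basis"
    have "continuous_on (cball 0 R) (iter_deriv vs f)"
      using smooth_continuous[OF smooth_iter_deriv[OF f vs]] continuous_on_subset by blast
    then have "continuous_on (cball 0 R) (\<lambda>x. (1 + norm x) ^ k * norm (iter_deriv vs f x))"
      by (intro continuous_intros)
    then obtain B where B: "\<And>x. x \<in> cball 0 R \<Longrightarrow> (1 + norm x) ^ k * norm (iter_deriv vs f x) \<le> B"
      using continuous_on_closed_Collect_le compact_continuous_image[of "cball (0::'a) R"] compact_imp_bounded
      by (metis (no_types, lifting) bounded_has_Sup(1) compact_cball empty_iff image_eqI)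
    have "(1 + norm x) ^ k * norm (iter_deriv vs f x) \<le> max 0 B" for x
    proof (cases "norm x \<le> R")
      case False
      then have "iter_deriv vs f x = 0"
        using R by (intro iter_deriv_zero_open[OF f _ _ vs, of "- cball 0 R"]) (auto simp: open_Compl)
      then show ?thesis by simp
    qed (use B in \<open>auto simp: max.coboundedI2\<close>)
    then show "\<exists>C. \<forall>x. (1 + norm x) ^ k * norm (iter_deriv vs f x) \<le> C" by blast
  qed
qed

lemma test_mult: "smooth g \<Longrightarrow> f \<in> test \<Longrightarrow> (\<lambda>x. g x * f x) \<in> test"
  unfolding test_def using smooth_mult by fastforce

lemma schwartz_imp_slow:
  assumes "f \<in> schwartz" shows "slow (\<lambda>n. f)"
proof (rule slowI)
  show "smooth f" by (rule schwartz_smooth[OF assms])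
  fix vs :: "'a list" assume "vs \<in> lists Basis"
  then have w: "vs \<in> words (length vs)" by (simp add: words_def)
  obtain c where c: "sbound (length vs) c f" using schwartz_sbound[OF assms] by blast
  have "norm (iter_deriv vs f x) \<le> c * (1 + norm x) ^ 0" for x
  proof -
    have "1 * norm (iter_deriv vs f x) \<le> (1 + norm x) ^ length vs * norm (iter_deriv vs f x)"
      by (intro mult_right_mono one_le_power) auto
    then show ?thesis using sboundD[OF c w, of x] by simp
  qed
  then show "\<exists>C k. \<forall>n x. norm (iter_deriv vs f x) \<le> C * (1 + norm x) ^ k" by blast
qed

text \<open>The induction is over \<open>g(x) s(q(x))\<close> with an arbitrary slowly increasing amplitude \<open>g\<close>, since the
  chain rule produces such amplitudes.\<close>

lemma slow_comp:
  fixes q :: "nat \<Rightarrow> 'a::euclidean_space \<Rightarrow> real"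
  assumes q: "slow (\<lambda>n x. complex_of_real (q n x))" and s: "slow (\<lambda>n. s)"
  shows "slow (\<lambda>n x. s (q n x))"
proof -
  have ex: "\<exists>C k. \<forall>n x. norm (iter_deriv vs (\<lambda>x. g n x * s (q n x)) x) \<le> C * (1 + norm x) ^ k"
    if "vs \<in> lists Basis" "slow g" "slow (\<lambda>n. s)" for vs g s
    using that
  proof (induction vs arbitrary: g s rule: rev_induct)
    case Nil
    obtain C k where C: "C \<ge> 0" "\<And>n vs x. vs \<in> words 0 \<Longrightarrow> norm (iter_deriv vs (g n) x) \<le> C * (1 + norm x) ^ k"
      using slowD[OF Nil(2), of 0] by blast
    obtain D l where D: "D \<ge> 0" "\<And>vs x. vs \<in> words 0 \<Longrightarrow> norm (iter_deriv vs s x) \<le> D * (1 + norm x) ^ l"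
      using slowD[OF Nil(3), of 0] by blast
    obtain E m where E: "E \<ge> 0" "\<And>n vs x. vs \<in> words 0 \<Longrightarrow>
        norm (iter_deriv vs (\<lambda>x. complex_of_real (q n x)) x) \<le> E * (1 + norm x) ^ m"
      using slowD[OF q, of 0] by blast
    have "norm (g n x * s (q n x)) \<le> (C * (D * (1 + E) ^ l)) * (1 + norm x) ^ (k + m * l)" for n x
    proof -
      have "1 + norm (q n x) \<le> 1 + E * (1 + norm x) ^ m" using E(2)[of "[]" n x] by simp
      also have "\<dots> \<le> (1 + E) * (1 + norm x) ^ m" using one_le_power[of "1 + norm x" m] by (simp add: algebra_simps)
      finally have 1: "(1 + norm (q n x)) ^ l \<le> ((1 + E) * (1 + norm x) ^ m) ^ l" by (intro power_mono) auto
      have "norm (g n x * s (q n x)) \<le> (C * (1 + norm x) ^ k) * (D * (1 + norm (q n x)) ^ l)"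
        unfolding norm_mult using C(2)[of "[]" n x] D(2)[of "[]" "q n x"] C(1) by (intro mult_mono) auto
      also have "\<dots> \<le> (C * (1 + norm x) ^ k) * (D * ((1 + E) * (1 + norm x) ^ m) ^ l)"
        using 1 C(1) D(1) by (intro mult_left_mono) auto
      also have "\<dots> = (C * (D * (1 + E) ^ l)) * (1 + norm x) ^ (k + m * l)"
        unfolding power_mult_distrib power_add power_mult by (simp add: mult_ac)
      finally show ?thesis .
    qed
    then show ?case unfolding iter_deriv_Nil by blast
  next
    case (snoc v us)
    have v: "v \<in> Basis" and us: "us \<in> lists Basis" using snoc.prems by auto
    have d: "g n differentiable_on UNIV" "s differentiable_on UNIV"
      "(\<lambda>x. complex_of_real (q n x)) differentiable_on UNIV" for n
      using slow_smooth[OF snoc.prems(2)] slow_smooth[OF snoc.prems(3)] slow_smooth[OF q] smooth_differentiable by blast+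
    have ps: "slow (\<lambda>n. pd 1 s)" using slow_pd[OF snoc.prems(3), of 1] by simp
    have sl: "slow (\<lambda>n. comp_step v (q n) (g n))" by (intro slow_mult slow_pd[OF _ v] q snoc.prems)
    obtain C k where C: "\<And>n x. norm (iter_deriv us (\<lambda>x. pd v (g n) x * s (q n x)) x) \<le> C * (1 + norm x) ^ k"
      using snoc.IH[OF us slow_pd[OF snoc.prems(2) v] snoc.prems(3)] by blast
    obtain D l where D: "\<And>n x. norm (iter_deriv us (\<lambda>x. comp_step v (q n) (g n) x * pd 1 s (q n x)) x) \<le> D * (1 + norm x) ^ l"
      using snoc.IH[OF us sl ps] by blast
    have "norm (iter_deriv (us @ [v]) (\<lambda>x. g n x * s (q n x)) x) \<le> (\<bar>C\<bar> + \<bar>D\<bar>) * (1 + norm x) ^ (k + l)" for n x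
    proof -
      have sm: "smooth (\<lambda>x. s' (q n x))" if "smooth s'" for s'
        using smooth_comp[OF that slow_smooth[OF q]] .
      have "norm (iter_deriv (us @ [v]) (\<lambda>x. g n x * s (q n x)) x) \<le>
        C * (1 + norm x) ^ k + D * (1 + norm x) ^ l"
        unfolding iter_deriv_snoc pd_mult_comp[OF d]
        apply (subst iter_deriv_add[OF _ _ us])
        subgoal by (intro smooth_mult sm slow_smooth[OF slow_pd[OF snoc.prems(2) v]] slow_smooth[OF snoc.prems(3)])
        subgoal using slow_smooth[OF sl, of n] sm[OF slow_smooth[OF ps]] by (rule smooth_mult)
        subgoal using C[of n x] D[of n x] by (rule norm_triangle_mono)
        done
      also have "\<dots> \<le> \<bar>C\<bar> * (1 + norm x) ^ (k + l) + \<bar>D\<bar> * (1 + norm x) ^ (k + l)"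
        by (intro add_mono mult_mono power_increasing) auto
      finally show ?thesis by (simp add: algebra_simps)
    qed
    then show ?case by blast
  qed
  show ?thesis
  proof (rule slowI)
    show "smooth (\<lambda>x. s (q n x))" for n using smooth_comp slow_smooth[OF s] slow_smooth[OF q] by blast
    fix vs :: "'a list" assume "vs \<in> lists Basis"
    from ex[OF this slow_const[of 1] s]
    show "\<exists>C k. \<forall>n x. norm (iter_deriv vs (\<lambda>x. s (q n x)) x) \<le> C * (1 + norm x) ^ k" by simp
  qed
qed

lemma slow_coeff:
  assumes "\<And>n. norm (c n) \<le> B" "slow f" shows "slow (\<lambda>n x. c n * f n x)"
proof (rule slowI)
  show "smooth (\<lambda>x. c n * f n x)" for n by (intro smooth_mult smooth_const slow_smooth assms)
  fix vs :: "'a list" assume vs: "vs \<in> lists Basis"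
  then have w: "vs \<in> words (length vs)" by (simp add: words_def)
  obtain C k where C: "C \<ge> 0" "\<And>n vs' x. vs' \<in> words (length vs) \<Longrightarrow> norm (iter_deriv vs' (f n) x) \<le> C * (1 + norm x) ^ k"
    using slowD[OF assms(2), of "length vs"] by blast
  have B: "0 \<le> B" using assms(1)[of 0] norm_ge_zero[of "c 0"] by linarith
  have "norm (iter_deriv vs (\<lambda>x. c n * f n x) x) \<le> (B * C) * (1 + norm x) ^ k" for n x
    unfolding iter_deriv_cmult[OF slow_smooth[OF assms(2)] vs] norm_mult mult.assoc
    using C(2)[OF w] assms(1) B by (intro mult_mono) auto
  then show "\<exists>C k. \<forall>n x. norm (iter_deriv vs (\<lambda>x. c n * f n x) x) \<le> C * (1 + norm x) ^ k" by blast
qed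

lemma slow_norm_squared: "slow (\<lambda>n x. complex_of_real ((norm (x - p))\<^sup>2))"
proof -
  have "(norm (x - p))\<^sup>2 = (\<Sum>b\<in>Basis. (x \<bullet> b - p \<bullet> b)\<^sup>2)" for x :: 'a
    by (subst power2_norm_eq_inner, subst euclidean_inner) (simp add: inner_diff_left power2_eq_square)
  then have "(\<lambda>(n::nat) (x::'a). complex_of_real ((norm (x - p))\<^sup>2)) =
      (\<lambda>n x. \<Sum>b\<in>Basis. (complex_of_real (x \<bullet> b) - complex_of_real (p \<bullet> b)) ^ 2)"
    by simp
  moreover have "slow (\<lambda>n (x::'a). \<Sum>b\<in>Basis. (complex_of_real (x \<bullet> b) - complex_of_real (p \<bullet> b)) ^ 2)"
    by (intro slow_sum slow_power slow_diff slow_inner slow_const)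
  ultimately show ?thesis by simp
qed

text \<open>The functions \<open>p(1/t) exp (-1/t)\<close>, extended by zero. They are closed under differentiation,
  which makes all of them smooth; the constant polynomial gives the building block of bump functions.\<close>

definition flat :: "real poly \<Rightarrow> real \<Rightarrow> real" where
  "flat p t = (if t > 0 then poly p (1 / t) * exp (- (1 / t)) else 0)"

lemma poly_times_exp_minus_tendsto: "((\<lambda>x::real. poly p x * exp (- x)) \<longlongrightarrow> 0) at_top"
proof -
  have "((\<lambda>x. \<Sum>i\<le>degree p. coeff p i * (x ^ i / exp x)) \<longlongrightarrow> (\<Sum>i\<le>degree p. coeff p i * 0)) at_top"
    by (intro tendsto_sum tendsto_mult tendsto_const tendsto_power_div_exp_0)
  then show ?thesis
    by (simp add: poly_altdef sum_distrib_right exp_minus divide_inverse mult.assoc)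
qed

lemma DERIV_flat: "(flat p has_real_derivative flat ([:0, 0, 1:] * (p - pderiv p)) t) (at t)"
proof -
  consider "t > 0" | "t < 0" | "t = 0" by linarith
  then show ?thesis
  proof cases
    case 1
    have "((\<lambda>t. poly p (1 / t) * exp (- (1 / t))) has_real_derivative
       flat ([:0, 0, 1:] * (p - pderiv p)) t) (at t)"
      using 1 by (auto intro!: derivative_eq_intros DERIV_chain'[where g="poly p"] poly_DERIV
          simp: flat_def field_simps power2_eq_square)
    then show ?thesis
      by (rule has_field_derivative_transform_within_open[where S="{0<..}"]) (use 1 in \<open>auto simp: flat_def\<close>)
  next
    case 2
    have "((\<lambda>t. 0) has_real_derivative flat ([:0, 0, 1:] * (p - pderiv p)) t) (at t)"
      using 2 by (auto simp: flat_def)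
    then show ?thesis
      by (rule has_field_derivative_transform_within_open[where S="{..<0}"]) (use 2 in \<open>auto simp: flat_def\<close>)
  next
    case 3
    have "((\<lambda>h. poly (p * [:0, 1:]) (inverse h) * exp (- inverse h)) \<longlongrightarrow> 0) (at_right 0)"
      by (rule filterlim_compose[OF poly_times_exp_minus_tendsto filterlim_inverse_at_top_right])
    then have r: "((\<lambda>h. flat p h / h) \<longlongrightarrow> 0) (at_right 0)"
      by (rule Lim_transform_eventually)
         (auto simp: eventually_at_right_field flat_def inverse_eq_divide intro!: exI[of _ 1])
    have l: "((\<lambda>h. flat p h / h) \<longlongrightarrow> 0) (at_left 0)"
      by (rule Lim_transform_eventually[OF tendsto_const])
         (auto simp: eventually_at_left_field flat_def intro!: exI[of _ "-1"])
    have "((\<lambda>h. flat p h / h) \<longlongrightarrow> 0) (at 0)" using filterlim_split_at_real l r by blast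
    then show ?thesis unfolding 3 has_field_derivative_iff by (simp add: flat_def)
  qed
qed

lemma pd_of_real:
  assumes "(f has_real_derivative D) (at t)"
  shows "((\<lambda>t. complex_of_real (f t)) has_derivative (\<lambda>h. of_real (h * D))) (at t)"
    and "pd 1 (\<lambda>t. complex_of_real (f t)) t = of_real D"
proof -
  show *: "((\<lambda>t. complex_of_real (f t)) has_derivative (\<lambda>h. of_real (h * D))) (at t)"
    using bounded_linear.has_derivative[OF bounded_linear_of_real assms[unfolded has_field_derivative_def]]
    by (simp add: mult.commute)
  show "pd 1 (\<lambda>t. complex_of_real (f t)) t = of_real D" using pd_eqI[OF *] by simp
qed

lemma smooth_flat: "smooth (\<lambda>t. complex_of_real (flat p t))"
proof -
  have "ksmooth n (\<lambda>t. complex_of_real (flat p t))" for n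
  proof (induction n arbitrary: p)
    case (Suc n)
    have "(\<lambda>t. complex_of_real (flat p t)) differentiable_on UNIV"
      using pd_of_real(1)[OF DERIV_flat[of p]] unfolding differentiable_on_def differentiable_def by blast
    moreover have "pd 1 (\<lambda>t. complex_of_real (flat p t)) =
        (\<lambda>t. complex_of_real (flat ([:0, 0, 1:] * (p - pderiv p)) t))"
      by (rule ext) (rule pd_of_real(2)[OF DERIV_flat])
    ultimately show ?case using Suc.IH by (simp del: mult_pCons_left)
  qed simp
  then show ?thesis by (simp add: smooth_iff_ksmooth)
qed

text \<open>The primitive of the bump \<open>flat 1 t * flat 1 (1 - t)\<close>, normalised. Integrating instead of dividing
  makes the transition function exactly constant outside the unit interval, and its smoothness is
  that of the bump.\<close>

lemma smooth_step:
  obtains S :: "real \<Rightarrow> complex"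
  where "slow (\<lambda>n. S)" "\<And>t. t \<le> 0 \<Longrightarrow> S t = 0" "\<And>t. t \<ge> 1 \<Longrightarrow> S t = 1"
proof -
  define k where "k t = flat 1 t * flat 1 (1 - t)" for t
  have lin: "smooth (\<lambda>x::real. complex_of_real (1 - x))"
    using smooth_diff[OF smooth_const[of 1] smooth_linear[OF bounded_linear_of_real]] by simp
  have ksm: "smooth (\<lambda>t. complex_of_real (k t))"
    using smooth_mult[OF smooth_flat smooth_comp[OF smooth_flat lin]] by (simp add: k_def)
  have k0: "k t = 0" if "t \<le> 0 \<or> t \<ge> 1" for t using that by (auto simp: k_def flat_def)
  have kpos: "k t > 0" if "0 < t" "t < 1" for t using that by (auto simp: k_def flat_def)
  have ktest: "(\<lambda>t. complex_of_real (k t)) \<in> test"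
    unfolding test_def using ksm k0 by (auto intro!: exI[of _ 1] simp: abs_if split: if_splits)
  have cont: "isCont k t" for t
  proof -
    have "continuous_on UNIV (\<lambda>t. Re (complex_of_real (k t)))"
      by (intro continuous_intros smooth_continuous[OF ksm])
    then show ?thesis by (simp add: continuous_on_eq_continuous_at)
  qed
  obtain F where "\<And>t. (F has_vector_derivative k t) (at t)"
    using einterval_antiderivative[of "-\<infinity>" "\<infinity>" k] cont by auto
  then have F: "(F has_real_derivative k t) (at t)" for t by (simp add: has_real_derivative_iff_has_vector_derivative)
  have F0: "F t = F 0" if "t \<le> 0" for t
  proof (rule ccontr)
    assume ne: "F t \<noteq> F 0"
    with that have "t < 0" by (cases "t = 0") auto
    then obtain z where "t < z" "z < 0" "F 0 - F t = (0 - t) * k z" using MVT2[of t 0 F k] F by blast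
    then show False using ne k0[of z] by simp
  qed
  have F1: "F t = F 1" if "t \<ge> 1" for t
  proof (rule ccontr)
    assume ne: "F t \<noteq> F 1"
    with that have "t > 1" by (cases "t = 1") auto
    then obtain z where "1 < z" "z < t" "F t - F 1 = (t - 1) * k z" using MVT2[of 1 t F k] F by blast
    then show False using ne k0[of z] by simp
  qed
  obtain z where z: "0 < z" "z < 1" "F 1 - F 0 = (1 - 0) * k z" using MVT2[of 0 1 F k] F by auto
  define c where "c = F 1 - F 0"
  have c: "c > 0" using z kpos[of z] by (simp add: c_def)
  define S where "S t = complex_of_real ((F t - F 0) / c)" for t
  have dS: "((\<lambda>t. (F t - F 0) / c) has_real_derivative k t / c) (at t)" for t
    using F c by (auto intro!: derivative_eq_intros)
  have kc: "(\<lambda>t. complex_of_real (k t / c)) = (\<lambda>t. of_real (1 / c) * complex_of_real (k t))" by simp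
  have "slow (\<lambda>n. S)"
  proof (rule slow_step[where k=0 and C=1])
    show "S differentiable_on UNIV" for n :: nat
      using pd_of_real(1)[OF dS] unfolding S_def differentiable_on_def differentiable_def by blast
    show "slow (\<lambda>n. pd v S)" if "v \<in> Basis" for v
    proof -
      have "pd v S = (\<lambda>t. of_real (1 / c) * complex_of_real (k t))"
        using that pd_of_real(2)[OF dS] by (auto simp: S_def[abs_def] kc[symmetric])
      then show ?thesis
        using slow_mult[OF slow_const schwartz_imp_slow[OF test_schwartz[OF ktest]]] by (simp only:)
    qed
    fix t
    have mono: "F a \<le> F b" if "a \<le> b" for a b
    proof (rule DERIV_nonneg_imp_nondecreasing[OF that])
      fix x show "\<exists>y. (F has_real_derivative y) (at x) \<and> 0 \<le> y"
      proof (intro exI conjI)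
        show "0 \<le> k x" using kpos[of x] k0[of x] by linarith
      qed (rule F)
    qed
    have "F 0 \<le> F t" using mono[of 0 t] F0[of t] by (cases "t \<le> 0") auto
    moreover have "F t \<le> F 1" using mono[of t 1] F1[of t] by (cases "t \<ge> 1") auto
    ultimately have "norm ((F t - F 0) / c) \<le> 1" using c by (simp add: c_def)
    then show "norm (S t) \<le> 1 * (1 + norm t) ^ 0" unfolding S_def norm_of_real by simp
  qed
  then show ?thesis
  proof (rule that)
    show "S t = 0" if "t \<le> 0" for t using F0[OF that] by (simp add: S_def)
    show "S t = 1" if "t \<ge> 1" for t using F1[OF that] c by (simp add: S_def c_def)
  qed
qed

text \<open>The transition function composed with \<open>2 - |x - p|\<^sup>2 / r\<^sup>2\<close>. With radii bounded below, these functions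
  are uniformly slowly increasing.\<close>

lemma bump_family:
  fixes p :: "'a::euclidean_space" and r :: "nat \<Rightarrow> real"
  assumes "e > 0" "\<And>n. r n \<ge> e"
  obtains \<psi> :: "nat \<Rightarrow> 'a \<Rightarrow> complex" where "slow \<psi>"
    "\<And>n x. norm (x - p) \<le> r n \<Longrightarrow> \<psi> n x = 1" "\<And>n x. norm (x - p) \<ge> 2 * r n \<Longrightarrow> \<psi> n x = 0"
proof -
  obtain S :: "real \<Rightarrow> complex"
    where S: "slow (\<lambda>n. S)" "\<And>t. t \<le> 0 \<Longrightarrow> S t = 0" "\<And>t. t \<ge> 1 \<Longrightarrow> S t = 1"
    using smooth_step by blast
  have r: "r n > 0" for n using assms(1) assms(2)[of n] by linarith
  define q where "q n x = 2 - (1 / (r n)\<^sup>2) * (norm (x - p))\<^sup>2" for n and x :: 'a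
  have "norm (complex_of_real (1 / (r n)\<^sup>2)) \<le> 1 / e\<^sup>2" for n
    unfolding norm_of_real using assms(1) assms(2)[of n] r[of n]
    by (auto intro!: divide_left_mono power_mono mult_mono simp: power2_eq_square)
  from slow_coeff[of "\<lambda>n. complex_of_real (1 / (r n)\<^sup>2)", OF this slow_norm_squared[of p]]
  have "slow (\<lambda>n x. complex_of_real (q n x))"
    using slow_diff[OF slow_const[of 2]] unfolding q_def by (simp only: of_real_diff of_real_mult of_real_numeral)
  from slow_comp[OF this S(1)] have "slow (\<lambda>n x. S (q n x))" .
  moreover have "S (q n x) = 1" if "norm (x - p) \<le> r n" for n x
  proof -
    have "(norm (x - p))\<^sup>2 \<le> (r n)\<^sup>2" using that by (intro power_mono) auto
    then have "q n x \<ge> 1" using r[of n] by (simp add: q_def field_simps)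
    then show ?thesis by (rule S(3))
  qed
  moreover have "S (q n x) = 0" if "norm (x - p) \<ge> 2 * r n" for n x
  proof -
    have "(2 * r n)\<^sup>2 \<le> (norm (x - p))\<^sup>2" using that r[of n] by (intro power_mono) auto
    then have "q n x \<le> 2 - 4" using r[of n] by (simp add: q_def field_simps)
    then show ?thesis by (intro S(2)) simp
  qed
  ultimately show ?thesis using that by blast
qed

lemma cutoff_family:
  obtains \<eta> :: "nat \<Rightarrow> 'a::euclidean_space \<Rightarrow> complex" where "slow \<eta>" "\<And>n. \<eta> n \<in> test"
    "\<And>n x. norm x \<le> real n + 1 \<Longrightarrow> \<eta> n x = 1"
proof -
  obtain \<eta> :: "nat \<Rightarrow> 'a \<Rightarrow> complex" where 1: "slow \<eta>"
    "\<And>n x. norm (x - 0) \<le> real n + 1 \<Longrightarrow> \<eta> n x = 1" "\<And>n x. norm (x - 0) \<ge> 2 * (real n + 1) \<Longrightarrow> \<eta> n x = 0"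
    using bump_family[of 1 "\<lambda>n. real n + 1" 0] by auto
  have "\<eta> n \<in> test" for n unfolding test_def
    using slow_smooth[OF 1(1)] 1(3) by (intro CollectI conjI exI[of _ "2 * (real n + 1)"]) auto
  then show ?thesis using 1 that by auto
qed

text \<open>The tail \<open>(1 - \<eta> n) f\<close> lives where \<open>|x| > n + 1\<close>; giving up one power of the weight makes it
  of size \<open>1/n\<close> in each norm. Hence the functional is determined by its values on the cutoffs of \<open>f\<close>.\<close>

lemma cfunctional_cutoff_limit:
  fixes \<eta> :: "nat \<Rightarrow> 'a::euclidean_space \<Rightarrow> complex"
  assumes u: "cfunctional u" and f: "f \<in> schwartz" and \<eta>: "slow \<eta>"
    and one: "\<And>n x. norm x \<le> real n + 1 \<Longrightarrow> \<eta> n x = 1"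
    and zero: "\<And>n. u (\<lambda>x. \<eta> n x * f x) = 0"
  shows "u f = 0"
proof -
  let ?m = "\<lambda>n x. 1 - \<eta> n x"
  have m: "slow ?m" by (intro slow_diff slow_const \<eta>)
  have "(\<lambda>n. u (\<lambda>x. ?m n x * f x)) \<longlonglongrightarrow> 0"
  proof (rule cfunctional_tendsto_zero[OF u])
    show "(\<lambda>x. ?m n x * f x) \<in> schwartz" for n by (rule schwartz_mult_slow[OF m f])
    fix N
    obtain C M where C: "\<And>n f c. smooth f \<Longrightarrow> sbound M c f \<Longrightarrow> sbound (Suc N) (C * c) (\<lambda>x. ?m n x * f x)"
      using sbound_mult_slow[OF m, of "Suc N"] by blast
    obtain c where c: "sbound M c f" using schwartz_sbound[OF f] by blast
    have B: "sbound (Suc N) (C * c) (\<lambda>x. ?m n x * f x)" for n using C[OF schwartz_smooth[OF f] c] .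
    have "sbound N (C * c * inverse (real (Suc n))) (\<lambda>x. ?m n x * f x)" for n
      unfolding sbound_def
    proof (intro ballI allI)
      fix vs :: "'a list" and x :: 'a assume vs: "vs \<in> words N"
      let ?d = "norm (iter_deriv vs (\<lambda>x. ?m n x * f x) x)"
      show "(1 + norm x) ^ N * ?d \<le> C * c * inverse (real (Suc n))"
      proof (cases "norm x < real n + 1")
        case True
        have "iter_deriv vs (\<lambda>x. ?m n x * f x) x = 0"
          using True one by (intro iter_deriv_zero_open[OF schwartz_smooth[OF schwartz_mult_slow[OF m f]], of "ball 0 (real n + 1)"] words_lists[OF vs]) auto
        then show ?thesis using sbound_nonneg[OF B[of n]] by simp
      next
        case False
        have "real (Suc n) * ((1 + norm x) ^ N * ?d) \<le> (1 + norm x) * ((1 + norm x) ^ N * ?d)"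
          using False by (intro mult_right_mono) auto
        also have "\<dots> \<le> C * c" using sboundD[OF B words_mono[OF vs], of x n] by (simp add: mult.assoc)
        finally show ?thesis by (simp add: field_simps)
      qed
    qed
    moreover have "(\<lambda>n. C * c * inverse (real (Suc n))) \<longlonglongrightarrow> 0"
      using tendsto_mult_right_zero[OF LIMSEQ_inverse_real_of_nat] .
    ultimately show "\<exists>c. c \<longlonglongrightarrow> 0 \<and> (\<forall>n. sbound N (c n) (\<lambda>x. ?m n x * f x))"
      by (intro exI[of _ "\<lambda>n. C * c * inverse (real (Suc n))"]) auto
  qed
  moreover have "u (\<lambda>x. ?m n x * f x) = u f" for n
  proof -
    have "(\<lambda>x. ?m n x * f x) = (\<lambda>x. f x - \<eta> n x * f x)" by (simp add: algebra_simps)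
    then show ?thesis using cfunctional_diff[OF u f schwartz_mult_slow[OF \<eta> f]] zero by simp
  qed
  ultimately show ?thesis by (simp add: LIMSEQ_const_iff)
qed

section \<open>Support of a distribution\<close>

text \<open>A telescoping substitute for a partition of unity: with \<open>\<psi>\<close> equal to \<open>1\<close> on one ball of the cover,
  \<open>\<psi> f\<close> is annihilated, and \<open>(1 - \<psi>) f\<close> is supported in the remaining balls.\<close>

lemma cfunctional_zero_cover:
  assumes u: "cfunctional (u :: 'a::euclidean_space distr)"
    and "finite P" and P: "\<And>p r. (p, r) \<in> P \<Longrightarrow> r > 0 \<and> (\<exists>U. cball p (2 * r) \<subseteq> U \<and> vanishes_on u U)"
    and "smooth f" "compact (closure (support_on UNIV f))"
    and "closure (support_on UNIV f) \<subseteq> (\<Union>(p, r)\<in>P. ball p r)"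
  shows "u f = 0"
  using assms(2-)
proof (induction P arbitrary: f)
  case empty
  then have "f = (\<lambda>x. 0)" by (auto simp: support_on_def)
  then show ?case using cfunctional_zero[OF u] by simp
next
  case (insert z P)
  obtain p r where z: "z = (p, r)" by fastforce
  then obtain U where r: "r > 0" and U: "cball p (2 * r) \<subseteq> U" "vanishes_on u U" using insert.prems(1) by blast
  obtain \<psi> :: "nat \<Rightarrow> 'a \<Rightarrow> complex" where \<psi>: "slow \<psi>" "\<And>n x. norm (x - p) \<le> r \<Longrightarrow> \<psi> n x = 1"
    "\<And>n x. norm (x - p) \<ge> 2 * r \<Longrightarrow> \<psi> n x = 0" using bump_family[of r "\<lambda>_. r" p] r by auto
  let ?f1 = "\<lambda>x. \<psi> 0 x * f x" and ?f2 = "\<lambda>x. (1 - \<psi> 0 x) * f x"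
  have sm: "smooth ?f1" "smooth ?f2"
    by (intro smooth_mult smooth_diff smooth_const slow_smooth[OF \<psi>(1)] insert.prems)+
  have s1: "closure (support_on UNIV ?f1) \<subseteq> cball p (2 * r)"
  proof (rule closure_minimal)
    show "support_on UNIV ?f1 \<subseteq> cball p (2 * r)"
      using \<psi>(3)[of _ 0] by (force simp: support_on_def dist_norm norm_minus_commute)
  qed simp
  have s2: "closure (support_on UNIV ?f2) \<subseteq> closure (support_on UNIV f) - ball p r"
  proof (rule closure_minimal)
    show "support_on UNIV ?f2 \<subseteq> closure (support_on UNIV f) - ball p r"
      using closure_subset[of "support_on UNIV f"] \<psi>(2)[of _ 0]
      by (auto simp: support_on_def dist_norm norm_minus_commute)
  qed (auto intro: closed_Diff)
  have c1: "compact (closure (support_on UNIV ?f1))"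
    using s1 bounded_subset[OF bounded_cball] by (simp add: compact_eq_bounded_closed)
  have c2: "compact (closure (support_on UNIV ?f2))"
    using s2 insert.prems(3) bounded_subset by (auto simp: compact_eq_bounded_closed)
  have u1: "u ?f1 = 0"
    using U(2)[unfolded vanishes_on_def, rule_format, of ?f1] order_trans[OF s1 U(1)] c1 sm(1) by simp
  have u2: "u ?f2 = 0"
  proof (rule insert.IH[OF _ sm(2) c2])
    show "closure (support_on UNIV ?f2) \<subseteq> (\<Union>(p, r)\<in>P. ball p r)"
      using insert.prems(4) s2 z by auto
  qed (use insert.prems(1) in blast)
  have t: "g \<in> test" if g: "smooth g" "compact (closure (support_on UNIV g))" for g :: "'a \<Rightarrow> complex"
  proof -
    obtain R where R: "\<And>x. x \<in> closure (support_on UNIV g) \<Longrightarrow> norm x \<le> R"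
      using compact_imp_bounded[OF g(2)] unfolding bounded_iff by blast
    have "\<And>x. norm x > R \<Longrightarrow> g x = 0"
      using R closure_subset[of "support_on UNIV g"] by (force simp: support_on_def)
    then show ?thesis using g by (auto simp: test_def)
  qed
  have "f = (\<lambda>x. ?f1 x + ?f2 x)" by (simp add: algebra_simps)
  then have "u f = u ?f1 + u ?f2"
    using cfunctional_add[OF u test_schwartz[OF t[OF sm(1) c1]] test_schwartz[OF t[OF sm(2) c2]]] by simp
  then show ?case using u1 u2 by simp
qed

lemma cfunctional_zero_off_support:
  assumes u: "cfunctional (u :: 'a::euclidean_space distr)" and f: "smooth f"
    and c: "compact (closure (support_on UNIV f))"
    and s: "closure (support_on UNIV f) \<inter> dist_support u = {}"
  shows "u f = 0"
proof -
  let ?C = "closure (support_on UNIV f)"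
  have "\<exists>r U. r > 0 \<and> cball p (2 * r) \<subseteq> U \<and> vanishes_on u U" if "p \<in> ?C" for p
  proof -
    have "p \<in> \<Union>{U. open U \<and> vanishes_on u U}"
      using s that unfolding dist_support_def by (simp add: disjoint_iff del: Union_iff)
    then obtain U where U: "open U" "vanishes_on u U" "p \<in> U" by (auto simp del: UnionE)
    then obtain e where "e > 0" "cball p e \<subseteq> U" using open_contains_cball[of U] by auto
    then show ?thesis using U by (intro exI[of _ "e / 2"] exI[of _ U]) auto
  qed
  then obtain r where r: "\<And>p. p \<in> ?C \<Longrightarrow> r p > 0 \<and> (\<exists>U. cball p (2 * r p) \<subseteq> U \<and> vanishes_on u U)"
    by metis
  have "?C \<subseteq> (\<Union>p\<in>?C. ball p (r p))" using r by auto
  then obtain D where D: "D \<subseteq> ?C" "finite D" "?C \<subseteq> (\<Union>p\<in>D. ball p (r p))"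
    using compactE_image[OF c, of ?C "\<lambda>p. ball p (r p)"] by auto
  show ?thesis
  proof (rule cfunctional_zero_cover[OF u _ _ f c, of "(\<lambda>p. (p, r p)) ` D"])
    show "finite ((\<lambda>p. (p, r p)) ` D)" using D by simp
    show "\<And>p r'. (p, r') \<in> (\<lambda>p. (p, r p)) ` D \<Longrightarrow> r' > 0 \<and> (\<exists>U. cball p (2 * r') \<subseteq> U \<and> vanishes_on u U)"
      using r D(1) by auto
    show "?C \<subseteq> (\<Union>(p, r)\<in>(\<lambda>p. (p, r p)) ` D. ball p r)" using D(3) by auto
  qed
qed

text \<open>For \<open>\<theta>\<close> equal to \<open>1\<close> on a large ball, \<open>(1 - \<theta>) f\<close> is a limit of test functions supported away from the
  support of the distribution.\<close>

lemma compact_support_cutoff: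
  assumes u: "cfunctional (u :: 'a::euclidean_space distr)" and c: "compact (dist_support u)"
  obtains \<theta> where "\<theta> \<in> test" "\<And>f. f \<in> schwartz \<Longrightarrow> u f = u (\<lambda>x. \<theta> x * f x)"
proof -
  obtain \<eta> :: "nat \<Rightarrow> 'a \<Rightarrow> complex" where \<eta>: "slow \<eta>" "\<And>n. \<eta> n \<in> test"
    "\<And>n x. norm x \<le> real n + 1 \<Longrightarrow> \<eta> n x = 1" using cutoff_family by blast
  obtain R where R: "\<And>x. x \<in> dist_support u \<Longrightarrow> norm x \<le> R"
    using compact_imp_bounded[OF c] unfolding bounded_iff by blast
  obtain n where n: "R \<le> real n" using real_arch_simple by blast
  show ?thesis
  proof (rule that[of "\<eta> n"])
    show "\<eta> n \<in> test" by (rule \<eta>(2))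
    fix f :: "'a \<Rightarrow> complex" assume f: "f \<in> schwartz"
    have chif: "(\<lambda>x. \<eta> n x * f x) \<in> schwartz" by (rule schwartz_mult_slow[OF \<eta>(1) f])
    let ?g = "\<lambda>x. f x - \<eta> n x * f x"
    have g: "?g \<in> schwartz" by (rule schwartz_diff[OF f chif])
    have "u ?g = 0"
    proof (rule cfunctional_cutoff_limit[OF u g \<eta>(1,3)])
      fix m
      let ?h = "\<lambda>x. \<eta> m x * ?g x"
      obtain R' where R': "\<And>x. norm x > R' \<Longrightarrow> \<eta> m x = 0" using \<eta>(2)[of m] unfolding test_def by blast
      have b: "closure (support_on UNIV ?h) \<subseteq> cball 0 R'"
      proof (rule closure_minimal)
        show "support_on UNIV ?h \<subseteq> cball 0 R'"
        proof
          fix x assume "x \<in> support_on UNIV ?h"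
          then have "\<eta> m x \<noteq> 0" by (simp add: support_on_def)
          then have "norm x \<le> R'" using R'[of x] by linarith
          then show "x \<in> cball 0 R'" by simp
        qed
      qed simp
      have a: "closure (support_on UNIV ?h) \<subseteq> - ball 0 (real n + 1)"
        using \<eta>(3)[of _ n] by (intro closure_minimal) (auto simp: support_on_def)
      show "u ?h = 0"
      proof (rule cfunctional_zero_off_support[OF u])
        show "smooth ?h" by (intro smooth_mult slow_smooth[OF \<eta>(1)] schwartz_smooth[OF g])
        show "compact (closure (support_on UNIV ?h))"
          using b bounded_subset[OF bounded_cball] by (simp add: compact_eq_bounded_closed)
        show "closure (support_on UNIV ?h) \<inter> dist_support u = {}" 
        proof (rule ccontr)
          assume "\<not> ?thesis"
          then obtain x where x: "x \<in> closure (support_on UNIV ?h)" "x \<in> dist_support u" by auto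
          then have "x \<in> - ball 0 (real n + 1)" using a by (rule_tac subsetD)
          then show False using R[OF x(2)] n by simp
        qed
      qed
    qed
    then show "u f = u (\<lambda>x. \<eta> n x * f x)" using cfunctional_diff[OF u f chif] by simp
  qed
qed

section \<open>The Fourier transform on Schwartz space\<close>

text \<open>The square of \<open>1 + |x|\<close> dominates every \<open>1 + x\<^sub>b\<^sup>2\<close>, so the function is bounded by a product of
  integrable functions of one variable.\<close>

lemma integrable_inverse_power_norm:
  "integrable lborel (\<lambda>x::'a::euclidean_space. 1 / (1 + norm x) ^ (2 * DIM('a)))"
proof (rule integrableI_bounded)
  have int1: "integrable lborel (\<lambda>t::real. inverse (1 + t\<^sup>2))"
    using integrable_inverse_1_plus_square by (simp add: set_integrable_def einterval_def)
  have "(\<integral>\<^sup>+ (x::'a). ennreal (norm (1 / (1 + norm x) ^ (2 * DIM('a)))) \<partial>lborel) \<le>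
    (\<integral>\<^sup>+ (x::'a). (\<Prod>b\<in>Basis. ennreal (inverse (1 + (x \<bullet> b)\<^sup>2))) \<partial>lborel)"
  proof (rule nn_integral_mono)
    fix x :: 'a
    have le: "1 + (x \<bullet> b)\<^sup>2 \<le> (1 + norm x)\<^sup>2" if "b \<in> Basis" for b
    proof -
      have "(x \<bullet> b)\<^sup>2 \<le> (norm x)\<^sup>2" using Basis_le_norm[OF that, of x] power_mono[of "\<bar>x \<bullet> b\<bar>" "norm x" 2] by simp
      moreover have "(1 + norm x)\<^sup>2 = 1 + 2 * norm x + (norm x)\<^sup>2" by (simp add: power2_sum)
      ultimately show ?thesis using norm_ge_zero[of x] by linarith
    qed
    have "(\<Prod>b\<in>(Basis::'a set). inverse ((1 + norm x)\<^sup>2)) \<le> (\<Prod>b\<in>Basis. inverse (1 + (x \<bullet> b)\<^sup>2))"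
    proof (rule prod_mono, rule conjI)
      fix b :: 'a assume "b \<in> Basis"
      then show "inverse ((1 + norm x)\<^sup>2) \<le> inverse (1 + (x \<bullet> b)\<^sup>2)"
        using le by (intro le_imp_inverse_le) (auto intro: add_pos_nonneg)
    qed simp
    also have "(\<Prod>b\<in>(Basis::'a set). inverse ((1 + norm x)\<^sup>2)) = 1 / (1 + norm x) ^ (2 * DIM('a))"
      by (simp add: power_mult power_inverse divide_inverse)
    finally show "ennreal (norm (1 / (1 + norm x) ^ (2 * DIM('a)))) \<le>
        (\<Prod>b\<in>Basis. ennreal (inverse (1 + (x \<bullet> b)\<^sup>2)))"
      by (subst prod_ennreal) (auto intro!: ennreal_leI)
  qed
  also have "\<dots> = (\<Prod>b\<in>(Basis::'a set). (\<integral>\<^sup>+ t. ennreal (inverse (1 + t\<^sup>2)) \<partial>lborel))"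
    by (rule nn_integral_lborel_prod) auto
  also have "\<dots> < \<infinity>"
    using int1 unfolding integrable_iff_bounded 
    by (simp add: less_top[symmetric] power_eq_top_ennreal_iff)
  finally show "(\<integral>\<^sup>+ (x::'a). ennreal (norm (1 / (1 + norm x) ^ (2 * DIM('a)))) \<partial>lborel) < \<infinity>" .
qed simp

text \<open>The natural domain of the differentiation rule for the Fourier transform. It contains, besides
  Schwartz functions, all their products with measurable functions of polynomial growth.\<close>

definition moments :: "('a::euclidean_space \<Rightarrow> complex) \<Rightarrow> bool" where
  "moments f \<longleftrightarrow> f \<in> borel_measurable borel \<and>
     (\<forall>k. integrable lborel (\<lambda>x. (1 + norm x) ^ k * norm (f x)))"

lemma momentsI:
  assumes "f \<in> borel_measurable borel" "\<And>k. \<exists>c. \<forall>x. (1 + norm x) ^ k * norm (f x) \<le> c"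
  shows "moments (f :: 'a::euclidean_space \<Rightarrow> complex)"
  unfolding moments_def
proof (intro conjI allI assms(1))
  fix k
  obtain c where c: "\<And>x. (1 + norm x) ^ (k + 2 * DIM('a)) * norm (f x) \<le> c" using assms(2) by blast
  have "integrable lborel (\<lambda>x::'a. c * (1 / (1 + norm x) ^ (2 * DIM('a))))"
    using integrable_inverse_power_norm by (rule integrable_mult_right)
  then show "integrable lborel (\<lambda>x. (1 + norm x) ^ k * norm (f x))"
  proof (rule Bochner_Integration.integrable_bound)
    show "AE x in lborel. norm ((1 + norm x) ^ k * norm (f x)) \<le> norm (c * (1 / (1 + norm x) ^ (2 * DIM('a))))"
    proof (rule AE_I2)
      fix x :: 'a
      have p: "0 < (1 + norm x) ^ (2 * DIM('a))" by (intro zero_less_power add_pos_nonneg) auto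
      have "(1 + norm x) ^ k * norm (f x) \<le> c / (1 + norm x) ^ (2 * DIM('a))"
        using c[of x] p by (simp add: power_add field_simps)
      moreover have "0 \<le> (1 + norm x) ^ k * norm (f x)" by simp
      ultimately show "norm ((1 + norm x) ^ k * norm (f x)) \<le> norm (c * (1 / (1 + norm x) ^ (2 * DIM('a))))"
        by (simp only: real_norm_def times_divide_eq_right mult_1_right)
    qed
  qed (use assms(1) in simp)
qed

lemma schwartz_moments: "f \<in> schwartz \<Longrightarrow> moments f"
proof (rule momentsI)
  assume f: "f \<in> schwartz"
  show "f \<in> borel_measurable borel" using schwartz_smooth[OF f] smooth_measurable by blast
  show "\<exists>c. \<forall>x. (1 + norm x) ^ k * norm (f x) \<le> c" for k
    using schwartz_sbound[OF f, of k] sboundD[OF _ Nil_words, of k _ f] by auto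
qed

lemma moments_measurable: "moments f \<Longrightarrow> f \<in> borel_measurable borel"
  by (simp add: moments_def)

lemma moments_integrable_norm: "moments f \<Longrightarrow> integrable lborel (\<lambda>x. norm (f x))"
  unfolding moments_def by (metis (no_types, lifting) Bochner_Integration.integrable_cong mult_1 power_0)

lemma moments_integrable: "moments f \<Longrightarrow> integrable lborel f"
  using moments_integrable_norm[of f] moments_measurable[of f] by (simp add: integrable_norm_iff)

lemma moments_mult:
  assumes f: "moments f" and m: "m \<in> borel_measurable borel" and b: "\<And>x. norm (m x) \<le> C * (1 + norm x) ^ l"
  shows "moments (\<lambda>x. m x * f x)"
  unfolding moments_def
proof (intro conjI allI)
  show "(\<lambda>x. m x * f x) \<in> borel_measurable borel" using m moments_measurable[OF f] by simp
  fix k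
  have "integrable lborel (\<lambda>x. C * ((1 + norm x) ^ (k + l) * norm (f x)))"
    using f unfolding moments_def by (intro integrable_mult_right) blast
  then show "integrable lborel (\<lambda>x. (1 + norm x) ^ k * norm (m x * f x))"
  proof (rule Bochner_Integration.integrable_bound)
    show "AE x in lborel. norm ((1 + norm x) ^ k * norm (m x * f x)) \<le> norm (C * ((1 + norm x) ^ (k + l) * norm (f x)))"
    proof (rule AE_I2)
      fix x :: 'a
      have "(1 + norm x) ^ k * norm (m x * f x) = norm (m x) * ((1 + norm x) ^ k * norm (f x))" by (simp add: norm_mult)
      also have "\<dots> \<le> (C * (1 + norm x) ^ l) * ((1 + norm x) ^ k * norm (f x))"
        by (intro mult_right_mono b) auto
      also have "\<dots> = C * ((1 + norm x) ^ (k + l) * norm (f x))" by (simp add: power_add)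
      finally show "norm ((1 + norm x) ^ k * norm (m x * f x)) \<le> norm (C * ((1 + norm x) ^ (k + l) * norm (f x)))"
        by simp
    qed
  qed (use m moments_measurable[OF f] in simp)
qed

lemma integrable_mult_cis:
  assumes "integrable lborel (f :: 'a::euclidean_space \<Rightarrow> complex)"
  shows "integrable lborel (\<lambda>x. f x * cis (- 2 * pi * (\<xi> \<bullet> x)))"
proof (rule Bochner_Integration.integrable_bound[OF assms])
  have "(\<lambda>x. cis (- 2 * pi * (\<xi> \<bullet> x))) \<in> borel_measurable borel"
    by (intro borel_measurable_continuous_onI continuous_intros)
  then show "(\<lambda>x. f x * cis (- 2 * pi * (\<xi> \<bullet> x))) \<in> borel_measurable lborel"
    using borel_measurable_integrable[OF assms] by simp
qed (simp add: norm_mult)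

lemma norm_fourier_le: "norm (fourier f \<xi>) \<le> (LINT x|lborel. norm (f x))"
  unfolding fourier_def
  by (rule order_trans[OF integral_norm_bound]) (simp add: norm_mult)

lemma fourier_add:
  "integrable lborel f \<Longrightarrow> integrable lborel g \<Longrightarrow> fourier (\<lambda>x. f x + g x) = (\<lambda>\<xi>. fourier f \<xi> + fourier g \<xi>)"
  unfolding fourier_def fun_eq_iff distrib_right
  by (intro allI Bochner_Integration.integral_add integrable_mult_cis)

lemma fourier_cmult: "fourier (\<lambda>x. c * f x) = (\<lambda>\<xi>. c * fourier f \<xi>)"
  by (simp add: fourier_def fun_eq_iff mult.assoc)

text \<open>The factor that differentiation in direction \<open>v\<close> puts under the Fourier integral.\<close>

definition freq :: "'a::euclidean_space \<Rightarrow> 'a \<Rightarrow> complex" where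
  "freq v x = - 2 * pi * \<i> * of_real (x \<bullet> v)"

lemma freq_bound: "norm (freq v x) \<le> (2 * pi * norm v) * (1 + norm x) ^ 1"
proof -
  have "norm (freq v x) = 2 * pi * \<bar>x \<bullet> v\<bar>" by (simp add: freq_def norm_mult)
  also have "\<dots> \<le> 2 * pi * (norm x * norm v)" by (intro mult_left_mono Cauchy_Schwarz_ineq2) auto
  also have "\<dots> \<le> (2 * pi * norm v) * (1 + norm x) ^ 1" by (simp add: algebra_simps)
  finally show ?thesis .
qed

lemma freq_measurable [measurable]: "freq v \<in> borel_measurable borel"
  unfolding freq_def by measurable

lemma moments_freq: "moments f \<Longrightarrow> moments (\<lambda>x. freq v x * f x)"
  by (rule moments_mult[OF _ freq_measurable freq_bound])

lemma cis_second_order: "norm (cis \<delta> - 1 - \<i> * \<delta>) \<le> \<delta>\<^sup>2"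
proof -
  have "cmod (iexp \<delta> - (\<Sum>k\<le>1. (\<i> * \<delta>) ^ k / fact k)) \<le> \<bar>\<delta>\<bar> ^ Suc 1 / fact (Suc 1)"
    by (rule iexp_approx1)
  then have "norm (cis \<delta> - 1 - \<i> * \<delta>) \<le> \<delta>\<^sup>2 / 2"
    by (simp add: cis_conv_exp algebra_simps power2_eq_square)
  then show ?thesis by (rule order_trans) simp
qed

text \<open>The second-order remainder of the exponential is at most quadratic in the increment, with second
  moments of \<open>f\<close> as the constant.\<close>

lemma has_derivative_fourier:
  assumes f: "moments f"
  shows "(fourier f has_derivative (\<lambda>h. fourier (\<lambda>x. freq h x * f x) \<xi>)) (at \<xi>)"
proof -
  let ?D = "\<lambda>h. fourier (\<lambda>x. freq h x * f x) \<xi>"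
  define B where "B = (LINT x|lborel. (1 + norm x) ^ 1 * norm (f x))"
  define A where "A = (2 * pi)\<^sup>2 * (LINT x|lborel. (1 + norm x) ^ 2 * norm (f x))"
  have m: "integrable lborel (\<lambda>x. (1 + norm x) ^ k * norm (f x))" for k using f by (simp add: moments_def)
  have int: "integrable lborel (\<lambda>x. freq h x * f x)" for h by (rule moments_integrable[OF moments_freq[OF f]])
  have "bounded_linear ?D"
  proof (rule bounded_linear_intro[where K="2 * pi * B"])
    show "?D (h + k) = ?D h + ?D k" for h k
      using fun_cong[OF fourier_add[OF int int], of h k \<xi>] by (simp add: freq_def inner_add_right algebra_simps)
    show "?D (r *\<^sub>R h) = r *\<^sub>R ?D h" for r h
      using fun_cong[OF fourier_cmult, of "of_real r" "\<lambda>x. freq h x * f x" \<xi>]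
      by (simp add: freq_def algebra_simps scaleR_conv_of_real)
    fix h
    have "norm (?D h) \<le> (LINT x|lborel. norm (freq h x * f x))" by (rule norm_fourier_le)
    also have "\<dots> \<le> (LINT x|lborel. (2 * pi * norm h) * ((1 + norm x) ^ 1 * norm (f x)))"
      by (intro integral_mono integrable_norm int integrable_mult_right m)
         (simp only: norm_mult mult.assoc[symmetric], intro mult_right_mono freq_bound, simp)
    also have "\<dots> = (2 * pi * norm h) * B" unfolding B_def by (rule integral_mult_right_zero)
    finally show "norm (?D h) \<le> norm h * (2 * pi * B)" by (simp only: mult_ac)
  qed
  moreover have "((\<lambda>h. norm (fourier f (\<xi> + h) - fourier f \<xi> - ?D h) / norm h) \<longlongrightarrow> 0) (at 0)"
  proof (rule Lim_null_comparison)
    show "((\<lambda>h. A * norm h) \<longlongrightarrow> 0) (at 0)"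
      by (rule tendsto_mult_right_zero) (auto intro!: tendsto_norm_zero)
    have "norm (fourier f (\<xi> + h) - fourier f \<xi> - ?D h) \<le> A * norm h * norm h" for h
    proof -
      let ?e = "\<lambda>\<xi> x. cis (- 2 * pi * (\<xi> \<bullet> x))"
      have i: "integrable lborel (\<lambda>x. g x * ?e \<zeta> x)" if "integrable lborel g" for \<zeta> g
        using that by (rule integrable_mult_cis)
      have eq: "fourier f (\<xi> + h) - fourier f \<xi> - ?D h =
          (LINT x|lborel. f x * ?e (\<xi> + h) x - f x * ?e \<xi> x - freq h x * f x * ?e \<xi> x)"
        unfolding fourier_def
        using Bochner_Integration.integral_diff[OF Bochner_Integration.integrable_diff[OF
            i[OF moments_integrable[OF f], of "\<xi> + h"] i[OF moments_integrable[OF f], of \<xi>]] i[OF int, of h \<xi>]]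
          Bochner_Integration.integral_diff[OF i[OF moments_integrable[OF f], of "\<xi> + h"]
            i[OF moments_integrable[OF f], of \<xi>]] by (simp only:)
      have "norm (fourier f (\<xi> + h) - fourier f \<xi> - ?D h) \<le> (LINT x|lborel. norm (f x * ?e (\<xi> + h) x - f x * ?e \<xi> x - freq h x * f x * ?e \<xi> x))"
        unfolding eq by (rule integral_norm_bound)
      also have "\<dots> \<le> (LINT x|lborel. ((2 * pi)\<^sup>2 * (norm h)\<^sup>2) * ((1 + norm x) ^ 2 * norm (f x)))"
      proof (intro integral_mono integrable_norm integrable_mult_right m Bochner_Integration.integrable_diff i int moments_integrable[OF f])
        fix x :: 'a
        let ?\<delta> = "- 2 * pi * (h \<bullet> x)"
        have c: "?e (\<xi> + h) x = ?e \<xi> x * cis ?\<delta>"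
          by (simp add: cis_mult inner_add_left distrib_left)
        have eq: "f x * ?e (\<xi> + h) x - f x * ?e \<xi> x - freq h x * f x * ?e \<xi> x =
          f x * ?e \<xi> x * (cis ?\<delta> - 1 - \<i> * ?\<delta>)"
          unfolding c by (simp add: freq_def inner_commute algebra_simps)
        have "norm (f x * ?e (\<xi> + h) x - f x * ?e \<xi> x - freq h x * f x * ?e \<xi> x) \<le> norm (f x) * (?\<delta>)\<^sup>2"
          unfolding eq norm_mult norm_cis mult_1_right by (intro mult_left_mono cis_second_order) auto
        also have "\<dots> \<le> norm (f x) * ((2 * pi)\<^sup>2 * (norm h * (1 + norm x))\<^sup>2)"
        proof (rule mult_left_mono)
          have "\<bar>h \<bullet> x\<bar>\<^sup>2 \<le> (norm h * (1 + norm x))\<^sup>2"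
            using Cauchy_Schwarz_ineq2[of h x] by (intro power_mono) (auto simp: algebra_simps add_increasing)
          then show "?\<delta>\<^sup>2 \<le> (2 * pi)\<^sup>2 * (norm h * (1 + norm x))\<^sup>2"
            by (simp add: power_mult_distrib)
        qed simp
        also have "\<dots> = ((2 * pi)\<^sup>2 * (norm h)\<^sup>2) * ((1 + norm x) ^ 2 * norm (f x))"
          by (simp only: power_mult_distrib mult_ac)
        finally show "norm (f x * ?e (\<xi> + h) x - f x * ?e \<xi> x - freq h x * f x * ?e \<xi> x) \<le>
           ((2 * pi)\<^sup>2 * (norm h)\<^sup>2) * ((1 + norm x) ^ 2 * norm (f x))" .
      qed
      also have "\<dots> = ((2 * pi)\<^sup>2 * (norm h)\<^sup>2) * (LINT x|lborel. (1 + norm x) ^ 2 * norm (f x))"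
        by (rule integral_mult_right_zero)
      also have "\<dots> = A * norm h * norm h" unfolding A_def power2_eq_square by (simp only: mult_ac)
      finally show ?thesis .
    qed
    then show "\<forall>\<^sub>F h in at 0. norm (norm (fourier f (\<xi> + h) - fourier f \<xi> - ?D h) / norm h) \<le> A * norm h"
      by (intro always_eventually allI) (auto simp: divide_le_eq)
  qed
  ultimately show ?thesis by (simp add: has_derivative_at)
qed

lemma pd_fourier: "moments f \<Longrightarrow> pd v (fourier f) = fourier (\<lambda>x. freq v x * f x)"
  by (rule ext, rule pd_eqI, rule has_derivative_fourier)

lemma smooth_fourier: "moments f \<Longrightarrow> smooth (fourier f)"
proof -
  have "moments f \<Longrightarrow> ksmooth n (fourier f)" for n
  proof (induction n arbitrary: f)
    case (Suc n)
    have "fourier f differentiable_on UNIV"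
      using has_derivative_fourier[OF Suc.prems] unfolding differentiable_on_def differentiable_def by blast
    then show ?case using Suc by (simp add: pd_fourier moments_freq)
  qed simp
  then show "moments f \<Longrightarrow> smooth (fourier f)" by (simp add: smooth_iff_ksmooth)
qed

definition freqs :: "'a::euclidean_space list \<Rightarrow> 'a \<Rightarrow> complex" where
  "freqs vs x = prod_list (map (\<lambda>v. freq v x) vs)"

lemma moments_freqs: "moments f \<Longrightarrow> moments (\<lambda>x. freqs vs x * f x)"
  by (induction vs) (auto simp: freqs_def mult.assoc moments_freq)

lemma iter_deriv_fourier: "moments f \<Longrightarrow> iter_deriv vs (fourier f) = fourier (\<lambda>x. freqs vs x * f x)"
proof (induction vs)
  case (Cons v vs)
  then show ?case
    using pd_fourier[OF moments_freqs, of f v vs] by (simp add: iter_deriv_Cons freqs_def mult.assoc)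
qed (simp add: freqs_def)

lemma slow_freq: "slow (\<lambda>n. freq v)"
  unfolding freq_def by (intro slow_mult slow_const slow_inner)

lemma slow_freqs: "slow (\<lambda>n. freqs vs)"
proof (induction vs)
  case (Cons v vs)
  then show ?case using slow_mult[OF slow_freq Cons] by (simp add: freqs_def[abs_def])
qed (simp add: freqs_def[abs_def] slow_const)

text \<open>By translation invariance the difference quotients of \<open>g\<close> have integral zero, and the mean value
  theorem provides a dominating function for the passage to the limit.\<close>

lemma integral_pd_eq_zero:
  assumes g: "g \<in> schwartz" and v: "v \<in> Basis"
  shows "(LINT x|lborel. pd v g x) = 0"
proof -
  define h where "h n = inverse (real (Suc n))" for n
  have h: "0 < h n" "h n \<le> 1" for n by (auto simp: h_def field_simps)
  let ?q = "\<lambda>n x. (g (x + h n *\<^sub>R v) - g x) / of_real (h n)"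
  let ?K = "2 * DIM('a)"
  have gd: "g differentiable_on UNIV" by (rule smooth_differentiable[OF schwartz_smooth[OF g]])
  have gm: "g \<in> borel_measurable borel" by (rule smooth_measurable[OF schwartz_smooth[OF g]])
  have dm: "pd v g \<in> borel_measurable borel" by (rule smooth_measurable[OF schwartz_smooth[OF schwartz_pd[OF g v]]])
  obtain c where c: "sbound ?K c (pd v g)" using schwartz_sbound[OF schwartz_pd[OF g v]] by blast
  have path: "((\<lambda>s. g (x + s *\<^sub>R v)) has_derivative (\<lambda>t. of_real t * pd v g (x + s *\<^sub>R v))) (at s)" for x s
  proof -
    have "((\<lambda>s. x + s *\<^sub>R v) has_derivative (\<lambda>t. t *\<^sub>R v)) (at s)" by (auto intro!: derivative_eq_intros)
    from has_derivative_compose[OF this has_derivative_pd[OF gd]]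
    have 1: "((\<lambda>s. g (x + s *\<^sub>R v)) has_derivative (\<lambda>t. pd (t *\<^sub>R v) g (x + s *\<^sub>R v))) (at s)" .
    have "pd (t *\<^sub>R v) g y = of_real t * pd v g y" for t y
      using linear_scale[OF has_derivative_linear[OF has_derivative_pd[OF gd, of y]], of t v]
      by (simp add: scaleR_conv_of_real)
    then show ?thesis using 1 by simp
  qed
  have "(\<lambda>n. LINT x|lborel. ?q n x) \<longlonglongrightarrow> (LINT x|lborel. pd v g x)"
  proof (rule integral_dominated_convergence[where w="\<lambda>x. (c * 2 ^ ?K) * (1 / (1 + norm x) ^ ?K)"])
    show "pd v g \<in> borel_measurable lborel" using dm by simp
    show "?q n \<in> borel_measurable lborel" for n
      using measurable_compose[OF _ gm, of "\<lambda>x. x + h n *\<^sub>R v" borel] gm by simp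
    show "integrable lborel (\<lambda>x::'a. (c * 2 ^ ?K) * (1 / (1 + norm x) ^ ?K))"
      by (intro integrable_mult_right integrable_inverse_power_norm)
    show "AE x in lborel. (\<lambda>n. ?q n x) \<longlonglongrightarrow> pd v g x"
    proof (rule AE_I2)
      fix x
      have a1: "((\<lambda>s. norm (g (x + s *\<^sub>R v) - g x - of_real s * pd v g x) / norm s) \<longlongrightarrow> 0) (at 0)"
        using path[of x 0] by (simp add: has_derivative_at)
      have a2: "norm (g (x + s *\<^sub>R v) - g x - of_real s * pd v g x) / norm s =
          norm ((g (x + s *\<^sub>R v) - g x) /\<^sub>R s - pd v g x)" if "s \<noteq> 0" for s
      proof -
        have "(g (x + s *\<^sub>R v) - g x) /\<^sub>R s - pd v g x = (g (x + s *\<^sub>R v) - g x - of_real s * pd v g x) /\<^sub>R s"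
          using that by (simp add: scaleR_conv_of_real field_simps)
        then show ?thesis by (simp add: divide_inverse mult.commute)
      qed
      have "((\<lambda>s. norm ((g (x + s *\<^sub>R v) - g x) /\<^sub>R s - pd v g x)) \<longlongrightarrow> 0) (at 0)"
        by (rule Lim_transform_eventually[OF a1]) (simp add: eventually_at_filter a2[unfolded real_norm_def])
      then have "((\<lambda>s. (g (x + s *\<^sub>R v) - g x) /\<^sub>R s) \<longlongrightarrow> pd v g x) (at 0)"
        by (subst Lim_null) (rule tendsto_norm_zero_cancel)
      moreover have "filterlim h (at 0) sequentially"
        unfolding filterlim_at using LIMSEQ_inverse_real_of_nat h by (auto simp: h_def[abs_def] intro: always_eventually)
      ultimately have "(\<lambda>n. (g (x + h n *\<^sub>R v) - g x) /\<^sub>R h n) \<longlonglongrightarrow> pd v g x"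
        by (rule filterlim_compose)
      then show "(\<lambda>n. ?q n x) \<longlonglongrightarrow> pd v g x" by (simp add: scaleR_conv_of_real divide_inverse mult.commute)
    qed
    fix n
    show "AE x in lborel. norm (?q n x) \<le> (c * 2 ^ ?K) * (1 / (1 + norm x) ^ ?K)"
    proof (rule AE_I2)
      fix x :: 'a
      have "\<exists>s\<in>{0<..<h n}. norm (g (x + h n *\<^sub>R v) - g (x + 0 *\<^sub>R v)) \<le> norm (of_real (h n - 0) * pd v g (x + s *\<^sub>R v))"
        by (rule mvt_general[OF h(1), where f="\<lambda>s. g (x + s *\<^sub>R v)"])
           (auto intro!: path continuous_at_imp_continuous_on has_derivative_continuous)
      then obtain s where s: "0 < s" "s < h n" "norm (g (x + h n *\<^sub>R v) - g x) \<le> h n * norm (pd v g (x + s *\<^sub>R v))"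
        using h(1)[of n] by (auto simp: norm_mult)
      have "norm (?q n x) \<le> norm (pd v g (x + s *\<^sub>R v))"
        using s(3) h(1)[of n] by (simp add: norm_divide field_simps)
      also have "\<dots> \<le> c / (1 + norm (x + s *\<^sub>R v)) ^ ?K"
        using sboundD[OF c Nil_words, of "x + s *\<^sub>R v"] by (simp add: field_simps add_pos_nonneg)
      also have "\<dots> \<le> c / ((1 + norm x) / 2) ^ ?K"
      proof (intro divide_left_mono power_mono mult_pos_pos zero_less_power sbound_nonneg[OF c])
        have "norm x \<le> norm (x + s *\<^sub>R v) + norm (s *\<^sub>R v)" using norm_triangle_ineq4[of "x + s *\<^sub>R v" "s *\<^sub>R v"] by simp
        moreover have "norm (s *\<^sub>R v) \<le> 1" using v s h(2)[of n] by simp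
        ultimately have "norm x \<le> norm (x + s *\<^sub>R v) + 1" using add_left_mono order_trans by blast
        then have "norm x + 1 \<le> 2 * norm (x + s *\<^sub>R v) + 2"
          by (rule_tac order_trans[OF add_right_mono]) (assumption, simp)
        then show "(1 + norm x) / 2 \<le> 1 + norm (x + s *\<^sub>R v)" by simp
      qed (auto intro: add_pos_nonneg)
      finally show "norm (?q n x) \<le> (c * 2 ^ ?K) * (1 / (1 + norm x) ^ ?K)"
        by (simp add: power_divide)
    qed
  qed
  moreover have q0: "(LINT x|lborel. ?q n x) = 0" for n
  proof -
    have gi: "integrable lborel g" by (rule moments_integrable[OF schwartz_moments[OF g]])
    have eq: "lborel = distr lborel borel (\<lambda>x. x + h n *\<^sub>R v)"
    proof -
      have "(\<lambda>x. x + h n *\<^sub>R v) = (+) (h n *\<^sub>R v)" by (rule ext) (rule add.commute)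
      then show ?thesis using lborel_distr_plus[of "h n *\<^sub>R v"] by simp
    qed
    have i1: "integrable lborel (\<lambda>x. g (x + h n *\<^sub>R v))"
      using gi integrable_distr_eq[of "\<lambda>x. x + h n *\<^sub>R v" lborel borel g] gm by (subst (asm) eq) auto
    have i2: "(LINT x|lborel. g (x + h n *\<^sub>R v)) = (LINT x|lborel. g x)"
      by (subst (2) eq, subst integral_distr) (use gm in auto)
    show ?thesis using i1 i2 gi by simp
  qed
  ultimately show ?thesis unfolding q0 by (simp add: LIMSEQ_const_iff)
qed

text \<open>Integration by parts, in the form that the derivative of \<open>f\<close> times the exponential has integral
  zero.\<close>

lemma fourier_pd:
  assumes f: "f \<in> schwartz" and v: "v \<in> Basis"
  shows "fourier (pd v f) \<xi> = 2 * pi * \<i> * of_real (\<xi> \<bullet> v) * fourier f \<xi>"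
proof -
  let ?Q = "freq \<xi>"
  have e: "cis (- 2 * pi * (\<xi> \<bullet> x)) = exp (?Q x)" for x
    by (simp add: cis_conv_exp freq_def inner_commute mult_ac)
  have bl: "bounded_linear ?Q"
    unfolding freq_def
    by (intro bounded_linear_compose[OF bounded_linear_mult_right]
        bounded_linear_compose[OF bounded_linear_of_real] bounded_linear_inner_left)
  have pQ: "pd v ?Q x = - 2 * pi * \<i> * of_real (\<xi> \<bullet> v)" for x
    using pd_eqI[OF bounded_linear_imp_has_derivative[OF bl]] by (simp add: freq_def inner_commute)
  have fe: "(\<lambda>x. f x * exp (?Q x)) \<in> schwartz"
    using schwartz_mult_slow[OF slow_exp_imaginary[OF slow_freq[of \<xi>]] f] by (simp add: freq_def mult.commute)
  have d: "f differentiable_on UNIV" "?Q differentiable_on UNIV"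
    by (rule smooth_differentiable[OF schwartz_smooth[OF f]], rule smooth_differentiable[OF smooth_linear[OF bl]])
  have i: "integrable lborel (\<lambda>x. pd v f x * exp (?Q x))" "integrable lborel (\<lambda>x. f x * exp (?Q x))"
    unfolding e[symmetric]
    by (intro integrable_mult_cis moments_integrable[OF schwartz_moments] schwartz_pd f v)+
  have "0 = (LINT x|lborel. pd v (\<lambda>x. f x * exp (?Q x)) x)" using integral_pd_eq_zero[OF fe v] by simp
  also have "\<dots> = (LINT x|lborel. pd v f x * exp (?Q x) + (- 2 * pi * \<i> * of_real (\<xi> \<bullet> v)) * (f x * exp (?Q x)))"
    unfolding pd_mult_exp[OF d] pQ by (simp add: algebra_simps)
  also have "\<dots> = fourier (pd v f) \<xi> + (- 2 * pi * \<i> * of_real (\<xi> \<bullet> v)) * fourier f \<xi>"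
    using i unfolding fourier_def e by simp
  finally show ?thesis by (simp add: algebra_simps)
qed

text \<open>Each further power of the weight is paid for by one derivative of \<open>f\<close>, because \<open>|\<xi>|\<close> is at most the
  sum of its coordinates and these come from derivatives.\<close>

lemma fourier_decay:
  "\<exists>M C. C \<ge> 0 \<and> (\<forall>f\<in>schwartz. \<forall>c. sbound M c f \<longrightarrow>
     (\<forall>\<xi>::'a::euclidean_space. (1 + norm \<xi>) ^ N * norm (fourier f \<xi>) \<le> C * c))"
proof (induction N)
  case 0
  let ?K = "2 * DIM('a)"
  let ?I = "LINT x::'a|lborel. 1 / (1 + norm x) ^ ?K"
  have "norm (fourier f \<xi>) \<le> ?I * c" if f: "f \<in> schwartz" "sbound ?K c f" for f c and \<xi> :: 'a
  proof -
    have "norm (fourier f \<xi>) \<le> (LINT x|lborel. norm (f x))" by (rule norm_fourier_le)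
    also have "\<dots> \<le> (LINT x::'a|lborel. c * (1 / (1 + norm x) ^ ?K))"
    proof (intro integral_mono integrable_mult_right integrable_inverse_power_norm moments_integrable_norm[OF schwartz_moments[OF f(1)]])
      show "norm (f x) \<le> c * (1 / (1 + norm x) ^ ?K)" for x
        using sboundD[OF f(2) Nil_words, of x] by (simp add: field_simps add_pos_nonneg)
    qed
    also have "\<dots> = c * ?I" by (rule integral_mult_right_zero)
    finally show ?thesis by (simp only: mult.commute)
  qed
  moreover have "?I \<ge> 0" by (intro integral_nonneg_AE AE_I2) simp
  ultimately show ?case by (intro exI[of _ ?K] exI[of _ ?I]) auto
next
  case (Suc N)
  then obtain M C where C: "C \<ge> 0" "\<And>f c \<xi>. f \<in> schwartz \<Longrightarrow> sbound M c f \<Longrightarrow>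
     (1 + norm \<xi>) ^ N * norm (fourier f (\<xi>::'a)) \<le> C * c" by blast
  have "(1 + norm \<xi>) ^ Suc N * norm (fourier f \<xi>) \<le> (C * (1 + real DIM('a))) * c"
    if f: "f \<in> schwartz" "sbound (Suc M) c f" for f c and \<xi> :: 'a
  proof -
    let ?w = "(1 + norm \<xi>) ^ N"
    have 1: "1 + norm \<xi> \<le> 1 + (\<Sum>b\<in>Basis. \<bar>\<xi> \<bullet> b\<bar>)" using norm_le_l1[of \<xi>] by simp
    have b: "\<bar>\<xi> \<bullet> b\<bar> * norm (fourier f \<xi>) \<le> norm (fourier (pd b f) \<xi>)" if "b \<in> Basis" for b
    proof -
      have "1 \<le> 2 * pi" using pi_ge_two by linarith
      then have "\<bar>\<xi> \<bullet> b\<bar> * norm (fourier f \<xi>) \<le> (2 * pi) * (\<bar>\<xi> \<bullet> b\<bar> * norm (fourier f \<xi>))"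
        using mult_right_mono[of 1 "2 * pi" "\<bar>\<xi> \<bullet> b\<bar> * norm (fourier f \<xi>)"] by simp
      also have "\<dots> = norm (fourier (pd b f) \<xi>)" unfolding fourier_pd[OF f(1) that] by (simp add: norm_mult)
      finally show ?thesis .
    qed
    have "(1 + norm \<xi>) ^ Suc N * norm (fourier f \<xi>) = ?w * ((1 + norm \<xi>) * norm (fourier f \<xi>))" by simp
    also have "\<dots> \<le> ?w * ((1 + (\<Sum>b\<in>Basis. \<bar>\<xi> \<bullet> b\<bar>)) * norm (fourier f \<xi>))"
      using 1 by (intro mult_left_mono mult_right_mono) auto
    also have "\<dots> \<le> ?w * (norm (fourier f \<xi>) + (\<Sum>b\<in>Basis. norm (fourier (pd b f) \<xi>)))"
      unfolding distrib_right mult_1 sum_distrib_right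
      by (intro mult_left_mono add_mono sum_mono b) auto
    also have "\<dots> = ?w * norm (fourier f \<xi>) + (\<Sum>b\<in>Basis. ?w * norm (fourier (pd b f) \<xi>))"
      by (simp add: distrib_left sum_distrib_left)
    also have "\<dots> \<le> C * c + (\<Sum>b\<in>(Basis::'a set). C * c)"
      using f by (intro add_mono sum_mono C(2) schwartz_pd sbound_pd) (auto intro: sbound_mono_index)
    finally show ?thesis by (simp add: algebra_simps)
  qed
  then show ?case using C(1) by (intro exI[of _ "Suc M"] exI[of _ "C * (1 + real DIM('a))"]) auto
qed

theorem coperator_fourier: "coperator (fourier :: ('a::euclidean_space \<Rightarrow> complex) \<Rightarrow> _)"
proof -
  have ex: "\<exists>M C. C \<ge> 0 \<and> (\<forall>f\<in>schwartz. \<forall>c. sbound M c f \<longrightarrow>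
     (\<forall>\<xi>::'a. (1 + norm \<xi>) ^ N * norm (iter_deriv vs (fourier f) \<xi>) \<le> C * c))" for N vs
  proof -
    obtain M C where C: "C \<ge> 0" "\<And>f c \<xi>. f \<in> schwartz \<Longrightarrow> sbound M c f \<Longrightarrow>
       (1 + norm \<xi>) ^ N * norm (fourier f (\<xi>::'a)) \<le> C * c" using fourier_decay[of N] by blast
    obtain D L where D: "D \<ge> 0" "\<And>f c. smooth f \<Longrightarrow> sbound L c f \<Longrightarrow> sbound M (D * c) (\<lambda>x. freqs vs x * f x)"
      using sbound_mult_slow[OF slow_freqs[of vs], of M] by blast
    have "(1 + norm \<xi>) ^ N * norm (iter_deriv vs (fourier f) \<xi>) \<le> (C * D) * c"
      if "f \<in> schwartz" "sbound L c f" for f :: "'a \<Rightarrow> complex" and c \<xi>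
      unfolding iter_deriv_fourier[OF schwartz_moments[OF that(1)]]
      using C(2)[OF schwartz_mult_slow[OF slow_freqs that(1)] D(2)[OF schwartz_smooth[OF that(1)] that(2)]]
      by (simp add: mult.assoc)
    then show ?thesis using C(1) D(1) by (intro exI[of _ L] exI[of _ "C * D"]) auto
  qed
  have bound: "\<exists>M C. \<forall>f\<in>schwartz. \<forall>c. sbound M c f \<longrightarrow> sbound N (C * c) (fourier f :: 'a \<Rightarrow> complex)" for N
  proof -
    obtain M C where C: "\<And>vs. C vs \<ge> 0" "\<And>vs f c \<xi>. f \<in> schwartz \<Longrightarrow> sbound (M vs) c f \<Longrightarrow>
       (1 + norm \<xi>) ^ N * norm (iter_deriv vs (fourier f) (\<xi>::'a)) \<le> C vs * c"
      using ex[of N] by metis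
    have "sbound N ((\<Sum>vs\<in>words N. C vs) * c) (fourier f)"
      if f: "f \<in> schwartz" "sbound (\<Sum>vs\<in>words N. M vs) c f" for f :: "'a \<Rightarrow> complex" and c
      unfolding sbound_def
    proof (intro ballI allI)
      fix vs :: "'a list" and \<xi> assume vs: "vs \<in> words N"
      have "sbound (M vs) c f" using vs by (intro sbound_mono_index[OF f(2)] member_le_sum) auto
      then have "(1 + norm \<xi>) ^ N * norm (iter_deriv vs (fourier f) \<xi>) \<le> C vs * c" using C(2) f(1) by blast
      also have "\<dots> \<le> (\<Sum>vs\<in>words N. C vs) * c"
        using vs C(1) sbound_nonneg[OF f(2)] by (intro mult_right_mono member_le_sum) auto
      finally show "(1 + norm \<xi>) ^ N * norm (iter_deriv vs (fourier f) \<xi>) \<le> \<dots>" .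
    qed
    then show ?thesis by blast
  qed
  show ?thesis unfolding coperator_def
  proof (intro conjI ballI allI bound)
    fix f :: "'a \<Rightarrow> complex" assume f: "f \<in> schwartz"
    show "fourier f \<in> schwartz" unfolding schwartz_iff_sbound
    proof (intro conjI allI)
      show "smooth (fourier f)" by (rule smooth_fourier[OF schwartz_moments[OF f]])
      show "\<exists>c. sbound N c (fourier f)" for N using bound[of N] schwartz_sbound[OF f] f by blast
    qed
    show "fourier (\<lambda>x. c * f x) = (\<lambda>\<xi>. c * fourier f \<xi>)" for c by (rule fourier_cmult)
    fix g :: "'a \<Rightarrow> complex" assume g: "g \<in> schwartz"
    show "fourier (\<lambda>x. f x + g x) = (\<lambda>\<xi>. fourier f \<xi> + fourier g \<xi>)"
      by (intro fourier_add moments_integrable schwartz_moments f g)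
  qed
qed

section \<open>Gaussians and Fourier inversion\<close>

lemma power_le_fact_exp: "0 \<le> y \<Longrightarrow> y ^ k \<le> fact k * exp (y::real)"
proof -
  assume y: "0 \<le> y"
  have s: "summable (\<lambda>n. y ^ n /\<^sub>R fact n)" using exp_converges[of y] sums_summable by blast
  have "(\<Sum>n\<in>{k}. y ^ n /\<^sub>R fact n) \<le> (\<Sum>n. y ^ n /\<^sub>R fact n)"
    by (rule sum_le_suminf[OF s]) (use y in auto)
  then have "y ^ k / fact k \<le> exp y" by (simp add: exp_def divide_inverse mult.commute)
  then show ?thesis by (simp add: field_simps)
qed

text \<open>The elementary inequality \<open>y ^ k \<le> k! exp y\<close> is applied to \<open>y = \<epsilon> (1 + t)\<^sup>2 / 2 \<le> \<epsilon> + \<epsilon> t\<^sup>2\<close>.\<close>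

lemma power_gaussian_bound:
  assumes "\<epsilon> > 0" shows "\<exists>B. \<forall>t\<ge>0. (1 + t) ^ k * exp (K - \<epsilon> * t\<^sup>2) \<le> (B::real)"
proof (intro exI allI impI)
  fix t :: real assume t: "t \<ge> 0"
  define y where "y = \<epsilon> * (1 + t)\<^sup>2 / 2"
  have y: "y \<ge> 0" using assms by (simp add: y_def)
  have "(1 + t) ^ k \<le> (1 + t) ^ (2 * k)" using t by (intro power_increasing) auto
  also have "\<dots> = (2 / \<epsilon>) ^ k * y ^ k" using assms by (simp add: y_def power_mult power_mult_distrib[symmetric])
  also have "\<dots> \<le> (2 / \<epsilon>) ^ k * (fact k * exp y)"
    using assms y by (intro mult_left_mono power_le_fact_exp) auto
  finally have 1: "(1 + t) ^ k \<le> (2 / \<epsilon>) ^ k * fact k * exp y" by (simp add: mult.assoc)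
  have "0 \<le> \<epsilon> * (1 - t)\<^sup>2" using assms by simp
  then have "y \<le> \<epsilon> + \<epsilon> * t\<^sup>2" by (simp add: y_def power2_eq_square algebra_simps)
  then have 2: "exp (K - \<epsilon> * t\<^sup>2) \<le> exp (K + \<epsilon> - y)" by simp
  have "(1 + t) ^ k * exp (K - \<epsilon> * t\<^sup>2) \<le> ((2 / \<epsilon>) ^ k * fact k * exp y) * exp (K + \<epsilon> - y)"
    using t assms by (intro mult_mono 1 2) auto
  also have "\<dots> = (2 / \<epsilon>) ^ k * fact k * exp (K + \<epsilon>)" by (simp add: exp_add[symmetric] mult.assoc)
  finally show "(1 + t) ^ k * exp (K - \<epsilon> * t\<^sup>2) \<le> (2 / \<epsilon>) ^ k * fact k * exp (K + \<epsilon>)" .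
qed

lemma schwartz_exp:
  assumes Q: "slow (\<lambda>n. Q)" and "\<epsilon> > 0" and R: "\<And>x. Re (Q x) \<le> K - \<epsilon> * (norm x)\<^sup>2"
  shows "(\<lambda>x. exp (Q x)) \<in> schwartz"
proof (rule schwartzI_words[OF smooth_exp[OF slow_smooth[OF Q]]])
  fix vs :: "'a list" and k assume vs: "vs \<in> lists Basis"
  obtain C l where C: "\<And>x. norm (iter_deriv vs (\<lambda>x. exp (Q x)) x) \<le> C * (1 + norm x) ^ l * exp (Re (Q x))"
    using iter_deriv_mult_exp_bound[OF Q vs slow_const[of 1]] by auto
  obtain B where B: "\<And>t. t \<ge> 0 \<Longrightarrow> (1 + t) ^ (k + l) * exp (K - \<epsilon> * t\<^sup>2) \<le> B"
    using power_gaussian_bound[OF \<open>\<epsilon> > 0\<close>] by blast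
  have "(1 + norm x) ^ k * norm (iter_deriv vs (\<lambda>x. exp (Q x)) x) \<le> \<bar>C\<bar> * B" for x
  proof -
    have "(1 + norm x) ^ k * norm (iter_deriv vs (\<lambda>x. exp (Q x)) x) \<le>
      (1 + norm x) ^ k * (\<bar>C\<bar> * (1 + norm x) ^ l * exp (K - \<epsilon> * (norm x)\<^sup>2))"
      using R[of x] by (intro mult_left_mono order_trans[OF C] mult_mono mult_right_mono) auto
    also have "\<dots> = \<bar>C\<bar> * ((1 + norm x) ^ (k + l) * exp (K - \<epsilon> * (norm x)\<^sup>2))"
      by (simp only: power_add mult_ac)
    also have "\<dots> \<le> \<bar>C\<bar> * B" by (intro mult_left_mono B) auto
    finally show ?thesis .
  qed
  then show "\<exists>C. \<forall>x. (1 + norm x) ^ k * norm (iter_deriv vs (\<lambda>x. exp (Q x)) x) \<le> C" by blast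
qed

lemma slow_of_real: "slow (\<lambda>n. complex_of_real)"
  by (rule slow_bounded_linear[OF bounded_linear_of_real])

lemma schwartz_gaussian_exp:
  assumes "\<alpha> > 0"
  shows "(\<lambda>t::real. exp (- complex_of_real \<alpha> * of_real t ^ 2 + \<beta> * of_real t)) \<in> schwartz"
proof (rule schwartz_exp)
  show "slow (\<lambda>n t. - complex_of_real \<alpha> * of_real t ^ 2 + \<beta> * of_real t)"
    by (intro slow_add slow_mult slow_const slow_power slow_of_real)
  show "\<alpha> / 2 > 0" using assms by simp
  fix t :: real
  have "0 \<le> (\<alpha> * t - Re \<beta>)\<^sup>2 / (2 * \<alpha>)" using assms by simp
  also have "\<dots> = \<alpha> * t\<^sup>2 / 2 - Re \<beta> * t + (Re \<beta>)\<^sup>2 / (2 * \<alpha>)"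
    using assms by (simp add: power2_eq_square field_simps)
  finally show "Re (- complex_of_real \<alpha> * of_real t ^ 2 + \<beta> * of_real t) \<le> (Re \<beta>)\<^sup>2 / (2 * \<alpha>) - \<alpha> / 2 * (norm t)\<^sup>2"
    by (simp add: Re_power2)
qed

lemma integral_std_gaussian_iexp:
  "(LINT x|lborel. exp (- (complex_of_real x ^ 2) / 2 + \<i> * of_real (t * x))) = of_real (sqrt (2 * pi)) * exp (- (of_real t)\<^sup>2 / 2)"
proof -
  have "(CLINT x|std_normal_distribution. iexp (t * x)) = complex_of_real (exp (- (t^2) / 2))"
    using fun_cong[OF char_std_normal_distribution, of t] by (simp add: char_def)
  also have "(CLINT x|std_normal_distribution. iexp (t * x)) =
      (LINT x|lborel. std_normal_density x *\<^sub>R iexp (t * x))"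
    by (rule integral_density) (auto intro!: borel_measurable_continuous_onI continuous_intros)
  also have "\<dots> = (LINT x|lborel. of_real (1 / sqrt (2 * pi)) * exp (- (complex_of_real x ^ 2) / 2 + \<i> * of_real (t * x)))"
    by (intro Bochner_Integration.integral_cong refl)
       (simp add: std_normal_density_def scaleR_conv_of_real exp_of_real[symmetric] mult_exp_exp)
  also have "\<dots> = of_real (1 / sqrt (2 * pi)) * (LINT x|lborel. exp (- (complex_of_real x ^ 2) / 2 + \<i> * of_real (t * x)))"
    by (rule integral_mult_right_zero)
  finally show ?thesis by (simp add: field_simps exp_of_real[symmetric])
qed

text \<open>Completing the square with the real part of \<open>\<beta>\<close> is a real substitution; what remains is the
  characteristic function of the normal distribution.\<close>

lemma integral_gaussian_exp:
  assumes "\<alpha> > 0"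
  shows "(LINT t|lborel. exp (- complex_of_real \<alpha> * of_real t ^ 2 + \<beta> * of_real t)) =
    of_real (sqrt (pi / \<alpha>)) * exp (\<beta>\<^sup>2 / (4 * of_real \<alpha>))"
proof -
  define u v where "u = Re \<beta>" and "v = Im \<beta>"
  have beta: "\<beta> = of_real u + \<i> * of_real v" by (simp add: u_def v_def complex_eq)
  define r where "r = sqrt (2 * \<alpha>)"
  have r: "r > 0" "r\<^sup>2 = 2 * \<alpha>" using assms by (auto simp: r_def)
  have r2: "complex_of_real \<alpha> = (of_real r)\<^sup>2 / 2" using r(2) by (simp flip: of_real_power)
  let ?f = "\<lambda>t. exp (- complex_of_real \<alpha> * of_real t ^ 2 + \<beta> * of_real t)"
  let ?c = "exp (of_real u ^ 2 / (4 * of_real \<alpha>) + \<i> * of_real (u * v) / (2 * of_real \<alpha>)) :: complex"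
  have "(LINT t|lborel. ?f t) = \<bar>1 / r\<bar> *\<^sub>R (LINT x|lborel. ?f (u / (2 * \<alpha>) + 1 / r * x))"
    using r by (intro lborel_integral_real_affine) auto
  also have "(LINT x|lborel. ?f (u / (2 * \<alpha>) + 1 / r * x)) =
     (LINT x|lborel. ?c * exp (- (complex_of_real x ^ 2) / 2 + \<i> * of_real ((v / r) * x)))"
  proof (intro Bochner_Integration.integral_cong refl)
    fix x
    have "- complex_of_real \<alpha> * of_real (u / (2 * \<alpha>) + 1 / r * x) ^ 2 + \<beta> * of_real (u / (2 * \<alpha>) + 1 / r * x) =
      of_real u ^ 2 / (4 * of_real \<alpha>) + \<i> * of_real (u * v) / (2 * of_real \<alpha>) +
       (- (complex_of_real x ^ 2) / 2 + \<i> * of_real ((v / r) * x))"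
      using r(1) by (simp add: beta r2 field_simps power2_eq_square)
    then show "?f (u / (2 * \<alpha>) + 1 / r * x) = ?c * exp (- (complex_of_real x ^ 2) / 2 + \<i> * of_real ((v / r) * x))"
      by (simp only: exp_add)
  qed
  also have "\<dots> = ?c * (LINT x|lborel. exp (- (complex_of_real x ^ 2) / 2 + \<i> * of_real ((v / r) * x)))"
    by (rule integral_mult_right_zero)
  also have "\<dots> = ?c * (of_real (sqrt (2 * pi)) * exp (- (of_real (v / r))\<^sup>2 / 2))"
    by (simp only: integral_std_gaussian_iexp)
  also have "\<bar>1 / r\<bar> *\<^sub>R \<dots> = of_real (sqrt (2 * pi) / r) * (?c * exp (- (of_real (v / r))\<^sup>2 / 2))"
    using r(1) by (simp add: scaleR_conv_of_real)
  also have "sqrt (2 * pi) / r = sqrt (pi / \<alpha>)" by (simp add: r_def real_sqrt_divide[symmetric])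
  also have "?c * exp (- (of_real (v / r))\<^sup>2 / 2) = exp (\<beta>\<^sup>2 / (4 * of_real \<alpha>))"
  proof -
    have "of_real u ^ 2 / (4 * of_real \<alpha>) + \<i> * of_real (u * v) / (2 * of_real \<alpha>) + (- (of_real (v / r))\<^sup>2 / 2) =
       \<beta>\<^sup>2 / (4 * complex_of_real \<alpha>)"
      using r(1) by (simp add: beta r2 field_simps power2_eq_square)
    then show ?thesis by (simp only: exp_add[symmetric])
  qed
  finally show ?thesis .
qed

text \<open>The integrand of the outer integral is damped by \<open>exp (- \<pi> \<epsilon>\<^sup>2 \<xi>\<^sup>2)\<close>. Fubini's theorem then turns the
  integral into an average of \<open>k\<close> against a Gaussian of width \<open>\<epsilon>\<close> around \<open>-t\<close>, and both sides converge.\<close>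

lemma fourier_inversion:
  fixes k :: "real \<Rightarrow> complex"
  assumes k: "k \<in> schwartz"
  shows "fourier (fourier k) t = k (- t)"
proof -
  have Fk: "fourier k \<in> schwartz" using coperator_schwartz[OF coperator_fourier k] .
  have ki: "integrable lborel k" and Fki: "integrable lborel (fourier k)"
    using moments_integrable[OF schwartz_moments] k Fk by auto
  have kc: "continuous_on UNIV k" using smooth_continuous[OF schwartz_smooth[OF k]] .
  have km: "k \<in> borel_measurable borel" and Fkm: "fourier k \<in> borel_measurable borel"
    using smooth_measurable schwartz_smooth k Fk by blast+
  define \<epsilon> where "\<epsilon> n = inverse (real (Suc n))" for n
  have e: "\<epsilon> n > 0" for n by (simp add: \<epsilon>_def)
  have elim: "\<epsilon> \<longlonglongrightarrow> 0" using LIMSEQ_inverse_real_of_nat by (simp add: \<epsilon>_def[abs_def])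
  define G where "G n \<xi> = exp (- complex_of_real (pi * (\<epsilon> n)\<^sup>2) * of_real \<xi> ^ 2)" for n and \<xi> :: real
  have Gcont: "continuous_on UNIV (G n)" for n unfolding G_def by (intro continuous_intros)
  have Gm: "G n \<in> borel_measurable borel" for n by (rule borel_measurable_continuous_onI[OF Gcont])
  have Gnorm: "norm (G n \<xi>) \<le> 1" for n \<xi> by (simp add: G_def Re_power2)
  have Gi: "integrable lborel (G n)" for n
    using moments_integrable[OF schwartz_moments[OF schwartz_gaussian_exp[of "pi * (\<epsilon> n)\<^sup>2" 0]]] e[of n]
    by (simp add: G_def[abs_def])
  have cm: "(\<lambda>x. cis (f x)) \<in> borel_measurable M" if "f \<in> borel_measurable M" for f :: "_ \<Rightarrow> real" and M
    using measurable_compose[OF that borel_measurable_continuous_onI[OF continuous_on_cis[OF continuous_on_id]]] by simp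
  define A where "A n = (LINT \<xi>|lborel. fourier k \<xi> * cis (- 2 * pi * (t * \<xi>)) * G n \<xi>)" for n
  have lim1: "A \<longlonglongrightarrow> fourier (fourier k) t"
    unfolding A_def fourier_def[of "fourier k"] inner_real_def
  proof (rule integral_dominated_convergence[where w="\<lambda>\<xi>. norm (fourier k \<xi>)"])
    show "AE \<xi> in lborel. (\<lambda>n. fourier k \<xi> * cis (- 2 * pi * (t * \<xi>)) * G n \<xi>) \<longlonglongrightarrow> fourier k \<xi> * cis (- 2 * pi * (t * \<xi>))"
    proof (rule AE_I2)
      fix \<xi>
      have "(\<lambda>n. G n \<xi>) \<longlonglongrightarrow> exp (- complex_of_real (pi * 0\<^sup>2) * of_real \<xi> ^ 2)"
        unfolding G_def by (intro tendsto_intros elim)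
      from tendsto_mult[OF tendsto_const this, of "fourier k \<xi> * cis (- 2 * pi * (t * \<xi>))"]
      show "(\<lambda>n. fourier k \<xi> * cis (- 2 * pi * (t * \<xi>)) * G n \<xi>) \<longlonglongrightarrow> fourier k \<xi> * cis (- 2 * pi * (t * \<xi>))" by simp
    qed
    show "AE \<xi> in lborel. norm (fourier k \<xi> * cis (- 2 * pi * (t * \<xi>)) * G n \<xi>) \<le> norm (fourier k \<xi>)" for n
      using Gnorm by (intro AE_I2) (simp add: norm_mult mult_left_le)
    show "integrable lborel (\<lambda>\<xi>. norm (fourier k \<xi>))" using Fki by (rule integrable_norm)
    show "(\<lambda>\<xi>. fourier k \<xi> * cis (- 2 * pi * (t * \<xi>))) \<in> borel_measurable lborel"
      using Fkm by (intro borel_measurable_times cm) auto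
    show "(\<lambda>\<xi>. fourier k \<xi> * cis (- 2 * pi * (t * \<xi>)) * G n \<xi>) \<in> borel_measurable lborel" for n
      using Fkm Gm by (intro borel_measurable_times cm) auto
  qed
  have A_eq: "A n = (LINT y|lborel. k (- t + \<epsilon> n * y) * exp (- complex_of_real pi * of_real y ^ 2))" for n
  proof -
    let ?H = "\<lambda>\<xi> x. k x * (cis (- 2 * pi * (\<xi> * x)) * cis (- 2 * pi * (t * \<xi>)) * G n \<xi>)"
    have Hm: "(\<lambda>(\<xi>, x). ?H \<xi> x) \<in> borel_measurable (lborel \<Otimes>\<^sub>M lborel)"
      using km Gm unfolding split_beta'
      by (intro borel_measurable_times cm measurable_compose[OF measurable_snd, of k]
          measurable_compose[OF measurable_fst, of "G n"]) auto
    have Hi: "integrable (lborel \<Otimes>\<^sub>M lborel) (\<lambda>(\<xi>, x). ?H \<xi> x)"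
    proof (rule lborel_pair.Fubini_integrable[OF Hm])
      have "(LINT x|lborel. norm (?H \<xi> x)) = (LINT x|lborel. norm (k x)) * norm (G n \<xi>)" for \<xi>
        by (simp add: norm_mult)
      then show "integrable lborel (\<lambda>\<xi>. LINT x|lborel. norm (case (\<xi>, x) of (\<xi>, x) \<Rightarrow> ?H \<xi> x))"
        using Gi by simp
      show "AE \<xi> in lborel. integrable lborel (\<lambda>x. case (\<xi>, x) of (\<xi>, x) \<Rightarrow> ?H \<xi> x)"
      proof (rule AE_I2)
        fix \<xi>
        show "integrable lborel (\<lambda>x. case (\<xi>, x) of (\<xi>, x) \<Rightarrow> ?H \<xi> x)"
          using integrable_mult_left[OF integrable_mult_cis[OF ki, of \<xi>], of "cis (- 2 * pi * (t * \<xi>)) * G n \<xi>"]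
          by (simp add: mult_ac)
      qed
    qed
    have "A n = (LINT \<xi>|lborel. (LINT x|lborel. ?H \<xi> x))"
      unfolding A_def fourier_def inner_real_def
      by (subst integral_mult_left_zero[symmetric])+ (simp only: mult_ac)
    also have "\<dots> = (LINT x|lborel. (LINT \<xi>|lborel. ?H \<xi> x))"
      using lborel_pair.Fubini_integral[OF Hi] by simp
    also have "\<dots> = (LINT x|lborel. k x * (of_real (1 / \<epsilon> n) * exp (- complex_of_real pi * of_real ((x + t) / \<epsilon> n) ^ 2)))"
    proof (intro Bochner_Integration.integral_cong refl)
      fix x
      have "(LINT \<xi>|lborel. ?H \<xi> x) = k x * (LINT \<xi>|lborel. cis (- 2 * pi * (\<xi> * x)) * cis (- 2 * pi * (t * \<xi>)) * G n \<xi>)"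
        by (rule integral_mult_right_zero)
      also have "(LINT \<xi>|lborel. cis (- 2 * pi * (\<xi> * x)) * cis (- 2 * pi * (t * \<xi>)) * G n \<xi>) =
         (LINT \<xi>|lborel. exp (- complex_of_real (pi * (\<epsilon> n)\<^sup>2) * of_real \<xi> ^ 2 + (- 2 * pi * \<i> * of_real (x + t)) * of_real \<xi>))"
        by (intro Bochner_Integration.integral_cong refl)
           (simp add: G_def cis_conv_exp exp_add[symmetric] algebra_simps)
      also have "\<dots> = of_real (sqrt (pi / (pi * (\<epsilon> n)\<^sup>2))) * exp ((- 2 * pi * \<i> * of_real (x + t))\<^sup>2 / (4 * of_real (pi * (\<epsilon> n)\<^sup>2)))"
        using e[of n] by (intro integral_gaussian_exp) simp
      also have "sqrt (pi / (pi * (\<epsilon> n)\<^sup>2)) = 1 / \<epsilon> n" using e[of n] by (simp add: real_sqrt_divide)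
      also have "(- 2 * pi * \<i> * of_real (x + t))\<^sup>2 / (4 * of_real (pi * (\<epsilon> n)\<^sup>2)) = - complex_of_real pi * of_real ((x + t) / \<epsilon> n) ^ 2"
        using e[of n] by (simp add: power_mult_distrib power_divide) (simp add: power2_eq_square)
      finally show "(LINT \<xi>|lborel. ?H \<xi> x) = k x * (of_real (1 / \<epsilon> n) * exp (- complex_of_real pi * of_real ((x + t) / \<epsilon> n) ^ 2))" .
    qed
    also have "\<dots> = \<bar>\<epsilon> n\<bar> *\<^sub>R (LINT y|lborel. k (- t + \<epsilon> n * y) *
        (of_real (1 / \<epsilon> n) * exp (- complex_of_real pi * of_real ((- t + \<epsilon> n * y + t) / \<epsilon> n) ^ 2)))"
      using e[of n] by (intro lborel_integral_real_affine) simp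
    also have "\<dots> = (LINT y|lborel. \<bar>\<epsilon> n\<bar> *\<^sub>R (k (- t + \<epsilon> n * y) *
        (of_real (1 / \<epsilon> n) * exp (- complex_of_real pi * of_real ((- t + \<epsilon> n * y + t) / \<epsilon> n) ^ 2))))"
      by (rule integral_scaleR_right[symmetric])
    also have "\<dots> = (LINT y|lborel. k (- t + \<epsilon> n * y) * exp (- complex_of_real pi * of_real y ^ 2))"
      using e[of n] by (intro Bochner_Integration.integral_cong refl) (simp add: scaleR_conv_of_real)
    finally show ?thesis .
  qed
  have gi: "integrable lborel (\<lambda>y. exp (- complex_of_real pi * of_real y ^ 2))"
    using moments_integrable[OF schwartz_moments[OF schwartz_gaussian_exp[of pi 0]]] by simp
  have g1: "(LINT y|lborel. exp (- complex_of_real pi * of_real y ^ 2)) = 1"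
    using integral_gaussian_exp[of pi 0] by simp
  obtain c where "sbound 0 c k" using schwartz_sbound[OF k] by blast
  then have c: "norm (k x) \<le> c" for x using sboundD[OF _ Nil_words, of 0 c k x] by simp
  have "A \<longlonglongrightarrow> (LINT y|lborel. k (- t) * exp (- complex_of_real pi * of_real y ^ 2))"
    unfolding A_eq[abs_def]
  proof (rule integral_dominated_convergence[where w="\<lambda>y. c * norm (exp (- complex_of_real pi * of_real y ^ 2))"])
    show "AE y in lborel. (\<lambda>n. k (- t + \<epsilon> n * y) * exp (- complex_of_real pi * of_real y ^ 2)) \<longlonglongrightarrow>
        k (- t) * exp (- complex_of_real pi * of_real y ^ 2)"
    proof (rule AE_I2)
      fix y
      have "(\<lambda>n. - t + \<epsilon> n * y) \<longlonglongrightarrow> - t + 0 * y" by (intro tendsto_intros elim)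
      then have "(\<lambda>n. k (- t + \<epsilon> n * y)) \<longlonglongrightarrow> k (- t)"
        using kc by (intro isCont_tendsto_compose[of "- t" k]) (auto simp: continuous_on_eq_continuous_at)
      then show "(\<lambda>n. k (- t + \<epsilon> n * y) * exp (- complex_of_real pi * of_real y ^ 2)) \<longlonglongrightarrow>
        k (- t) * exp (- complex_of_real pi * of_real y ^ 2)" by (intro tendsto_mult tendsto_const)
    qed
    show "AE y in lborel. norm (k (- t + \<epsilon> n * y) * exp (- complex_of_real pi * of_real y ^ 2)) \<le>
       c * norm (exp (- complex_of_real pi * of_real y ^ 2))" for n
      unfolding norm_mult by (intro AE_I2 mult_right_mono c) auto
    show "integrable lborel (\<lambda>y. c * norm (exp (- complex_of_real pi * of_real y ^ 2)))"
      by (intro integrable_mult_right integrable_norm gi)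
    show "(\<lambda>y. k (- t) * exp (- complex_of_real pi * of_real y ^ 2)) \<in> borel_measurable lborel" by simp
    show "(\<lambda>y. k (- t + \<epsilon> n * y) * exp (- complex_of_real pi * of_real y ^ 2)) \<in> borel_measurable lborel" for n
      using km by simp
  qed
  also have "(LINT y|lborel. k (- t) * exp (- complex_of_real pi * of_real y ^ 2)) = k (- t)"
    using g1 by simp
  finally show ?thesis using lim1 LIMSEQ_unique by blast
qed

section \<open>Modulated Gaussians span a dense subspace\<close>

lemma gaussian_eq_exp: "gaussian x = exp (- complex_of_real pi * of_real x ^ 2)"
  by (simp add: gaussian_def exp_of_real[symmetric])

lemma gaussian_schwartz: "gaussian \<in> schwartz"
  using schwartz_gaussian_exp[of pi 0] by (simp add: gaussian_eq_exp[abs_def])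

lemma cis_eq_exp_freq: "cis (- 2 * pi * (\<xi> \<bullet> x)) = exp (freq \<xi> x)"
  by (simp add: cis_conv_exp freq_def inner_commute mult_ac)

lemma freq_commute: "freq s t = freq t s"
  by (simp add: freq_def inner_commute)

lemma norm_exp_freq [simp]: "norm (exp (freq s t)) = 1"
  by (simp flip: cis_eq_exp_freq)

lemma bounded_linear_freq: "bounded_linear (freq s)"
  unfolding freq_def
  by (intro bounded_linear_compose[OF bounded_linear_mult_right]
      bounded_linear_compose[OF bounded_linear_of_real] bounded_linear_inner_left)

lemma slow_exp_freq: "slow (\<lambda>n t. exp (freq s t))"
  by (rule slow_exp_imaginary[OF slow_freq]) (simp add: freq_def)

lemma smooth_exp_freq: "smooth (\<lambda>t. exp (freq s t))"
  by (rule slow_smooth[OF slow_exp_freq])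

lemma pd_exp_freq:
  fixes s :: "'a::euclidean_space"
  shows "pd v (\<lambda>t. exp (freq s t)) = (\<lambda>t. freq v s * exp (freq s t))"
proof -
  have p: "pd v (freq s) = (\<lambda>x. freq s v)"
    by (rule ext, rule pd_eqI, rule bounded_linear_imp_has_derivative[OF bounded_linear_freq])
  have d: "(\<lambda>t::'a. 1::complex) differentiable_on UNIV" "freq s differentiable_on UNIV"
    by (rule smooth_differentiable[OF smooth_const], rule smooth_differentiable[OF smooth_linear[OF bounded_linear_freq]])
  show ?thesis using pd_mult_exp[OF d, of v] by (simp add: p freq_commute[of v])
qed

lemma iter_deriv_exp_freq:
  "vs \<in> lists Basis \<Longrightarrow> iter_deriv vs (\<lambda>t. exp (freq s t)) = (\<lambda>t. freqs vs s * exp (freq s t))"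
proof (induction vs)
  case (Cons v vs)
  have "pd v (\<lambda>t. freqs vs s * exp (freq s t)) = (\<lambda>t. freqs vs s * pd v (\<lambda>t. exp (freq s t)) t)"
    by (rule pd_bounded_linear[OF smooth_differentiable[OF smooth_exp_freq] bounded_linear_mult_right])
  then show ?case using Cons by (simp add: iter_deriv_Cons pd_exp_freq freqs_def mult_ac)
qed (simp add: freqs_def)

lemma iter_deriv_sum:
  assumes "\<And>i. i \<in> I \<Longrightarrow> smooth (f i)" "vs \<in> lists Basis"
  shows "iter_deriv vs (\<lambda>x. \<Sum>i\<in>I. f i x) = (\<lambda>x. \<Sum>i\<in>I. iter_deriv vs (f i) x)"
  using assms(1)
  by (induction I rule: infinite_finite_induct)
     (simp_all add: iter_deriv_zero[OF assms(2)] iter_deriv_add[OF _ smooth_sum assms(2)])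

lemma norm_cis_diff_le: "norm (cis a - cis b) \<le> \<bar>a - b\<bar>"
proof -
  have "norm (cis (a - b) - 1) \<le> \<bar>a - b\<bar>"
    using iexp_approx1[of "a - b" 0] by (simp add: cis_conv_exp)
  moreover have "cis a - cis b = cis b * (cis (a - b) - 1)" by (simp add: right_diff_distrib cis_mult)
  ultimately show ?thesis by (simp add: norm_mult)
qed

text \<open>Lipschitz dependence on the frequency of all derivatives in \<open>t\<close> of \<open>exp (freq \<xi> t)\<close>. On a bounded
  set of frequencies the constant grows only linearly in \<open>t\<close>, whatever the number of derivatives.\<close>

lemma freqs_exp_Lipschitz:
  fixes vs :: "'a::euclidean_space list"
  shows "\<exists>L\<ge>0. \<forall>t \<xi> r. norm \<xi> \<le> A \<longrightarrow> norm r \<le> A \<longrightarrow> norm (freqs vs \<xi>) \<le> L \<and>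
    norm (freqs vs \<xi> * exp (freq t \<xi>) - freqs vs r * exp (freq t r)) \<le> L * (1 + norm t) * norm (\<xi> - r)"
proof (induction vs)
  case Nil
  have "norm (exp (freq t \<xi>) - exp (freq t r)) \<le> (2 * pi) * (1 + norm t) * norm (\<xi> - r)" for t \<xi> r :: 'a
  proof -
    have "norm (exp (freq t \<xi>) - exp (freq t r)) \<le> \<bar>- 2 * pi * (t \<bullet> \<xi>) - - 2 * pi * (t \<bullet> r)\<bar>"
      unfolding cis_eq_exp_freq[symmetric] by (rule norm_cis_diff_le)
    also have "- 2 * pi * (t \<bullet> \<xi>) - - 2 * pi * (t \<bullet> r) = - (2 * pi * (t \<bullet> (\<xi> - r)))"
      by (simp add: inner_diff_right algebra_simps)
    also have "\<bar>\<dots>\<bar> = 2 * pi * \<bar>t \<bullet> (\<xi> - r)\<bar>" by (simp add: abs_mult)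
    also have "\<dots> \<le> 2 * pi * (norm t * norm (\<xi> - r))" by (intro mult_left_mono Cauchy_Schwarz_ineq2) auto
    also have "\<dots> \<le> (2 * pi) * (1 + norm t) * norm (\<xi> - r)" by (simp add: algebra_simps)
    finally show ?thesis .
  qed
  moreover have "1 \<le> 2 * pi" using pi_ge_two by linarith
  ultimately show ?case by (intro exI[of _ "2 * pi"]) (simp add: freqs_def)
next
  case (Cons v vs)
  let ?X = "\<lambda>t \<xi>. freqs vs \<xi> * exp (freq t \<xi>)"
  obtain L where L: "L \<ge> 0" "\<And>\<xi>. norm \<xi> \<le> A \<Longrightarrow> norm (freqs vs \<xi>) \<le> L"
    "\<And>t \<xi> r. norm \<xi> \<le> A \<Longrightarrow> norm r \<le> A \<Longrightarrow> norm (?X t \<xi> - ?X t r) \<le> L * (1 + norm t) * norm (\<xi> - r)"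
    using Cons by blast
  define B where "B = 2 * pi * norm v"
  have B: "B \<ge> 0" by (simp add: B_def)
  have fr: "norm (freq v \<xi>) \<le> B * norm \<xi>" for \<xi>
  proof -
    have "norm (freq v \<xi>) = 2 * pi * \<bar>\<xi> \<bullet> v\<bar>" by (simp add: freq_def norm_mult)
    also have "\<dots> \<le> 2 * pi * (norm \<xi> * norm v)" by (intro mult_left_mono Cauchy_Schwarz_ineq2) auto
    finally show ?thesis by (simp add: B_def mult_ac)
  qed
  have frA: "norm (freq v \<xi>) \<le> B * \<bar>A\<bar>" if "norm \<xi> \<le> A" for \<xi>
    using that B by (intro order_trans[OF fr] mult_left_mono) auto
  show ?case
  proof (intro exI[of _ "(B * \<bar>A\<bar>) * L + B * L"] conjI allI impI)
    fix t \<xi> r :: 'a assume a: "norm \<xi> \<le> A" "norm r \<le> A"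
    have "norm (freqs (v # vs) \<xi>) \<le> (B * \<bar>A\<bar>) * L"
      using frA[OF a(1)] L(2)[OF a(1)] B by (simp add: freqs_def norm_mult) (intro mult_mono, auto)
    then show "norm (freqs (v # vs) \<xi>) \<le> (B * \<bar>A\<bar>) * L + B * L" using B L(1) by (simp add: add_increasing2)
    have "freqs (v # vs) \<xi> * exp (freq t \<xi>) - freqs (v # vs) r * exp (freq t r) =
      freq v \<xi> * (?X t \<xi> - ?X t r) + (freq v \<xi> - freq v r) * ?X t r"
      by (simp add: freqs_def algebra_simps)
    also have "freq v \<xi> - freq v r = freq v (\<xi> - r)" by (simp add: freq_def inner_diff_left algebra_simps)
    finally have eq: "freqs (v # vs) \<xi> * exp (freq t \<xi>) - freqs (v # vs) r * exp (freq t r) =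
      freq v \<xi> * (?X t \<xi> - ?X t r) + freq v (\<xi> - r) * ?X t r" .
    have 1: "norm (freq v \<xi> * (?X t \<xi> - ?X t r)) \<le> (B * \<bar>A\<bar>) * (L * (1 + norm t) * norm (\<xi> - r))"
      unfolding norm_mult[of "freq v \<xi>"] using B by (intro mult_mono frA L(3) a) auto
    have "norm (freq v (\<xi> - r) * ?X t r) \<le> (B * norm (\<xi> - r)) * (L * 1)"
      unfolding norm_mult norm_exp_freq using B L(1) by (intro mult_mono fr L(2) a) auto
    also have "\<dots> \<le> (B * norm (\<xi> - r)) * (L * (1 + norm t))" using B L(1) by (intro mult_left_mono) auto
    finally have 2: "norm (freq v (\<xi> - r) * ?X t r) \<le> (B * norm (\<xi> - r)) * (L * (1 + norm t))" .
    show "norm (freqs (v # vs) \<xi> * exp (freq t \<xi>) - freqs (v # vs) r * exp (freq t r)) \<le>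
       ((B * \<bar>A\<bar>) * L + B * L) * (1 + norm t) * norm (\<xi> - r)"
      unfolding eq using norm_triangle_mono[OF 1 2] by (simp add: algebra_simps)
  qed (use B L(1) in auto)
qed

text \<open>The integral defining the Fourier transform of \<open>\<kappa>\<close> is replaced by the sum in which frequencies
  are rounded down to multiples of \<open>1/N\<close>. The functional annihilates the sum times the Gaussian. By
  the Lipschitz estimate, \<open>N\<close> times the error is slowly increasing uniformly in \<open>N\<close>, so the value of the
  functional is \<open>O(1/N)\<close>.\<close>

lemma cfunctional_zero_on_gaussian_fourier:
  assumes u: "cfunctional (u :: real distr)"
    and z: "\<And>s. u (\<lambda>t. gaussian t * exp (freq s t)) = 0"
    and \<kappa>: "\<kappa> \<in> test"
  shows "u (\<lambda>t. gaussian t * fourier \<kappa> t) = 0"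
proof -
  obtain R where R: "\<And>x. norm x > R \<Longrightarrow> \<kappa> x = 0" using \<kappa> unfolding test_def by blast
  \<comment> \<open>Rounding a frequency moves it by at most \<open>1\<close>, so the rounded ones stay below \<open>A\<close> as well.\<close>
  define A where "A = \<bar>R\<bar> + 1"
  have \<kappa>S: "\<kappa> \<in> schwartz" by (rule test_schwartz[OF \<kappa>])
  have \<kappa>m: "moments \<kappa>" by (rule schwartz_moments[OF \<kappa>S])
  have \<kappa>i: "integrable lborel \<kappa>" by (rule moments_integrable[OF \<kappa>m])
  define N where "N m = real (Suc m)" for m
  have N: "N m \<ge> 1" for m by (simp add: N_def)
  define J where "J m = {\<lfloor>- (N m * A)\<rfloor> .. \<lfloor>N m * A\<rfloor>}" for m
  define \<rho> where "\<rho> m \<xi> = of_int \<lfloor>N m * \<xi>\<rfloor> / N m" for m and \<xi> :: real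
  define E where "E m j = {\<xi>. \<lfloor>N m * \<xi>\<rfloor> = j}" for m j
  define c where "c m j = (LINT \<xi>|lborel. indicator (E m j) \<xi> *\<^sub>R \<kappa> \<xi>)" for m j
  have Es: "E m j \<in> sets borel" for m j
  proof -
    have "E m j = (\<lambda>\<xi>. \<lfloor>N m * \<xi>\<rfloor>) -` {j} \<inter> space borel" by (auto simp: E_def)
    also have "\<dots> \<in> sets borel" by (rule measurable_sets[of _ _ "count_space UNIV"]) auto
    finally show ?thesis .
  qed
  have Ei: "integrable lborel (\<lambda>\<xi>. indicator (E m j) \<xi> *\<^sub>R \<kappa> \<xi>)" for m j
    using Es \<kappa>i by (intro integrable_mult_indicator) auto
  have \<rho>: "\<bar>\<xi> - \<rho> m \<xi>\<bar> \<le> 1 / N m" for m \<xi>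
  proof -
    have "of_int \<lfloor>N m * \<xi>\<rfloor> \<le> N m * \<xi>" "N m * \<xi> \<le> of_int \<lfloor>N m * \<xi>\<rfloor> + 1" by linarith+
    then have "\<bar>N m * \<xi> - of_int \<lfloor>N m * \<xi>\<rfloor>\<bar> \<le> 1" by linarith
    moreover have "\<xi> - \<rho> m \<xi> = (N m * \<xi> - of_int \<lfloor>N m * \<xi>\<rfloor>) / N m" using N[of m] by (simp add: \<rho>_def field_simps)
    ultimately show ?thesis using N[of m] by (simp add: divide_right_mono)
  qed
  have \<rho>A: "norm (\<rho> m \<xi>) \<le> A" "norm \<xi> \<le> A" if "\<kappa> \<xi> \<noteq> 0" for m \<xi>
  proof -
    have "\<bar>\<xi>\<bar> \<le> \<bar>R\<bar>" using R[of \<xi>] that by force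
    moreover have "1 / N m \<le> 1" using N[of m] by simp
    ultimately show "norm (\<rho> m \<xi>) \<le> A" "norm \<xi> \<le> A"
      using \<rho>[of \<xi> m] by (auto simp: A_def abs_if split: if_splits)
  qed
  have inJ: "\<lfloor>N m * \<xi>\<rfloor> \<in> J m" if "\<kappa> \<xi> \<noteq> 0" for m \<xi>
  proof -
    have "\<bar>\<xi>\<bar> \<le> A" using \<rho>A(2)[OF that] by simp
    then have "\<bar>N m * \<xi>\<bar> \<le> N m * A" using N[of m] by (simp add: abs_mult)
    then have "- (N m * A) \<le> N m * \<xi>" "N m * \<xi> \<le> N m * A" by linarith+
    then show ?thesis by (auto simp: J_def intro: floor_mono)
  qed
  \<comment> \<open>Rounding the frequency turns the Fourier integral into a finite sum.\<close>
  have step: "\<kappa> \<xi> * h (\<rho> m \<xi>) = (\<Sum>j\<in>J m. h (of_int j / N m) * (indicator (E m j) \<xi> *\<^sub>R \<kappa> \<xi>))" for h m \<xi>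
  proof (cases "\<kappa> \<xi> = 0")
    case False
    have "(\<Sum>j\<in>J m. h (of_int j / N m) * (indicator (E m j) \<xi> *\<^sub>R \<kappa> \<xi>)) =
       (\<Sum>j\<in>J m. if j = \<lfloor>N m * \<xi>\<rfloor> then h (of_int j / N m) * \<kappa> \<xi> else 0)"
      by (intro sum.cong refl) (auto simp: E_def indicator_def)
    also have "\<dots> = h (\<rho> m \<xi>) * \<kappa> \<xi>" using inJ[OF False] by (simp add: \<rho>_def J_def)
    finally show ?thesis by (simp add: mult.commute)
  qed simp
  have sum_int: "(LINT \<xi>|lborel. \<kappa> \<xi> * h (\<rho> m \<xi>)) = (\<Sum>j\<in>J m. h (of_int j / N m) * c m j)"
    "integrable lborel (\<lambda>\<xi>. \<kappa> \<xi> * h (\<rho> m \<xi>))" for h m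
    unfolding step c_def
    by (simp only: Bochner_Integration.integral_sum[OF integrable_mult_right[OF Ei]] integral_mult_right_zero)
       (intro Bochner_Integration.integrable_sum integrable_mult_right Ei)
  define T where "T m t = (\<Sum>j\<in>J m. c m j * exp (freq (of_int j / N m) t))" for m and t :: real
  have uT: "u (\<lambda>t. gaussian t * T m t) = 0" and TS: "(\<lambda>t. gaussian t * T m t) \<in> schwartz" for m
  proof -
    have eS: "(\<lambda>t. gaussian t * exp (freq s t)) \<in> schwartz" for s
      using schwartz_mult_slow[OF slow_exp_freq gaussian_schwartz] by (simp add: mult.commute)
    have eq: "(\<lambda>t. gaussian t * T m t) = (\<lambda>t. \<Sum>j\<in>J m. c m j * (gaussian t * exp (freq (of_int j / N m) t)))"
      by (simp add: T_def sum_distrib_left mult_ac)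
    have fin: "finite (J m)" by (simp add: J_def)
    show "(\<lambda>t. gaussian t * T m t) \<in> schwartz"
      unfolding eq by (rule cfunctional_sum(2)[OF u _ fin]) (intro schwartz_cmult eS)
    have "u (\<lambda>t. gaussian t * T m t) = (\<Sum>j\<in>J m. u (\<lambda>t. c m j * (gaussian t * exp (freq (of_int j / N m) t))))"
      unfolding eq by (rule cfunctional_sum(1)[OF u _ fin]) (intro schwartz_cmult eS)
    also have "\<dots> = 0" by (intro sum.neutral ballI) (simp add: cfunctional_cmult[OF u eS] z)
    finally show "u (\<lambda>t. gaussian t * T m t) = 0" .
  qed
  have Tsm: "smooth (T m)" for m
    unfolding T_def by (intro smooth_sum smooth_mult smooth_const smooth_exp_freq)
  have Fsm: "smooth (fourier \<kappa>)" by (rule smooth_fourier[OF \<kappa>m])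
  \<comment> \<open>The error of rounding, magnified by the number of steps per unit.\<close>
  define g where "g m t = of_real (N m) * (fourier \<kappa> t - T m t)" for m t
  have g: "slow g"
  proof (rule slowI)
    show "smooth (g m)" for m unfolding g_def by (intro smooth_mult smooth_const smooth_diff Fsm Tsm)
    fix vs :: "real list" assume vs: "vs \<in> lists Basis"
    obtain L where L: "L \<ge> 0" "\<And>t \<xi> r. norm \<xi> \<le> A \<Longrightarrow> norm r \<le> A \<Longrightarrow>
      norm (freqs vs \<xi> * exp (freq t \<xi>) - freqs vs r * exp (freq t r)) \<le> L * (1 + norm t) * norm (\<xi> - r)"
      using freqs_exp_Lipschitz[of A vs] by blast
    define B where "B = (LINT \<xi>|lborel. norm (\<kappa> \<xi>)) * L"
    have "norm (iter_deriv vs (g m) t) \<le> B * (1 + norm t) ^ 1" for m t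
    proof -
      let ?X = "\<lambda>\<xi>. freqs vs \<xi> * exp (freq t \<xi>)"
      have dF: "iter_deriv vs (fourier \<kappa>) t = (LINT \<xi>|lborel. \<kappa> \<xi> * ?X \<xi>)"
        unfolding iter_deriv_fourier[OF \<kappa>m] unfolding fourier_def cis_eq_exp_freq by (simp add: mult_ac)
      have Fi: "integrable lborel (\<lambda>\<xi>. \<kappa> \<xi> * ?X \<xi>)"
        using integrable_mult_cis[OF moments_integrable[OF moments_freqs[OF \<kappa>m]], of vs t]
        unfolding cis_eq_exp_freq by (simp add: mult_ac)
      have dT: "iter_deriv vs (T m) t = (LINT \<xi>|lborel. \<kappa> \<xi> * ?X (\<rho> m \<xi>))"
      proof -
        have sm: "smooth (\<lambda>t. c m j * exp (freq (of_int j / N m) t))" for j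
          by (intro smooth_mult smooth_const smooth_exp_freq)
        have "iter_deriv vs (T m) t = (\<Sum>j\<in>J m. iter_deriv vs (\<lambda>t. c m j * exp (freq (of_int j / N m) t)) t)"
          unfolding T_def by (subst iter_deriv_sum[OF sm vs]) simp
        also have "\<dots> = (\<Sum>j\<in>J m. ?X (of_int j / N m) * c m j)"
          by (intro sum.cong refl)
             (simp add: iter_deriv_cmult[OF smooth_exp_freq vs] iter_deriv_exp_freq[OF vs] freq_commute[of t] mult_ac)
        also have "\<dots> = (LINT \<xi>|lborel. \<kappa> \<xi> * ?X (\<rho> m \<xi>))" by (rule sum_int(1)[symmetric])
        finally show ?thesis .
      qed
      have "iter_deriv vs (g m) t = of_real (N m) * (iter_deriv vs (fourier \<kappa>) t - iter_deriv vs (T m) t)"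
        unfolding g_def using iter_deriv_cmult[OF smooth_diff[OF Fsm Tsm] vs] iter_deriv_diff[OF Fsm Tsm vs] by simp
      also have "\<dots> = of_real (N m) * (LINT \<xi>|lborel. \<kappa> \<xi> * ?X \<xi> - \<kappa> \<xi> * ?X (\<rho> m \<xi>))"
        unfolding dF dT using Bochner_Integration.integral_diff[OF Fi sum_int(2)[of ?X m]] by simp
      finally have "norm (iter_deriv vs (g m) t) = N m * norm (LINT \<xi>|lborel. \<kappa> \<xi> * ?X \<xi> - \<kappa> \<xi> * ?X (\<rho> m \<xi>))"
        using N[of m] by (simp add: norm_mult)
      also have "norm (LINT \<xi>|lborel. \<kappa> \<xi> * ?X \<xi> - \<kappa> \<xi> * ?X (\<rho> m \<xi>)) \<le>
          (LINT \<xi>|lborel. norm (\<kappa> \<xi> * ?X \<xi> - \<kappa> \<xi> * ?X (\<rho> m \<xi>)))" by (rule integral_norm_bound)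
      also have "\<dots> \<le> (LINT \<xi>|lborel. norm (\<kappa> \<xi>) * (L * (1 + norm t) * (1 / N m)))"
      proof (intro integral_mono integrable_norm integrable_mult_left \<kappa>i Bochner_Integration.integrable_diff Fi sum_int(2)[of ?X m])
        fix \<xi>
        show "norm (\<kappa> \<xi> * ?X \<xi> - \<kappa> \<xi> * ?X (\<rho> m \<xi>)) \<le> norm (\<kappa> \<xi>) * (L * (1 + norm t) * (1 / N m))"
        proof (cases "\<kappa> \<xi> = 0")
          case False
          have "norm (?X \<xi> - ?X (\<rho> m \<xi>)) \<le> L * (1 + norm t) * norm (\<xi> - \<rho> m \<xi>)"
            by (rule L(2)) (rule \<rho>A[OF False])+
          also have "\<dots> \<le> L * (1 + norm t) * (1 / N m)" using L(1) \<rho> by (intro mult_left_mono) auto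
          finally show ?thesis unfolding right_diff_distrib[symmetric] norm_mult[of "\<kappa> \<xi>"] by (intro mult_left_mono) auto
        qed simp
      qed
      also have "\<dots> = (LINT \<xi>|lborel. norm (\<kappa> \<xi>)) * (L * (1 + norm t) * (1 / N m))"
        by (rule integral_mult_left_zero)
      also have "N m * \<dots> = B * (1 + norm t) ^ 1" using N[of m] by (simp add: B_def)
      finally show ?thesis using N[of m] by simp
    qed
    then show "\<exists>C k. \<forall>m t. norm (iter_deriv vs (g m) t) \<le> C * (1 + norm t) ^ k" by blast
  qed
  have FS: "(\<lambda>t. gaussian t * fourier \<kappa> t) \<in> schwartz"
    using schwartz_mult_slow[OF schwartz_imp_slow[OF coperator_schwartz[OF coperator_fourier \<kappa>S]] gaussian_schwartz]
    by (simp add: mult.commute)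
  have ug: "u (\<lambda>t. g m t * gaussian t) = of_real (N m) * u (\<lambda>t. gaussian t * fourier \<kappa> t)" for m
  proof -
    have "(\<lambda>t. g m t * gaussian t) = (\<lambda>t. of_real (N m) * (gaussian t * fourier \<kappa> t - gaussian t * T m t))"
      by (simp add: g_def algebra_simps)
    then show ?thesis
      using cfunctional_cmult[OF u schwartz_diff[OF FS TS]] cfunctional_diff[OF u FS TS] uT by simp
  qed
  obtain K C where C: "C \<ge> 0" "\<And>f c. f \<in> schwartz \<Longrightarrow> sbound K c f \<Longrightarrow> norm (u f) \<le> C * c"
    using cfunctional_bound[OF u] by blast
  obtain D M where D: "\<And>n f c. smooth f \<Longrightarrow> sbound M c f \<Longrightarrow> sbound K (D * c) (\<lambda>x. g n x * f x)"
    using sbound_mult_slow[OF g, of K] by blast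
  obtain d where d: "sbound M d gaussian" using schwartz_sbound[OF gaussian_schwartz] by blast
  have bound: "N m * norm (u (\<lambda>t. gaussian t * fourier \<kappa> t)) \<le> C * (D * d)" for m
    using C(2)[OF schwartz_mult_slow[OF g gaussian_schwartz] D[OF schwartz_smooth[OF gaussian_schwartz] d], of m] N[of m]
    unfolding ug by (simp add: norm_mult)
  show ?thesis
  proof (rule ccontr)
    assume "u (\<lambda>t. gaussian t * fourier \<kappa> t) \<noteq> 0"
    then have "norm (u (\<lambda>t. gaussian t * fourier \<kappa> t)) > 0" by simp
    from reals_Archimedean3[OF this] obtain m :: nat
      where "C * (D * d) < real m * norm (u (\<lambda>t. gaussian t * fourier \<kappa> t))" by blast
    also have "\<dots> \<le> N m * norm (u (\<lambda>t. gaussian t * fourier \<kappa> t))" by (intro mult_right_mono) (auto simp: N_def)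
    finally show False using bound[of m] by simp
  qed
qed

lemma cfunctional_zero_if_zero_on_test:
  assumes u: "cfunctional u" and z: "\<And>f. f \<in> test \<Longrightarrow> u f = 0" and f: "f \<in> schwartz"
  shows "u f = 0"
proof -
  obtain \<eta> :: "nat \<Rightarrow> 'a \<Rightarrow> complex" where \<eta>: "slow \<eta>" "\<And>n. \<eta> n \<in> test"
    "\<And>n x. norm x \<le> real n + 1 \<Longrightarrow> \<eta> n x = 1" using cutoff_family by blast
  show ?thesis
  proof (rule cfunctional_cutoff_limit[OF u f \<eta>(1,3)])
    show "u (\<lambda>x. \<eta> n x * f x) = 0" for n
      using z[OF test_mult[OF schwartz_smooth[OF f] \<eta>(2)[of n]]] by (simp add: mult.commute)
  qed
qed

text \<open>A test function divided by the Gaussian is again a test function, hence by inversion the Fourier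
  transform of some Schwartz function. So every test function is the Gaussian times a Fourier
  transform.\<close>

theorem cfunctional_zero_of_modulated_gaussians:
  assumes u: "cfunctional (u :: real distr)"
    and z: "\<And>s. u (\<lambda>t. gaussian t * exp (freq s t)) = 0"
    and f: "f \<in> schwartz"
  shows "u f = 0"
proof (rule cfunctional_zero_if_zero_on_test[OF u _ f])
  have "coperator (\<lambda>f t. gaussian t * f t)"
    using coperator_mult[OF schwartz_imp_slow[OF gaussian_schwartz]] .
  from cfunctional_comp[OF u coperator_comp[OF coperator_fourier this]]
  have w: "cfunctional (\<lambda>\<kappa>. u (\<lambda>t. gaussian t * fourier \<kappa> t))" .
  have w0: "u (\<lambda>t. gaussian t * fourier \<kappa> t) = 0" if "\<kappa> \<in> schwartz" for \<kappa>
    by (rule cfunctional_zero_if_zero_on_test[OF w _ that]) (rule cfunctional_zero_on_gaussian_fourier[OF u z])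
  fix h :: "real \<Rightarrow> complex" assume h: "h \<in> test"
  define k where "k t = exp (of_real pi * of_real t ^ 2) * h (- t)" for t
  have "(\<lambda>t. h (- t)) \<in> test"
  proof -
    obtain R where R: "\<And>x. norm x > R \<Longrightarrow> h x = 0" using h unfolding test_def by blast
    have sh: "smooth h" using h by (simp add: test_def)
    have "smooth (\<lambda>t::real. complex_of_real (- t))"
      by (intro smooth_linear bounded_linear_compose[OF bounded_linear_of_real bounded_linear_minus[OF bounded_linear_ident]])
    from smooth_comp[OF sh this] have "smooth (\<lambda>t. h (- t))" .
    then show ?thesis using R unfolding test_def by (intro CollectI conjI exI[of _ R]) auto
  qed
  moreover have "smooth (\<lambda>t::real. exp (of_real pi * of_real t ^ 2) :: complex)"
  proof (rule smooth_exp)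
    have "slow (\<lambda>n (t::real). complex_of_real pi * of_real t ^ 2)"
      by (intro slow_mult slow_const slow_power slow_of_real)
    from slow_smooth[OF this] show "smooth (\<lambda>t::real. complex_of_real pi * of_real t ^ 2)" .
  qed
  ultimately have k: "k \<in> schwartz" unfolding k_def[abs_def] by (intro test_schwartz test_mult)
  have "gaussian t * fourier (fourier k) t = h t" for t
    unfolding fourier_inversion[OF k] by (simp add: k_def gaussian_eq_exp mult.assoc[symmetric] exp_add[symmetric])
  then show "u h = 0" using w0[OF coperator_schwartz[OF coperator_fourier k]] by simp
qed

section \<open>Entire functions of exponential type with too many zeros\<close>

lemma entire_divide_zeros:
  assumes "finite Z" "h holomorphic_on UNIV" "\<And>p. p \<in> Z \<Longrightarrow> h p = 0"
  shows "\<exists>q. q holomorphic_on UNIV \<and> (\<forall>z. h z = (\<Prod>p\<in>Z. z - p) * q z)"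
  using assms
proof (induction Z)
  case (insert p Z)
  then obtain q where q: "q holomorphic_on UNIV" "\<And>z. h z = (\<Prod>p\<in>Z. z - p) * q z" by auto
  have "(\<Prod>r\<in>Z. p - r) \<noteq> 0" using insert.hyps by auto
  then have qp: "q p = 0" using q(2)[of p] insert.prems(2)[of p] by simp
  let ?q = "\<lambda>z. if z = p then deriv q p else (q z - q p) / (z - p)"
  have "?q holomorphic_on UNIV" using q(1) by (intro pole_lemma) auto
  moreover have "h z = (\<Prod>r\<in>insert p Z. z - r) * ?q z" for z
    using q(2)[of z] insert.hyps qp by auto
  ultimately show ?case by blast
qed auto

text \<open>Dividing out the zeros and applying the maximum principle on the circle of radius \<open>5 r\<close>, each zero
  contributes a factor of at most \<open>2 r\<close> at \<open>w\<close> and at least \<open>4 r\<close> on the circle.\<close>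

lemma entire_many_zeros_bound:
  assumes h: "h holomorphic_on UNIV" and Z: "finite Z" "\<And>p. p \<in> Z \<Longrightarrow> h p = 0 \<and> norm p \<le> r"
    and r: "r > 0" and w: "norm w \<le> r" and B: "\<And>z. norm z = 5 * r \<Longrightarrow> norm (h z) \<le> B"
  shows "norm (h w) \<le> B * (1 / 2) ^ card Z"
proof -
  obtain q where q: "q holomorphic_on UNIV" "\<And>z. h z = (\<Prod>p\<in>Z. z - p) * q z"
    using entire_divide_zeros[OF Z(1) h] Z(2) by blast
  let ?n = "card Z" and ?S = "ball (0::complex) (5 * r)"
  have "norm (q w) \<le> B / (4 * r) ^ ?n"
  proof (rule maximum_modulus_frontier[where S="?S" and f=q and \<xi>=w])
    show "q holomorphic_on interior (?S)" using q(1) holomorphic_on_subset by blast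
    show "continuous_on (closure (?S)) q"
      using holomorphic_on_imp_continuous_on[OF q(1)] continuous_on_subset by blast
    show "w \<in> ?S" using w r by simp
    fix z assume "z \<in> frontier (?S)"
    then have z: "norm z = 5 * r" using r by simp
    have "(\<Prod>p\<in>Z. 4 * r) \<le> (\<Prod>p\<in>Z. norm (z - p))"
    proof (rule prod_mono, rule conjI)
      fix p assume "p \<in> Z"
      then have "norm p \<le> r" using Z(2) by blast
      then show "4 * r \<le> norm (z - p)" using norm_triangle_ineq2[of z p] z by linarith
    qed (use r in simp)
    then have "(4 * r) ^ ?n * norm (q z) \<le> norm (\<Prod>p\<in>Z. z - p) * norm (q z)"
      by (intro mult_right_mono) (auto simp: prod_norm)
    also have "\<dots> \<le> B" using B[OF z] q(2)[of z] by (simp add: norm_mult)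
    finally show "norm (q z) \<le> B / (4 * r) ^ ?n" using r by (simp add: field_simps)
  qed auto
  moreover have "norm (\<Prod>p\<in>Z. w - p) \<le> (2 * r) ^ ?n"
  proof -
    have "(\<Prod>p\<in>Z. norm (w - p)) \<le> (\<Prod>p\<in>Z. 2 * r)"
    proof (rule prod_mono, rule conjI)
      fix p assume "p \<in> Z"
      then have "norm p \<le> r" using Z(2) by blast
      then show "norm (w - p) \<le> 2 * r" using norm_triangle_ineq4[of w p] w by linarith
    qed simp
    then show ?thesis by (simp add: prod_norm)
  qed
  ultimately have "norm (h w) \<le> (2 * r) ^ ?n * (B / (4 * r) ^ ?n)"
    unfolding q(2)[of w] norm_mult using r by (intro mult_mono) auto
  also have "\<dots> = B * ((2 * r) / (4 * r)) ^ ?n"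
    unfolding power_divide by (simp only: times_divide_eq_right mult.commute)
  also have "(2 * r) / (4 * r) = 1 / 2" using r by simp
  finally show ?thesis .
qed

text \<open>With the \<open>n\<^sup>2\<close> lattice points of an \<open>n\<close> by \<open>n\<close> square, the gain \<open>2 ^ (- n\<^sup>2)\<close> from the zeros beats the
  growth \<open>exp (c n)\<close> of the function.\<close>

theorem exponential_type_zero_on_lattice:
  assumes h: "h holomorphic_on UNIV" and g: "\<And>z. norm (h z) \<le> C * exp (K * norm z)"
    and a: "a > 0" and b: "b > 0"
    and zero: "\<And>k l :: int. h (of_real (a * of_int k) + \<i> * of_real (b * of_int l)) = 0"
  shows "h w = 0"
proof -
  define Z where "Z n = (\<lambda>(k, l). of_real (a * of_int k) + \<i> * of_real (b * of_int l) :: complex) ` ({0..<int n} \<times> {0..<int n})" for n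
  define c where "c = 5 * \<bar>K\<bar> * (a + b)"
  have "norm (h 0) \<le> C" using g[of 0] by simp
  from order_trans[OF norm_ge_zero this] have C0: "C \<ge> 0" .
  have "card (Z n) = n * n" for n
  proof -
    have "inj_on (\<lambda>(k, l). of_real (a * of_int k) + \<i> * of_real (b * of_int l) :: complex) ({0..<int n} \<times> {0..<int n})"
      using a b by (auto simp: inj_on_def complex_eq_iff)
    then show ?thesis unfolding Z_def by (subst card_image) auto
  qed
  have bound: "norm (h w) \<le> C * (exp c * (1 / 2) ^ n) ^ n" if n: "n > 0" "norm w \<le> (a + b) * real n" for n
  proof -
    let ?r = "(a + b) * real n"
    have "norm (h w) \<le> (C * exp (\<bar>K\<bar> * (5 * ?r))) * (1 / 2) ^ card (Z n)"
    proof (rule entire_many_zeros_bound[OF h _ _ _ n(2)])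
      show "finite (Z n)" by (simp add: Z_def)
      show "0 < ?r" using a b n(1) by simp
      show "norm (h z) \<le> C * exp (\<bar>K\<bar> * (5 * ?r))" if "norm z = 5 * ?r" for z
      proof -
        have "K * norm z \<le> \<bar>K\<bar> * (5 * ?r)" unfolding that[symmetric] by (intro mult_right_mono) auto
        then show ?thesis using C0 by (intro order_trans[OF g] mult_left_mono) auto
      qed
      fix p assume "p \<in> Z n"
      then obtain k l where p: "p = of_real (a * of_int k) + \<i> * of_real (b * of_int l)"
        "0 \<le> k" "k < int n" "0 \<le> l" "l < int n" by (auto simp: Z_def)
      have "norm p \<le> a * of_int k + b * of_int l"
        unfolding p(1) using norm_triangle_ineq[of "of_real (a * of_int k)" "\<i> * of_real (b * of_int l)"] p a b
        by (simp add: norm_mult)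
      also have "\<dots> \<le> a * real n + b * real n" using p a b by (intro add_mono mult_left_mono) auto
      finally show "h p = 0 \<and> norm p \<le> ?r" using zero p(1) by (simp add: algebra_simps)
    qed
    also have "\<dots> = C * (exp c * (1 / 2) ^ n) ^ n"
      unfolding \<open>card (Z n) = n * n\<close> by (simp add: c_def power_mult_distrib exp_of_nat_mult[symmetric] power_mult mult_ac)
    finally show ?thesis .
  qed
  have "(\<lambda>n. exp c * (1 / 2) ^ n) \<longlonglongrightarrow> exp c * 0"
    by (intro tendsto_mult tendsto_const LIMSEQ_power_zero) simp
  then have ev1: "\<forall>\<^sub>F n in sequentially. exp c * (1 / 2) ^ n < 1 / 2" by (rule order_tendstoD(2)) simp
  have ev2: "\<forall>\<^sub>F n in sequentially. n > 0 \<and> norm w \<le> (a + b) * real n"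
  proof -
    obtain N where N: "norm w / (a + b) \<le> real N" using real_arch_simple by blast
    have "n > 0 \<and> norm w \<le> (a + b) * real n" if "n \<ge> Suc N" for n
    proof -
      have "norm w / (a + b) \<le> real n" using N that by simp
      then show ?thesis using that a b by (simp add: field_simps)
    qed
    then show ?thesis using eventually_sequentially by blast
  qed
  have "\<forall>\<^sub>F n in sequentially. norm (h w) \<le> C * (1 / 2) ^ n"
    using ev1 ev2
  proof eventually_elim
    case (elim n)
    have "norm (h w) \<le> C * (exp c * (1 / 2) ^ n) ^ n" using elim by (intro bound) auto
    also have "\<dots> \<le> C * (1 / 2) ^ n" using elim C0 by (intro mult_left_mono power_mono) auto
    finally show ?case .
  qed
  moreover have "(\<lambda>n. C * (1 / 2) ^ n) \<longlonglongrightarrow> C * 0"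
    by (intro tendsto_mult tendsto_const LIMSEQ_power_zero) simp
  ultimately have "norm (h w) \<le> 0" using tendsto_lowerbound[of _ "C * 0" sequentially "norm (h w)"] by auto
  then show ?thesis by simp
qed

section \<open>Laplace transforms of compactly supported distributions\<close>

text \<open>The remainder of the exponential series. The case \<open>N = 0\<close> is the exponential itself, so that one
  estimate gives both the growth of the Laplace transform and its power series.\<close>

definition exp_tail :: "nat \<Rightarrow> complex \<Rightarrow> complex" where
  "exp_tail N t = exp t - (\<Sum>k<N. t ^ k / fact k)"

lemma exp_tail_bound: "norm (exp_tail N t) \<le> norm t ^ N / fact N * exp (norm t)"
proof -
  let ?a = "\<lambda>k. t ^ k /\<^sub>R fact k"
  have s: "summable ?a" using exp_converges[of t] sums_summable by blast
  have s': "summable (\<lambda>k. norm t ^ k /\<^sub>R fact k)" using exp_converges[of "norm t"] sums_summable by blast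
  have "exp t = (\<Sum>k. ?a (k + N)) + (\<Sum>k<N. ?a k)" unfolding exp_def by (rule suminf_split_initial_segment[OF s])
  then have eq: "exp_tail N t = (\<Sum>k. ?a (k + N))"
    by (simp add: exp_tail_def scaleR_conv_of_real divide_inverse mult.commute)
  have le: "norm (?a (k + N)) \<le> norm t ^ N / fact N * (norm t ^ k /\<^sub>R fact k)" for k
  proof -
    have "(fact k * fact N :: real) \<le> fact (k + N)"
      using dvd_imp_le[OF fact_fact_dvd_fact[of k N]] fact_gt_zero[of "k + N", where 'a=nat]
      by (metis of_nat_fact of_nat_le_iff of_nat_mult)
    then have "norm t ^ (k + N) / fact (k + N) \<le> norm t ^ (k + N) / (fact k * fact N)"
      by (intro divide_left_mono) auto
    then show ?thesis by (simp add: norm_power norm_mult divide_inverse power_add mult_ac)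
  qed
  have sm: "summable (\<lambda>k. norm t ^ N / fact N * (norm t ^ k /\<^sub>R fact k))" by (rule summable_mult[OF s'])
  have "norm (exp_tail N t) \<le> (\<Sum>k. norm t ^ N / fact N * (norm t ^ k /\<^sub>R fact k))"
  proof -
    have sn: "summable (\<lambda>k. norm (?a (k + N)))"
      by (rule summable_comparison_test'[OF sm, of 0]) (use le in auto)
    show ?thesis unfolding eq by (rule order_trans[OF summable_norm[OF sn] suminf_le[OF le sn sm]])
  qed
  also have "\<dots> = norm t ^ N / fact N * exp (norm t)" unfolding exp_def by (rule suminf_mult[OF s'])
  finally show ?thesis .
qed

lemma DERIV_exp_tail: "(exp_tail N has_field_derivative exp_tail (N - 1) t) (at t)"
proof -
  have "((\<lambda>t. \<Sum>k<N. t ^ k / fact k) has_field_derivative (\<Sum>k<N - 1. t ^ k / fact k)) (at t)"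
  proof (cases N)
    case (Suc n)
    have "((\<lambda>t. \<Sum>k<N. t ^ k / fact k) has_field_derivative (\<Sum>k<N. of_nat k * t ^ (k - 1) / fact k)) (at t)"
      by (auto intro!: derivative_eq_intros sum.cong)
    also have "(\<Sum>k<N. of_nat k * t ^ (k - 1) / fact k) = (\<Sum>k<n. t ^ k / fact k)"
    proof -
      have "of_nat (Suc k) * t ^ k / fact (Suc k) = t ^ k / fact k" for k by (simp del: of_nat_Suc)
      then show ?thesis unfolding Suc sum.lessThan_Suc_shift by simp
    qed
    finally show ?thesis by (simp add: Suc)
  qed auto
  then show ?thesis unfolding exp_tail_def[abs_def] by (rule DERIV_diff[OF DERIV_exp])
qed

text \<open>The bound of \<open>exp_tail_bound\<close> for arguments of absolute value at most \<open>K s\<close>.\<close>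

definition tail_bound :: "real \<Rightarrow> nat \<Rightarrow> real \<Rightarrow> real" where
  "tail_bound K N s = (K * s) ^ N / fact N * exp (K * s)"

lemma tail_bound_nonneg: "K \<ge> 0 \<Longrightarrow> s \<ge> 0 \<Longrightarrow> tail_bound K N s \<ge> 0"
  by (simp add: tail_bound_def)

lemma tail_bound_pred:
  assumes "K \<ge> 0" "s \<ge> 0" shows "tail_bound K N s \<le> (1 + K) * (1 + s) * tail_bound K (N - 1) s"
proof (cases N)
  case 0
  have "1 \<le> (1 + K) * (1 + s)" using assms by (simp add: algebra_simps)
  then show ?thesis using 0 mult_right_mono[OF _ tail_bound_nonneg[OF assms], of 1 _ 0] by simp
next
  case (Suc n)
  have "tail_bound K N s = (K * s) / real (Suc n) * tail_bound K n s"
    by (simp add: Suc tail_bound_def field_simps)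
  also have "\<dots> \<le> ((1 + K) * (1 + s)) * tail_bound K n s"
  proof (intro mult_right_mono tail_bound_nonneg assms)
    have "(K * s) / real (Suc n) \<le> K * s" using assms by (simp add: divide_le_eq mult_left_le algebra_simps)
    also have "\<dots> \<le> (1 + K) * (1 + s)" using assms by (intro mult_mono) auto
    finally show "(K * s) / real (Suc n) \<le> (1 + K) * (1 + s)" .
  qed
  finally show ?thesis by (simp add: Suc)
qed

lemma tail_bound_weight_mono:
  assumes "K \<ge> 0" "s \<ge> 0" "n \<le> M"
  shows "(1 + s) ^ n * tail_bound K (N - n) s \<le> (1 + K) ^ (M - n) * ((1 + s) ^ M * tail_bound K (N - M) s)"
  using assms(3)
proof (induction M rule: dec_induct)
  case (step m)
  have "(1 + K) ^ (m - n) * ((1 + s) ^ m * tail_bound K (N - m) s) \<le>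
      (1 + K) ^ (m - n) * ((1 + s) ^ m * ((1 + K) * (1 + s) * tail_bound K (N - m - 1) s))"
    using assms by (intro mult_left_mono tail_bound_pred) auto
  also have "\<dots> = (1 + K) ^ (Suc m - n) * ((1 + s) ^ Suc m * tail_bound K (N - Suc m) s)"
    using step.hyps by (simp add: Suc_diff_le mult_ac)
  finally show ?case using step.IH by linarith
qed simp

lemma smooth_exp_tail:
  assumes "bounded_linear \<phi>" shows "smooth (\<lambda>x::'a::euclidean_space. exp_tail N (z * \<phi> x))"
proof -
  have l: "slow (\<lambda>n x. z * \<phi> x)" by (intro slow_mult slow_const slow_bounded_linear assms)
  have "slow (\<lambda>n x. (z * \<phi> x) ^ k / fact k)" for k
    using slow_mult[OF slow_power[OF l] slow_const[of "1 / fact k"]] by simp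
  then have "smooth (\<lambda>x. (z * \<phi> x) ^ k / fact k)" for k by (rule slow_smooth)
  then show ?thesis unfolding exp_tail_def by (intro smooth_diff smooth_exp[OF slow_smooth[OF l]] smooth_sum)
qed

lemma pd_mult_exp_tail:
  assumes \<phi>: "bounded_linear \<phi>" and \<theta>: "\<theta> differentiable_on UNIV"
  shows "pd v (\<lambda>x. \<theta> x * exp_tail N (z * \<phi> x)) =
    (\<lambda>x. pd v \<theta> x * exp_tail N (z * \<phi> x) + z * ((\<phi> v * \<theta> x) * exp_tail (N - 1) (z * \<phi> x)))"
proof (rule ext, rule trans[OF pd_eqI])
  fix x
  have "((\<lambda>x. z * \<phi> x) has_derivative (\<lambda>v. z * \<phi> v)) (at x)"
    by (intro bounded_linear_imp_has_derivative bounded_linear_compose[OF bounded_linear_mult_right \<phi>])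
  from has_derivative_compose[OF this DERIV_exp_tail[unfolded has_field_derivative_def]]
  have "((\<lambda>x. exp_tail N (z * \<phi> x)) has_derivative (\<lambda>v. exp_tail (N - 1) (z * \<phi> x) * (z * \<phi> v))) (at x)" .
  from has_derivative_mult[OF has_derivative_pd[OF \<theta>] this]
  show "((\<lambda>x. \<theta> x * exp_tail N (z * \<phi> x)) has_derivative
    (\<lambda>v. \<theta> x * (exp_tail (N - 1) (z * \<phi> x) * (z * \<phi> v)) + pd v \<theta> x * exp_tail N (z * \<phi> x))) (at x)" .
qed (simp add: algebra_simps)

text \<open>Every differentiation costs at most a factor \<open>z\<close> and lowers the index of the remainder by at most one.
  The subtraction \<open>N - length vs\<close> is truncated, in agreement with the exponential being its own
  derivative.\<close>

lemma iter_deriv_exp_tail_bound: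
  fixes \<phi> :: "'a::euclidean_space \<Rightarrow> complex"
  assumes \<phi>: "bounded_linear \<phi>" and K: "K \<ge> 0" "\<And>x. norm x \<le> R \<Longrightarrow> norm (\<phi> x) \<le> K"
    and vs: "vs \<in> lists Basis"
  shows "\<theta> \<in> schwartz \<Longrightarrow> (\<And>x. norm x > R \<Longrightarrow> \<theta> x = 0) \<Longrightarrow>
    \<exists>C\<ge>0. \<forall>N z x. norm (iter_deriv vs (\<lambda>x. \<theta> x * exp_tail N (z * \<phi> x)) x) \<le>
      C * ((1 + norm z) ^ length vs * tail_bound K (N - length vs) (norm z))"
  using vs
proof (induction vs arbitrary: \<theta> rule: rev_induct)
  case Nil
  obtain c where "sbound 0 c \<theta>" using schwartz_sbound[OF Nil(1)] by blast
  then have c: "norm (\<theta> x) \<le> c" "c \<ge> 0" for x using sboundD[OF _ Nil_words, of 0 c \<theta> x] sbound_nonneg by auto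
  have "norm (\<theta> x * exp_tail N (z * \<phi> x)) \<le> c * tail_bound K N (norm z)" for N z x
  proof (cases "norm x \<le> R")
    case True
    have "norm (z * \<phi> x) \<le> K * norm z" using mult_left_mono[OF K(2)[OF True], of "norm z"] by (simp add: norm_mult mult.commute)
    then have "norm (z * \<phi> x) ^ N / fact N * exp (norm (z * \<phi> x)) \<le> tail_bound K N (norm z)"
      unfolding tail_bound_def using K(1) by (intro mult_mono divide_right_mono power_mono) auto
    then have "norm (exp_tail N (z * \<phi> x)) \<le> tail_bound K N (norm z)" using exp_tail_bound order_trans by blast
    then show ?thesis unfolding norm_mult[of "\<theta> x"] using c by (intro mult_mono) auto
  next
    case False
    then show ?thesis using Nil(2)[of x] c(2) tail_bound_nonneg[OF K(1)] by simp
  qed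
  then show ?case using c(2) by auto
next
  case (snoc v us)
  have v: "v \<in> Basis" and us: "us \<in> lists Basis" using snoc.prems(3) by auto
  have d: "\<theta> differentiable_on UNIV" by (rule smooth_differentiable[OF schwartz_smooth[OF snoc.prems(1)]])
  let ?n = "length us"
  let ?t = "\<lambda>n N z. (1 + norm z) ^ n * tail_bound K (N - n) (norm (z::complex))"
  have t0: "?t n N z \<ge> 0" for n N z by (intro mult_nonneg_nonneg zero_le_power tail_bound_nonneg K) auto
  have p0: "pd v \<theta> x = 0" if "norm x > R" for x
    using pd_cong_open[OF d, of "- cball 0 R" "\<lambda>x. 0" x v] snoc.prems(2) that by (simp add: open_Compl)
  have lt: "(\<lambda>x. \<phi> v * \<theta> x) \<in> schwartz" by (rule schwartz_cmult[OF snoc.prems(1)])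
  obtain C where C: "C \<ge> 0" "\<And>N z x. norm (iter_deriv us (\<lambda>x. pd v \<theta> x * exp_tail N (z * \<phi> x)) x) \<le> C * ?t ?n N z"
    using snoc.IH[OF schwartz_pd[OF snoc.prems(1) v] p0 us] by blast
  obtain D where D: "D \<ge> 0" "\<And>N z x. norm (iter_deriv us (\<lambda>x. (\<phi> v * \<theta> x) * exp_tail N (z * \<phi> x)) x) \<le> D * ?t ?n N z"
    using snoc.IH[OF lt _ us] snoc.prems(2) by auto
  have "norm (iter_deriv (us @ [v]) (\<lambda>x. \<theta> x * exp_tail N (z * \<phi> x)) x) \<le> (C * (1 + K) + D) * ?t (Suc ?n) N z" for N z x
  proof -
    have sm: "smooth (\<lambda>x. pd v \<theta> x * exp_tail N (z * \<phi> x))" "smooth (\<lambda>x. (\<phi> v * \<theta> x) * exp_tail (N - 1) (z * \<phi> x))"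
      by (intro smooth_mult smooth_exp_tail \<phi> schwartz_smooth schwartz_pd snoc.prems(1) v lt)+
    have eq: "iter_deriv (us @ [v]) (\<lambda>x. \<theta> x * exp_tail N (z * \<phi> x)) x =
      iter_deriv us (\<lambda>x. pd v \<theta> x * exp_tail N (z * \<phi> x)) x +
      z * iter_deriv us (\<lambda>x. (\<phi> v * \<theta> x) * exp_tail (N - 1) (z * \<phi> x)) x"
      unfolding iter_deriv_snoc pd_mult_exp_tail[OF \<phi> d]
      using iter_deriv_add[OF sm(1) smooth_mult[OF smooth_const[of z] sm(2)] us] iter_deriv_cmult[OF sm(2) us, of z] by simp
    have 1: "norm (iter_deriv us (\<lambda>x. pd v \<theta> x * exp_tail N (z * \<phi> x)) x) \<le> (C * (1 + K)) * ?t (Suc ?n) N z"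
    proof -
      have "?t ?n N z \<le> (1 + K) ^ (Suc ?n - ?n) * ?t (Suc ?n) N z"
        using K(1) by (intro tail_bound_weight_mono) auto
      then have "C * ?t ?n N z \<le> C * ((1 + K) * ?t (Suc ?n) N z)"
        using C(1) by (intro mult_left_mono) auto
      then show ?thesis using C(2)[of N z x] by (simp only: mult.assoc)
    qed
    have 2: "norm (z * iter_deriv us (\<lambda>x. (\<phi> v * \<theta> x) * exp_tail (N - 1) (z * \<phi> x)) x) \<le> D * ?t (Suc ?n) N z"
    proof -
      have "norm (z * iter_deriv us (\<lambda>x. (\<phi> v * \<theta> x) * exp_tail (N - 1) (z * \<phi> x)) x) \<le>
        (1 + norm z) * (D * ?t ?n (N - 1) z)"
        unfolding norm_mult[of z] by (intro mult_mono D(2)) auto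
      also have "\<dots> = D * ?t (Suc ?n) N z" by (simp add: mult_ac)
      finally show ?thesis .
    qed
    show ?thesis unfolding eq using norm_triangle_mono[OF 1 2] by (simp only: distrib_right)
  qed
  then show ?case using C(1) D(1) K(1) by (intro exI[of _ "C * (1 + K) + D"]) auto
qed

lemma cfunctional_exp_tail_bound:
  fixes \<phi> :: "'a::euclidean_space \<Rightarrow> complex"
  assumes u: "cfunctional u" and \<theta>: "\<theta> \<in> test" and \<phi>: "bounded_linear \<phi>"
  shows "\<exists>C K M. C \<ge> 0 \<and> K \<ge> 0 \<and> (\<forall>N z. norm (u (\<lambda>x. \<theta> x * exp_tail N (z * \<phi> x))) \<le>
     C * ((1 + norm z) ^ M * tail_bound K (N - M) (norm z)))"
proof -
  obtain R where R: "\<And>x. norm x > R \<Longrightarrow> \<theta> x = 0" using \<theta> unfolding test_def by blast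
  obtain L where L: "L \<ge> 0" "\<And>x. norm (\<phi> x) \<le> norm x * L" using bounded_linear.nonneg_bounded[OF \<phi>] by blast
  define K where "K = \<bar>R\<bar> * L"
  have K: "K \<ge> 0" "\<And>x. norm x \<le> R \<Longrightarrow> norm (\<phi> x) \<le> K"
    using L(1) by (auto simp: K_def intro!: order_trans[OF L(2)] mult_right_mono)
  obtain M B where B: "B \<ge> 0" "\<And>f c. f \<in> schwartz \<Longrightarrow> sbound M c f \<Longrightarrow> norm (u f) \<le> B * c"
    using cfunctional_bound[OF u] by blast
  let ?f = "\<lambda>N z x. \<theta> x * exp_tail N (z * \<phi> x)"
  let ?t = "\<lambda>n N z. (1 + norm z) ^ n * tail_bound K (N - n) (norm (z::complex))"
  have t0: "?t n N z \<ge> 0" for n N z by (intro mult_nonneg_nonneg zero_le_power tail_bound_nonneg K) auto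
  have "\<forall>vs. \<exists>C. vs \<in> lists Basis \<longrightarrow> C \<ge> 0 \<and> (\<forall>N z x. norm (iter_deriv vs (?f N z) x) \<le> C * ?t (length vs) N z)"
    using iter_deriv_exp_tail_bound[OF \<phi> K _ test_schwartz[OF \<theta>] R] by blast
  then obtain C where C: "\<And>vs. vs \<in> lists Basis \<Longrightarrow> C vs \<ge> 0"
    "\<And>vs N z x. vs \<in> lists Basis \<Longrightarrow> norm (iter_deriv vs (?f N z) x) \<le> C vs * ?t (length vs) N z"
    by metis
  define S where "S = (\<Sum>vs\<in>words M. C vs * (1 + K) ^ (M - length vs))"
  have Cw: "0 \<le> C vs * (1 + K) ^ (M - length vs)" if "vs \<in> words M" for vs
    using C(1)[OF words_lists[OF that]] K(1) by simp
  have S0: "S \<ge> 0" unfolding S_def using Cw by (intro sum_nonneg)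
  have ftest: "?f N z \<in> test" for N z
    using test_mult[OF smooth_exp_tail[OF \<phi>] \<theta>] by (simp add: mult.commute)
  have "sbound M ((1 + \<bar>R\<bar>) ^ M * (S * ?t M N z)) (?f N z)" for N z
    unfolding sbound_def
  proof (intro ballI allI)
    fix vs :: "'a list" and x :: 'a assume vs: "vs \<in> words M"
    then have l: "length vs \<le> M" by (simp add: words_def)
    show "(1 + norm x) ^ M * norm (iter_deriv vs (?f N z) x) \<le> (1 + \<bar>R\<bar>) ^ M * (S * ?t M N z)"
    proof (cases "norm x \<le> R")
      case True
      have "norm (iter_deriv vs (?f N z) x) \<le> C vs * ?t (length vs) N z" by (rule C(2)[OF words_lists[OF vs]])
      also have "\<dots> \<le> C vs * ((1 + K) ^ (M - length vs) * ?t M N z)"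
        using K(1) by (intro mult_left_mono tail_bound_weight_mono l C(1)[OF words_lists[OF vs]]) auto
      also have "\<dots> = (C vs * (1 + K) ^ (M - length vs)) * ?t M N z" by simp
      also have "\<dots> \<le> S * ?t M N z" unfolding S_def
        using vs Cw by (intro mult_right_mono member_le_sum t0) auto
      finally show ?thesis using True by (intro mult_mono power_mono) auto
    next
      case False
      have "iter_deriv vs (?f N z) x = 0"
        using False R ftest[of N z]
        by (intro iter_deriv_zero_open[of _ "- cball 0 R", OF _ _ _ words_lists[OF vs]]) (auto simp: test_def open_Compl)
      then show ?thesis using S0 t0[of z M N] by simp
    qed
  qed
  then have "norm (u (?f N z)) \<le> B * ((1 + \<bar>R\<bar>) ^ M * (S * ?t M N z))" for N z
    by (rule B(2)[OF test_schwartz[OF ftest]])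
  then have "norm (u (?f N z)) \<le> (B * (1 + \<bar>R\<bar>) ^ M * S) * ?t M N z" for N z
    by (simp only: mult.assoc)
  moreover have "B * (1 + \<bar>R\<bar>) ^ M * S \<ge> 0" using B(1) S0 by simp
  ultimately show ?thesis using K(1) by blast
qed

text \<open>The remainder estimate with index \<open>0\<close> bounds the growth; with index tending to infinity it shows
  that the power series with coefficients \<open>u (\<theta> \<phi> ^ k) / k!\<close> converges to \<open>h\<close> everywhere.\<close>

theorem laplace_entire_exponential_type:
  fixes \<phi> :: "'a::euclidean_space \<Rightarrow> complex"
  assumes u: "cfunctional u" and \<theta>: "\<theta> \<in> test" and \<phi>: "bounded_linear \<phi>"
  defines "h \<equiv> \<lambda>z. u (\<lambda>x. \<theta> x * exp (z * \<phi> x))"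
  shows "h holomorphic_on UNIV" and "\<exists>C K. \<forall>z. norm (h z) \<le> C * exp (K * norm z)"
proof -
  obtain C K M where C: "C \<ge> 0" "K \<ge> 0" "\<And>N z. norm (u (\<lambda>x. \<theta> x * exp_tail N (z * \<phi> x))) \<le>
     C * ((1 + norm z) ^ M * tail_bound K (N - M) (norm z))"
    using cfunctional_exp_tail_bound[OF assms(1-3)] by blast
  have h0: "h z = u (\<lambda>x. \<theta> x * exp_tail 0 (z * \<phi> x))" for z by (simp add: h_def exp_tail_def)
  show "\<exists>C K. \<forall>z. norm (h z) \<le> C * exp (K * norm z)"
  proof (intro exI allI)
    fix z
    have "norm (h z) \<le> C * ((1 + norm z) ^ M * exp (K * norm z))"
      using C(3)[of 0 z] unfolding h0 by (simp add: tail_bound_def)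
    also have "\<dots> \<le> C * ((fact M * exp (1 + norm z)) * exp (K * norm z))"
      using C(1) by (intro mult_left_mono mult_right_mono power_le_fact_exp) auto
    also have "\<dots> = (C * fact M * exp 1) * exp ((1 + K) * norm z)" by (simp add: exp_add distrib_right)
    finally show "norm (h z) \<le> (C * fact M * exp 1) * exp ((1 + K) * norm z)" .
  qed
  define a where "a k = u (\<lambda>x. \<theta> x * \<phi> x ^ k) / fact k" for k
  have pS: "(\<lambda>x. \<theta> x * \<phi> x ^ k) \<in> schwartz" for k
    using schwartz_mult_slow[OF slow_power[OF slow_bounded_linear[OF \<phi>]] test_schwartz[OF \<theta>], of k] by (simp add: mult.commute)
  have tS: "(\<lambda>x. \<theta> x * exp_tail N (z * \<phi> x)) \<in> schwartz" for N z
    using test_schwartz[OF test_mult[OF smooth_exp_tail[OF \<phi>] \<theta>]] by (simp add: mult.commute)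
  have series: "(\<lambda>k. a k * z ^ k) sums h z" for z
  proof -
    have part: "h z - (\<Sum>k<N. a k * z ^ k) = u (\<lambda>x. \<theta> x * exp_tail N (z * \<phi> x))" for N
    proof -
      let ?p = "\<lambda>k x. (z ^ k / fact k) * (\<theta> x * \<phi> x ^ k)"
      have pk: "?p k \<in> schwartz" for k by (rule schwartz_cmult[OF pS])
      have "(\<lambda>x. \<theta> x * exp_tail N (z * \<phi> x)) = (\<lambda>x. \<theta> x * exp_tail 0 (z * \<phi> x) - (\<Sum>k<N. ?p k x))"
        by (simp add: exp_tail_def right_diff_distrib sum_distrib_left power_mult_distrib mult_ac)
      then have "u (\<lambda>x. \<theta> x * exp_tail N (z * \<phi> x)) = h z - (\<Sum>k<N. u (?p k))"
        unfolding h0 using cfunctional_diff[OF u tS cfunctional_sum(2)[OF u pk, of "{..<N}"]]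
          cfunctional_sum(1)[OF u pk, of "{..<N}"] by simp
      also have "(\<Sum>k<N. u (?p k)) = (\<Sum>k<N. a k * z ^ k)"
        by (intro sum.cong refl) (simp only: cfunctional_cmult[OF u pS] a_def, simp)
      finally show ?thesis by simp
    qed
    have "(\<lambda>N. C * ((1 + norm z) ^ M * tail_bound K N (norm z))) \<longlonglongrightarrow> 0"
    proof -
      have "(\<lambda>N. (K * norm z) ^ N /\<^sub>R fact N) \<longlonglongrightarrow> 0"
        using exp_converges[of "K * norm z"] sums_summable summable_LIMSEQ_zero by blast
      then have "(\<lambda>N. tail_bound K N (norm z)) \<longlonglongrightarrow> 0"
        unfolding tail_bound_def by (intro tendsto_mult_left_zero) (simp add: divide_inverse mult.commute)
      then show ?thesis by (intro tendsto_mult_right_zero)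
    qed
    then have "(\<lambda>N. C * ((1 + norm z) ^ M * tail_bound K ((N + M) - M) (norm z))) \<longlonglongrightarrow> 0" by simp
    then have "(\<lambda>N. h z - (\<Sum>k<N + M. a k * z ^ k)) \<longlonglongrightarrow> 0"
      unfolding part by (rule Lim_null_comparison[rotated]) (intro always_eventually allI C(3))
    then have "(\<lambda>N. \<Sum>k<N + M. a k * z ^ k) \<longlonglongrightarrow> h z"
      using tendsto_diff[OF tendsto_const[of "h z"], of "\<lambda>N. h z - (\<Sum>k<N + M. a k * z ^ k)" 0 sequentially] by simp
    then show ?thesis unfolding sums_def by (rule LIMSEQ_offset)
  qed
  have "h holomorphic_on ball 0 r" for r
    by (rule power_series_holomorphic[of 0 r a]) (simp add: series)
  then have "h field_differentiable at z" for z
    using holomorphic_on_imp_differentiable_at[of h "ball 0 (norm z + 1)" z] by auto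
  then show "h holomorphic_on UNIV" by (auto simp: holomorphic_on_def field_differentiable_at_within)
qed

section \<open>Tensor products of Schwartz functions\<close>

text \<open>A derivative of a function of the coordinate \<open>x \<bullet> e\<close> is either zero or a derivative in that coordinate
  alone.\<close>

lemma iter_deriv_coordinate_bound:
  fixes e :: "'a::euclidean_space"
  assumes e: "e \<in> Basis" and vs: "vs \<in> lists Basis" and g: "smooth (g :: real \<Rightarrow> complex)"
  shows "\<exists>ws\<in>words (length vs). \<forall>x. norm (iter_deriv vs (\<lambda>x. g (x \<bullet> e)) x) \<le> norm (iter_deriv ws g (x \<bullet> e))"
  using vs g
proof (induction vs arbitrary: g rule: rev_induct)
  case Nil
  then show ?case by (intro bexI[of _ "[]"]) auto
next
  case (snoc v us)
  have v: "v \<in> Basis" and us: "us \<in> lists Basis" using snoc.prems by auto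
  have bl: "bounded_linear (\<lambda>x::'a. complex_of_real (x \<bullet> e))"
    by (intro bounded_linear_compose[OF bounded_linear_of_real] bounded_linear_inner_left)
  have "pd v (\<lambda>x. complex_of_real (x \<bullet> e)) x = of_real (v \<bullet> e)" for x
    by (rule pd_eqI[OF bounded_linear_imp_has_derivative[OF bl]])
  then have pd: "pd v (\<lambda>x. g (x \<bullet> e)) = (\<lambda>x. of_real (v \<bullet> e) * pd 1 g (x \<bullet> e))"
    using pd_mult_comp[of "\<lambda>_. 1" g "\<lambda>x. x \<bullet> e" v] smooth_differentiable[OF snoc.prems(2)]
      smooth_differentiable[OF smooth_linear[OF bl]] smooth_differentiable[OF smooth_const[of 1]] by simp
  show ?case
  proof (cases "v = e")
    case True
    then have "pd v (\<lambda>x. g (x \<bullet> e)) = (\<lambda>x. pd 1 g (x \<bullet> e))" using pd e by (simp add: inner_Basis)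
    moreover obtain ws where "ws \<in> words (length us)" "\<And>x. norm (iter_deriv us (\<lambda>x. pd 1 g (x \<bullet> e)) x) \<le> norm (iter_deriv ws (pd 1 g) (x \<bullet> e))"
      using snoc.IH[OF us smooth_pd[OF snoc.prems(2), of 1]] by auto
    ultimately show ?thesis
      by (intro bexI[of _ "ws @ [1]"]) (auto simp: iter_deriv_snoc words_snoc)
  next
    case False
    then have "pd v (\<lambda>x. g (x \<bullet> e)) = (\<lambda>x. 0)" using pd e v by (simp add: inner_Basis)
    then show ?thesis by (intro bexI[of _ "[]"]) (auto simp: iter_deriv_snoc iter_deriv_zero[OF us])
  qed
qed

definition tensor :: "(real \<Rightarrow> complex) \<Rightarrow> (real \<Rightarrow> complex) \<Rightarrow> real \<times> real \<Rightarrow> complex" where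
  "tensor g k = (\<lambda>(x, \<xi>). g x * k \<xi>)"

lemma tensor_eq: "tensor g k = (\<lambda>p. g (p \<bullet> (1, 0)) * k (p \<bullet> (0, 1)))"
  by (auto simp: tensor_def fun_eq_iff)

lemma smooth_coordinate:
  assumes "smooth h" shows "smooth (\<lambda>p::'a::euclidean_space. h (p \<bullet> b))"
proof (rule smooth_comp[OF assms])
  show "smooth (\<lambda>p::'a. complex_of_real (p \<bullet> b))"
    by (intro smooth_linear bounded_linear_compose[OF bounded_linear_of_real] bounded_linear_inner_left)
qed

lemma smooth_tensor:
  assumes "smooth g" "smooth k" shows "smooth (tensor g k)"
  unfolding tensor_eq by (rule smooth_mult[OF smooth_coordinate[OF assms(1)] smooth_coordinate[OF assms(2)]])

lemma sbound_tensor: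
  assumes "smooth g" "smooth k" "sbound N c g" "sbound N d k"
  shows "sbound N (2 ^ N * (c * d)) (tensor g k)"
  unfolding sbound_def
proof (intro ballI allI)
  fix vs :: "(real \<times> real) list" and p :: "real \<times> real" assume vs: "vs \<in> words N"
  let ?e = "(1, 0) :: real \<times> real" and ?f = "(0, 1) :: real \<times> real"
  have e: "?e \<in> Basis" "?f \<in> Basis" by (auto simp: Basis_prod_def)
  have coord: "norm (iter_deriv ws (\<lambda>p. g (p \<bullet> b)) p) \<le> c / (1 + norm (p \<bullet> b)) ^ N"
    if ws: "ws \<in> words N" and b: "b \<in> Basis" and g: "smooth g" "sbound N c g"
    for ws b c and g :: "real \<Rightarrow> complex"
  proof -
    obtain us where us: "us \<in> words (length ws)"
      "norm (iter_deriv ws (\<lambda>p. g (p \<bullet> b)) p) \<le> norm (iter_deriv us g (p \<bullet> b))"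
      using iter_deriv_coordinate_bound[OF b words_lists[OF ws] g(1)] by blast
    have "us \<in> words N" using us(1) ws by (auto simp: words_def)
    from sboundD[OF g(2) this, of "p \<bullet> b"]
    have "norm (iter_deriv us g (p \<bullet> b)) \<le> c / (1 + norm (p \<bullet> b)) ^ N"
      by (simp add: field_simps add_pos_nonneg)
    with us(2) show ?thesis by linarith
  qed
  let ?x = "1 + norm (p \<bullet> ?e)" and ?y = "1 + norm (p \<bullet> ?f)"
  have pos: "?x > 0" "?y > 0" by (auto intro: add_pos_nonneg)
  have *: "norm (iter_deriv vs (tensor g k) p) \<le> 2 ^ N * ((c / ?x ^ N) * (d / ?y ^ N))"
    unfolding tensor_eq
    by (rule iter_deriv_mult_bound[OF smooth_coordinate[OF assms(1)] smooth_coordinate[OF assms(2)] vs])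
       (use coord[OF _ e(1) assms(1,3)] coord[OF _ e(2) assms(2,4)] in auto)
  have "1 + norm p \<le> ?x * ?y"
  proof -
    have "norm p \<le> norm (fst p) + norm (snd p)" by (cases p) (simp add: norm_Pair sqrt_sum_squares_le_sum_abs)
    moreover have "0 \<le> norm (fst p) * norm (snd p)" by simp
    ultimately have "1 + norm p \<le> 1 + norm (fst p) + norm (snd p) + norm (fst p) * norm (snd p)" by linarith
    then show ?thesis by (cases p) (simp add: algebra_simps)
  qed
  then have "(1 + norm p) ^ N \<le> ?x ^ N * ?y ^ N" unfolding power_mult_distrib[symmetric] by (intro power_mono) auto
  then have "(1 + norm p) ^ N * norm (iter_deriv vs (tensor g k) p) \<le>
     (?x ^ N * ?y ^ N) * (2 ^ N * ((c / ?x ^ N) * (d / ?y ^ N)))"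
    by (intro mult_mono *) auto
  also have "\<dots> = 2 ^ N * (c * d)" using pos by (simp add: field_simps)
  finally show "(1 + norm p) ^ N * norm (iter_deriv vs (tensor g k) p) \<le> 2 ^ N * (c * d)" .
qed

lemma tensor_schwartz:
  assumes "g \<in> schwartz" "k \<in> schwartz" shows "tensor g k \<in> schwartz"
proof -
  have "\<exists>c. sbound N c (tensor g k)" for N
  proof -
    obtain c d where "sbound N c g" "sbound N d k" using schwartz_sbound assms by blast
    from sbound_tensor[OF schwartz_smooth[OF assms(1)] schwartz_smooth[OF assms(2)] this] show ?thesis by blast
  qed
  then show ?thesis
    using smooth_tensor schwartz_smooth assms unfolding schwartz_iff_sbound by simp
qed

lemma coperator_tensor_left:
  assumes k: "k \<in> schwartz" shows "coperator (\<lambda>g. tensor g k)"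
  unfolding coperator_def
proof (intro conjI ballI allI)
  fix N
  obtain d where d: "sbound N d k" using schwartz_sbound[OF k] by blast
  have "sbound N ((2 ^ N * d) * c) (tensor g k)" if "g \<in> schwartz" "sbound N c g" for g c
    using sbound_tensor[OF schwartz_smooth[OF that(1)] schwartz_smooth[OF k] that(2) d] by (simp add: mult_ac)
  then show "\<exists>M C. \<forall>g\<in>schwartz. \<forall>c. sbound M c g \<longrightarrow> sbound N (C * c) (tensor g k)" by blast
qed (auto simp: tensor_schwartz k, auto simp: tensor_def fun_eq_iff algebra_simps)

lemma coperator_tensor_right:
  assumes g: "g \<in> schwartz" shows "coperator (\<lambda>k. tensor g k)"
  unfolding coperator_def
proof (intro conjI ballI allI)
  fix N
  obtain c where c: "sbound N c g" using schwartz_sbound[OF g] by blast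
  have "sbound N ((2 ^ N * c) * d) (tensor g k)" if "k \<in> schwartz" "sbound N d k" for k d
    using sbound_tensor[OF schwartz_smooth[OF g] schwartz_smooth[OF that(1)] c that(2)] by (simp add: mult_ac)
  then show "\<exists>M C. \<forall>k\<in>schwartz. \<forall>d. sbound M d k \<longrightarrow> sbound N (C * d) (tensor g k)" by blast
qed (auto simp: tensor_schwartz g, auto simp: tensor_def fun_eq_iff algebra_simps)

section \<open>Chirped Gaussians\<close>

text \<open>The family \<open>E(z, w)\<close>.\<close>

definition chirped_gaussian :: "complex \<Rightarrow> complex \<Rightarrow> real \<times> real \<Rightarrow> complex" where
  "chirped_gaussian z w = (\<lambda>(x, \<xi>). exp (- of_real pi * (of_real x ^ 2 + of_real \<xi> ^ 2) + 2 * of_real pi * \<i> * of_real x * of_real \<xi>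
     + 2 * of_real pi * z * of_real x + 2 * of_real pi * w * of_real \<xi>))"

text \<open>The exponents of \<open>E(z, w)\<close> on the Fourier side. The quadratic form of \<open>E\<close> has the matrix with
  diagonal entries \<open>1\<close> and off-diagonal entries \<open>-i\<close>; its inverse has entries \<open>1/2\<close> and \<open>i/2\<close>, which
  determines this quadratic form and the two linear forms below.\<close>

definition dual_quadratic :: "real \<times> real \<Rightarrow> complex" where
  "dual_quadratic = (\<lambda>(s, t). - (of_real pi / 2) * (of_real s ^ 2 + of_real t ^ 2) - of_real pi * \<i> * of_real s * of_real t)"

definition dual_form1 :: "real \<times> real \<Rightarrow> complex" where
  "dual_form1 = (\<lambda>(s, t). of_real pi * (\<i> * of_real s - of_real t))"

definition dual_form2 :: "real \<times> real \<Rightarrow> complex" where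
  "dual_form2 = (\<lambda>(s, t). of_real pi * (\<i> * of_real t - of_real s))"

definition dual_gaussian :: "complex \<Rightarrow> complex \<Rightarrow> real \<times> real \<Rightarrow> complex" where
  "dual_gaussian z w p = exp (dual_quadratic p + z * dual_form1 p + w * dual_form2 p)"

lemma slow_fst: "slow (\<lambda>n (p :: real \<times> real). complex_of_real (fst p))"
  and slow_snd: "slow (\<lambda>n (p :: real \<times> real). complex_of_real (snd p))"
  by (intro slow_bounded_linear bounded_linear_compose[OF bounded_linear_of_real] bounded_linear_fst bounded_linear_snd)+

lemma bounded_linear_dual_form1: "bounded_linear dual_form1"
  and bounded_linear_dual_form2: "bounded_linear dual_form2"
proof -
  have 1: "dual_form1 = (\<lambda>p. of_real pi * (\<i> * of_real (fst p) - of_real (snd p)))"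
    and 2: "dual_form2 = (\<lambda>p. of_real pi * (\<i> * of_real (snd p) - of_real (fst p)))"
    by (auto simp: dual_form1_def dual_form2_def)
  show "bounded_linear dual_form1" "bounded_linear dual_form2" unfolding 1 2
    by (intro bounded_linear_compose[OF bounded_linear_mult_right] bounded_linear_sub
        bounded_linear_compose[OF bounded_linear_of_real] bounded_linear_fst bounded_linear_snd)+
qed

lemma slow_dual_quadratic: "slow (\<lambda>n. dual_quadratic)"
proof -
  have "slow (\<lambda>n p. - complex_of_real (pi / 2) * (of_real (fst p) ^ 2 + of_real (snd p) ^ 2) - of_real pi * \<i> * of_real (fst p) * of_real (snd p))"
    by (intro slow_diff slow_mult slow_add slow_power slow_const slow_fst slow_snd)
  then show ?thesis by (simp add: dual_quadratic_def split_beta')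
qed

text \<open>The quadratic form has real part \<open>- \<pi> |p|\<^sup>2 / 2\<close>; half of it absorbs the linear terms.\<close>

lemma dual_gaussian_schwartz: "dual_gaussian z w \<in> schwartz"
proof -
  let ?Q = "\<lambda>p. dual_quadratic p + z * dual_form1 p + w * dual_form2 p"
  have "slow (\<lambda>n. ?Q)"
    by (intro slow_add slow_mult slow_const slow_dual_quadratic
        slow_bounded_linear bounded_linear_dual_form1 bounded_linear_dual_form2)
  moreover have "(0::real) < pi / 4" by simp
  moreover have "Re (?Q p) \<le> 2 * pi * (norm z + norm w)\<^sup>2 - pi / 4 * (norm p)\<^sup>2" for p
  proof -
    obtain s t where p: "p = (s, t)" by fastforce
    define A B where "A = - Im z - Re w" and "B = - Re z - Im w"
    have ReQ: "Re (?Q p) = - (pi / 2) * (s\<^sup>2 + t\<^sup>2) + pi * (A * s + B * t)"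
      by (simp add: p dual_quadratic_def dual_form1_def dual_form2_def A_def B_def power2_eq_square algebra_simps)
    have "\<bar>A\<bar> \<le> norm z + norm w" "\<bar>B\<bar> \<le> norm z + norm w"
      using abs_Re_le_cmod[of z] abs_Im_le_cmod[of z] abs_Re_le_cmod[of w] abs_Im_le_cmod[of w] by (auto simp: A_def B_def)
    then have "A\<^sup>2 \<le> (norm z + norm w)\<^sup>2" "B\<^sup>2 \<le> (norm z + norm w)\<^sup>2"
      using abs_le_square_iff[of A "norm z + norm w"] abs_le_square_iff[of B "norm z + norm w"] by auto
    moreover have "0 \<le> (A - s / 2)\<^sup>2" "0 \<le> (B - t / 2)\<^sup>2" by auto
    then have "A * s \<le> A\<^sup>2 + s\<^sup>2 / 4" "B * t \<le> B\<^sup>2 + t\<^sup>2 / 4" by (auto simp: power2_diff field_simps)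
    ultimately have "A * s + B * t - (s\<^sup>2 + t\<^sup>2) / 2 \<le> 2 * (norm z + norm w)\<^sup>2 - (s\<^sup>2 + t\<^sup>2) / 4"
      by argo
    then have "pi * (A * s + B * t - (s\<^sup>2 + t\<^sup>2) / 2) \<le> pi * (2 * (norm z + norm w)\<^sup>2 - (s\<^sup>2 + t\<^sup>2) / 4)"
      by (intro mult_left_mono) auto
    moreover have "(norm p)\<^sup>2 = s\<^sup>2 + t\<^sup>2" by (simp add: p norm_Pair)
    ultimately show ?thesis unfolding ReQ by (simp add: algebra_simps)
  qed
  ultimately show ?thesis unfolding dual_gaussian_def[abs_def] by (rule schwartz_exp)
qed

text \<open>Integrating in \<open>s\<close> first leaves a one-dimensional Gaussian in \<open>t\<close> with real quadratic coefficient,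
  because \<open>(\<pi> i t)\<^sup>2\<close> is real.\<close>

lemma integral_quadratic_gaussian:
  "(LINT t|lborel. LINT s|lborel. exp (dual_quadratic (s, t) + \<beta>1 * of_real s + \<beta>2 * of_real t)) =
    of_real (sqrt 2) * exp ((\<beta>1\<^sup>2 + \<beta>2\<^sup>2 - 2 * \<i> * \<beta>1 * \<beta>2) / (4 * of_real pi))"
proof -
  have inner: "(LINT s|lborel. exp (dual_quadratic (s, t) + \<beta>1 * of_real s + \<beta>2 * of_real t)) =
    of_real (sqrt 2) * exp (\<beta>1\<^sup>2 / (2 * of_real pi)) * exp (- complex_of_real pi * of_real t ^ 2 + (\<beta>2 - \<i> * \<beta>1) * of_real t)" for t
  proof -
    let ?c = "- complex_of_real (pi / 2) * of_real t ^ 2 + \<beta>2 * of_real t"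
    have "(LINT s|lborel. exp (dual_quadratic (s, t) + \<beta>1 * of_real s + \<beta>2 * of_real t)) =
      (LINT s|lborel. exp ?c * exp (- complex_of_real (pi / 2) * of_real s ^ 2 + (\<beta>1 - of_real pi * \<i> * of_real t) * of_real s))"
      by (intro Bochner_Integration.integral_cong refl) (simp add: exp_add[symmetric] dual_quadratic_def algebra_simps)
    also have "\<dots> = exp ?c * (LINT s|lborel. exp (- complex_of_real (pi / 2) * of_real s ^ 2 + (\<beta>1 - of_real pi * \<i> * of_real t) * of_real s))"
      by (rule integral_mult_right_zero)
    also have "\<dots> = exp ?c * (of_real (sqrt (pi / (pi / 2))) * exp ((\<beta>1 - of_real pi * \<i> * of_real t)\<^sup>2 / (4 * of_real (pi / 2))))"
      by (subst integral_gaussian_exp) auto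
    also have "pi / (pi / 2) = 2" by simp
    also have "exp ?c * (of_real (sqrt 2) * exp ((\<beta>1 - of_real pi * \<i> * of_real t)\<^sup>2 / (4 * of_real (pi / 2)))) =
      of_real (sqrt 2) * exp (?c + (\<beta>1 - of_real pi * \<i> * of_real t)\<^sup>2 / (4 * of_real (pi / 2)))"
      by (simp add: exp_add)
    also have "?c + (\<beta>1 - of_real pi * \<i> * of_real t)\<^sup>2 / (4 * of_real (pi / 2)) =
      \<beta>1\<^sup>2 / (2 * of_real pi) + (- complex_of_real pi * of_real t ^ 2 + (\<beta>2 - \<i> * \<beta>1) * of_real t)"
      by (simp add: field_simps power2_eq_square)
    finally show ?thesis by (simp add: exp_add mult.assoc)
  qed
  have "(LINT t|lborel. LINT s|lborel. exp (dual_quadratic (s, t) + \<beta>1 * of_real s + \<beta>2 * of_real t)) =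
    of_real (sqrt 2) * exp (\<beta>1\<^sup>2 / (2 * of_real pi)) * (LINT t|lborel. exp (- complex_of_real pi * of_real t ^ 2 + (\<beta>2 - \<i> * \<beta>1) * of_real t))"
    unfolding inner by (rule integral_mult_right_zero)
  also have "\<dots> = of_real (sqrt 2) * (exp (\<beta>1\<^sup>2 / (2 * of_real pi)) * exp ((\<beta>2 - \<i> * \<beta>1)\<^sup>2 / (4 * of_real pi)))"
    by (subst integral_gaussian_exp) auto
  also have "exp (\<beta>1\<^sup>2 / (2 * of_real pi)) * exp ((\<beta>2 - \<i> * \<beta>1)\<^sup>2 / (4 * of_real pi)) = exp (\<beta>1\<^sup>2 / (2 * of_real pi) + (\<beta>2 - \<i> * \<beta>1)\<^sup>2 / (4 * of_real pi))"
    by (rule exp_add[symmetric])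
  also have "\<beta>1\<^sup>2 / (2 * of_real pi) + (\<beta>2 - \<i> * \<beta>1)\<^sup>2 / (4 * of_real pi) = (\<beta>1\<^sup>2 + \<beta>2\<^sup>2 - 2 * \<i> * \<beta>1 * \<beta>2) / (4 * complex_of_real pi)"
    by (simp add: field_simps power2_eq_square)
  finally show ?thesis by simp
qed

lemma fourier_dual_gaussian:
  "fourier (dual_gaussian z w) p =
    of_real (sqrt 2) * exp (- of_real pi / 2 * (z\<^sup>2 + w\<^sup>2 + 2 * \<i> * z * w)) * chirped_gaussian z w p"
proof -
  obtain x \<xi> where p: "p = (x, \<xi>)" by fastforce
  define \<beta>1 \<beta>2 where "\<beta>1 = of_real pi * \<i> * z - of_real pi * w - 2 * of_real pi * \<i> * of_real x"
    and "\<beta>2 = of_real pi * \<i> * w - of_real pi * z - 2 * of_real pi * \<i> * of_real \<xi>"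
  have eq: "dual_gaussian z w (s, t) * cis (- 2 * pi * (p \<bullet> (s, t))) =
     exp (dual_quadratic (s, t) + \<beta>1 * of_real s + \<beta>2 * of_real t)" for s t
    by (simp add: p dual_gaussian_def dual_form1_def dual_form2_def \<beta>1_def \<beta>2_def cis_conv_exp exp_add[symmetric] algebra_simps)
  have int: "integrable (lborel \<Otimes>\<^sub>M lborel) (\<lambda>(s, t). dual_gaussian z w (s, t) * cis (- 2 * pi * (p \<bullet> (s, t))))"
    using integrable_mult_cis[OF moments_integrable[OF schwartz_moments[OF dual_gaussian_schwartz[of z w]]], of p]
    by (simp add: lborel_prod split_beta')
  have "fourier (dual_gaussian z w) p = (LINT q|(lborel \<Otimes>\<^sub>M lborel). dual_gaussian z w q * cis (- 2 * pi * (p \<bullet> q)))"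
    by (simp add: fourier_def lborel_prod)
  also have "\<dots> = (LINT t|lborel. LINT s|lborel. dual_gaussian z w (s, t) * cis (- 2 * pi * (p \<bullet> (s, t))))"
    using lborel_pair.integral_snd[OF int] by (simp add: split_beta')
  also have "\<dots> = of_real (sqrt 2) * exp ((\<beta>1\<^sup>2 + \<beta>2\<^sup>2 - 2 * \<i> * \<beta>1 * \<beta>2) / (4 * of_real pi))"
    unfolding eq by (rule integral_quadratic_gaussian)
  also have "(\<beta>1\<^sup>2 + \<beta>2\<^sup>2 - 2 * \<i> * \<beta>1 * \<beta>2) / (4 * of_real pi) = - of_real pi / 2 * (z\<^sup>2 + w\<^sup>2 + 2 * \<i> * z * w) +
     (- of_real pi * (of_real x ^ 2 + of_real \<xi> ^ 2) + 2 * of_real pi * \<i> * of_real x * of_real \<xi>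
     + 2 * of_real pi * z * of_real x + 2 * of_real pi * w * of_real \<xi>)"
    by (simp add: \<beta>1_def \<beta>2_def field_simps power2_eq_square)
  finally show ?thesis by (simp only: p chirped_gaussian_def prod.case exp_add mult.assoc)
qed

lemma chirped_gaussian_eq_fourier:
  "chirped_gaussian z w =
    (\<lambda>p. (of_real (1 / sqrt 2) * exp (of_real pi / 2 * (z\<^sup>2 + w\<^sup>2 + 2 * \<i> * z * w))) * fourier (dual_gaussian z w) p)"
proof
  fix p
  let ?q = "of_real pi / 2 * (z\<^sup>2 + w\<^sup>2 + 2 * \<i> * z * w)"
  have "exp ?q * exp (- ?q) = 1" by (simp add: exp_add[symmetric])
  moreover have "complex_of_real (1 / sqrt 2) * of_real (sqrt 2) = 1" by (simp flip: of_real_mult)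
  moreover have "- of_real pi / 2 * (z\<^sup>2 + w\<^sup>2 + 2 * \<i> * z * w) = - ?q" by simp
  ultimately show "chirped_gaussian z w p = (of_real (1 / sqrt 2) * exp ?q) * fourier (dual_gaussian z w) p"
    unfolding fourier_dual_gaussian by (simp only: mult_ac) (metis mult.left_commute mult_1_right)
qed

lemma chirped_gaussian_schwartz: "chirped_gaussian z w \<in> schwartz"
  unfolding chirped_gaussian_eq_fourier
  by (intro schwartz_cmult coperator_schwartz[OF coperator_fourier] dual_gaussian_schwartz)

text \<open>The time shift of one argument pairs with its own modulation and the modulation of the other with
  its own time shift, so that the four real parameters form the two complex numbers \<open>z\<close> and \<open>w\<close>.\<close>

lemma cnj_rihaczek_tf_shift:
  "(\<lambda>p. cnj (rihaczek (tf_shift (l1, l2) gaussian) (tf_shift (m1, m2) gaussian) p)) =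
    (\<lambda>p. exp (- of_real pi * (of_real l1 ^ 2 + of_real m2 ^ 2) + 2 * of_real pi * \<i> * of_real m1 * of_real m2) *
      chirped_gaussian (of_real l1 - \<i> * of_real l2) (of_real m2 - \<i> * of_real m1) p)"
proof
  fix p :: "real \<times> real"
  obtain x \<xi> where p: "p = (x, \<xi>)" by fastforce
  have g: "gaussian t = exp (- complex_of_real pi * of_real t ^ 2)" for t by (rule gaussian_eq_exp)
  let ?\<beta> = "2 * of_real pi * of_real m1 + 2 * of_real pi * \<i> * (of_real m2 - of_real \<xi>) :: complex"
  have "fourier (tf_shift (m1, m2) gaussian) \<xi> =
    (LINT t|lborel. exp (- of_real pi * of_real m1 ^ 2) * exp (- complex_of_real pi * of_real t ^ 2 + ?\<beta> * of_real t))"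
    unfolding fourier_def
    by (intro Bochner_Integration.integral_cong refl)
       (simp add: tf_shift_def g cis_conv_exp exp_add[symmetric] algebra_simps power2_eq_square)
  also have "\<dots> = exp (- of_real pi * of_real m1 ^ 2) * (LINT t|lborel. exp (- complex_of_real pi * of_real t ^ 2 + ?\<beta> * of_real t))"
    by (rule integral_mult_right_zero)
  also have "\<dots> = exp (- of_real pi * of_real m1 ^ 2 + ?\<beta>\<^sup>2 / (4 * of_real pi))"
    by (subst integral_gaussian_exp) (auto simp: mult_exp_exp)
  also have "- of_real pi * of_real m1 ^ 2 + ?\<beta>\<^sup>2 / (4 * of_real pi) =
      2 * of_real pi * \<i> * of_real m1 * (of_real m2 - of_real \<xi>) - of_real pi * (of_real m2 - of_real \<xi>)\<^sup>2"
    by (simp add: field_simps power2_eq_square)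
  finally have F: "fourier (tf_shift (m1, m2) gaussian) \<xi> =
    exp (2 * of_real pi * \<i> * of_real m1 * (of_real m2 - of_real \<xi>) - of_real pi * (of_real m2 - of_real \<xi>)\<^sup>2)" .
  have "cnj (rihaczek (tf_shift (l1, l2) gaussian) (tf_shift (m1, m2) gaussian) p) =
    cnj (tf_shift (l1, l2) gaussian x) * fourier (tf_shift (m1, m2) gaussian) \<xi> * cis (2 * pi * x * \<xi>)"
    by (simp add: p rihaczek_def cis_cnj)
  also have "cnj (tf_shift (l1, l2) gaussian x) = exp (- 2 * of_real pi * \<i> * of_real l2 * of_real x - of_real pi * (of_real x - of_real l1)\<^sup>2)"
    by (simp add: tf_shift_def gaussian_def cis_cnj) (simp add: cis_conv_exp exp_add[symmetric] exp_of_real[symmetric] algebra_simps power2_eq_square)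
  also have "cis (2 * pi * x * \<xi>) = exp (2 * of_real pi * \<i> * of_real x * of_real \<xi>)" by (simp add: cis_conv_exp mult_ac)
  finally show "cnj (rihaczek (tf_shift (l1, l2) gaussian) (tf_shift (m1, m2) gaussian) p) =
    exp (- of_real pi * (of_real l1 ^ 2 + of_real m2 ^ 2) + 2 * of_real pi * \<i> * of_real m1 * of_real m2) *
      chirped_gaussian (of_real l1 - \<i> * of_real l2) (of_real m2 - \<i> * of_real m1) p"
    unfolding F by (simp add: p chirped_gaussian_def exp_add[symmetric] algebra_simps power2_eq_square)
qed

lemma test_mult_exp:
  assumes "\<theta> \<in> test" "slow (\<lambda>n. Q)" shows "(\<lambda>p. \<theta> p * exp (Q p)) \<in> test"
  using test_mult[OF smooth_exp[OF slow_smooth[OF assms(2)]] assms(1)] by (simp add: mult.commute)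

text \<open>The cutoff \<open>\<theta>\<close> of the Fourier transform of \<open>\<sigma>\<close> turns \<open>\<sigma> (E(z, w))\<close>, up to a nonvanishing factor,
  into a Laplace transform. The lattice is a product, so the theorem on zeros applies to one
  variable at a time: first in \<open>z\<close> for each lattice value of \<open>w\<close>, then in \<open>w\<close> for each complex \<open>z\<close>.\<close>

lemma chirped_gaussian_zero_of_lattice:
  fixes \<sigma> :: "(real \<times> real) distr"
  assumes \<sigma>: "cfunctional \<sigma>" and c: "compact (dist_support (dist_fourier \<sigma>))" and a: "a > 0" and b: "b > 0"
    and zero: "\<And>k l p q :: int. \<sigma> (chirped_gaussian
       (of_real (a * of_int k) + \<i> * of_real (b * of_int l)) (of_real (b * of_int p) + \<i> * of_real (a * of_int q))) = 0"
  shows "\<sigma> (chirped_gaussian z w) = 0"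
proof -
  have \<tau>: "cfunctional (dist_fourier \<sigma>)"
    unfolding dist_fourier_def by (rule cfunctional_comp[OF \<sigma> coperator_fourier])
  obtain \<theta> where \<theta>: "\<theta> \<in> test" "\<And>f. f \<in> schwartz \<Longrightarrow> dist_fourier \<sigma> f = dist_fourier \<sigma> (\<lambda>x. \<theta> x * f x)"
    using compact_support_cutoff[OF \<tau> c] by blast
  define H where "H z w = dist_fourier \<sigma> (\<lambda>x. \<theta> x * dual_gaussian z w x)" for z w
  have H: "\<sigma> (chirped_gaussian z w) = (of_real (1 / sqrt 2) * exp (of_real pi / 2 * (z\<^sup>2 + w\<^sup>2 + 2 * \<i> * z * w))) * H z w" for z w
    unfolding chirped_gaussian_eq_fourier
    by (simp only: cfunctional_cmult[OF \<sigma> coperator_schwartz[OF coperator_fourier dual_gaussian_schwartz[of z w]]]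
        \<theta>(2)[OF dual_gaussian_schwartz[of z w], unfolded dist_fourier_def] H_def dist_fourier_def)
  then have H0: "\<sigma> (chirped_gaussian z w) = 0 \<longleftrightarrow> H z w = 0" for z w by simp
  have entire1: "(\<lambda>z. H z w) holomorphic_on UNIV" "\<exists>C K. \<forall>z. norm (H z w) \<le> C * exp (K * norm z)" for w
  proof -
    let ?\<theta> = "\<lambda>p. \<theta> p * exp (dual_quadratic p + w * dual_form2 p)"
    have t: "?\<theta> \<in> test"
      by (intro test_mult_exp \<theta>(1) slow_add slow_mult slow_const slow_dual_quadratic slow_bounded_linear bounded_linear_dual_form2)
    have eq: "H z w = dist_fourier \<sigma> (\<lambda>p. ?\<theta> p * exp (z * dual_form1 p))" for z
      by (simp add: H_def dual_gaussian_def exp_add mult_ac)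
    show "(\<lambda>z. H z w) holomorphic_on UNIV" "\<exists>C K. \<forall>z. norm (H z w) \<le> C * exp (K * norm z)"
      unfolding eq by (rule laplace_entire_exponential_type[OF \<tau> t bounded_linear_dual_form1])+
  qed
  have entire2: "(\<lambda>w. H z w) holomorphic_on UNIV" "\<exists>C K. \<forall>w. norm (H z w) \<le> C * exp (K * norm w)" for z
  proof -
    let ?\<theta> = "\<lambda>p. \<theta> p * exp (dual_quadratic p + z * dual_form1 p)"
    have t: "?\<theta> \<in> test"
      by (intro test_mult_exp \<theta>(1) slow_add slow_mult slow_const slow_dual_quadratic slow_bounded_linear bounded_linear_dual_form1)
    have eq: "H z w = dist_fourier \<sigma> (\<lambda>p. ?\<theta> p * exp (w * dual_form2 p))" for w
      by (simp add: H_def dual_gaussian_def exp_add mult_ac)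
    show "(\<lambda>w. H z w) holomorphic_on UNIV" "\<exists>C K. \<forall>w. norm (H z w) \<le> C * exp (K * norm w)"
      unfolding eq by (rule laplace_entire_exponential_type[OF \<tau> t bounded_linear_dual_form2])+
  qed
  have step1: "H z (of_real (b * of_int p) + \<i> * of_real (a * of_int q)) = 0" for z and p q :: int
  proof -
    let ?w = "of_real (b * of_int p) + \<i> * of_real (a * of_int q) :: complex"
    obtain C K where "\<And>z. norm (H z ?w) \<le> C * exp (K * norm z)" using entire1(2)[of ?w] by blast
    from exponential_type_zero_on_lattice[OF entire1(1) this a b] zero show ?thesis unfolding H0 by blast
  qed
  obtain C K where "\<And>w. norm (H z w) \<le> C * exp (K * norm w)" using entire2(2)[of z] by blast
  from exponential_type_zero_on_lattice[OF entire2(1) this b a] step1 have "H z w = 0" by blast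
  then show ?thesis by (simp add: H0)
qed

section \<open>Vanishing of the operator\<close>

definition chirp :: "real \<times> real \<Rightarrow> complex" where
  "chirp = (\<lambda>(x, \<xi>). exp (2 * of_real pi * \<i> * of_real x * of_real \<xi>))"

lemma slow_chirp: "slow (\<lambda>n. chirp)"
proof -
  have "slow (\<lambda>n p. exp (2 * of_real pi * \<i> * of_real (fst p) * of_real (snd p)))"
    by (intro slow_exp_imaginary slow_mult slow_const slow_fst slow_snd) simp
  then show ?thesis by (simp add: chirp_def split_beta')
qed

lemma cnj_rihaczek_eq: "(\<lambda>p. cnj (rihaczek g f p)) = (\<lambda>p. chirp p * tensor (\<lambda>x. cnj (g x)) (fourier f) p)"
proof
  fix p :: "real \<times> real"
  obtain x \<xi> where p: "p = (x, \<xi>)" by fastforce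
  have "cnj (cis (- 2 * pi * x * \<xi>)) = cis (2 * pi * x * \<xi>)" by (simp add: cis_cnj)
  also have "\<dots> = chirp p" by (simp add: p chirp_def cis_conv_exp mult_ac)
  finally show "cnj (rihaczek g f p) = chirp p * tensor (\<lambda>x. cnj (g x)) (fourier f) p"
    by (simp add: p rihaczek_def tensor_def mult_ac)
qed

lemma chirp_tensor_gaussian:
  "(\<lambda>p. chirp p * tensor (\<lambda>x. gaussian x * exp (freq s x)) (\<lambda>\<xi>. gaussian \<xi> * exp (freq t \<xi>)) p) =
     chirped_gaussian (- \<i> * of_real s) (- \<i> * of_real t)"
  by (auto simp: chirp_def tensor_def chirped_gaussian_def gaussian_eq_exp freq_def fun_eq_iff exp_add[symmetric] algebra_simps)

theorem theorem4p1:
  fixes \<sigma> :: "(real \<times> real) distr" and a b :: real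
  assumes "tempered \<sigma>"
    and "a > 0" and "b > 0"
    and "compact (dist_support (dist_fourier \<sigma>))"
    and "\<And>l m. l \<in> rect_lattice a b \<Longrightarrow> m \<in> rect_lattice a b \<Longrightarrow>
      dist_inner (kohn_nirenberg \<sigma> (tf_shift m gaussian)) (tf_shift l gaussian) = 0"
  shows "\<forall>f\<in>schwartz. \<forall>g\<in>schwartz. dist_inner (kohn_nirenberg \<sigma> f) g = 0"
proof (intro ballI)
  have \<sigma>: "cfunctional \<sigma>" by (rule tempered_imp_cfunctional[OF assms(1)])
  have zero: "\<sigma> (chirped_gaussian z w) = 0" for z w
  proof (rule chirped_gaussian_zero_of_lattice[OF \<sigma> assms(4,2,3)])
    fix k l p q :: int
    \<comment> \<open>The signs turn \<open>l\<^sub>1 - i l\<^sub>2\<close> and \<open>m\<^sub>2 - i m\<^sub>1\<close> into the required lattice points.\<close>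
    let ?l = "(a * of_int k, b * of_int (- l))" and ?m = "(a * of_int (- q), b * of_int p)"
    let ?z = "of_real (a * of_int k) + \<i> * of_real (b * of_int l) :: complex"
      and ?w = "of_real (b * of_int p) + \<i> * of_real (a * of_int q) :: complex"
    have "?l \<in> rect_lattice a b" "?m \<in> rect_lattice a b" unfolding rect_lattice_def by blast+
    from assms(5)[OF this]
    have "\<sigma> (\<lambda>x. cnj (rihaczek (tf_shift ?l gaussian) (tf_shift ?m gaussian) x)) = 0"
      unfolding dist_inner_kohn_nirenberg by (simp only: dist_inner_def)
    then show "\<sigma> (chirped_gaussian ?z ?w) = 0"
      unfolding cnj_rihaczek_tf_shift cfunctional_cmult[OF \<sigma> chirped_gaussian_schwartz] by simp
  qed
  let ?V = "\<lambda>g k. \<sigma> (\<lambda>p. chirp p * tensor g k p)"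
  have V: "cfunctional (\<lambda>f. \<sigma> (\<lambda>p. chirp p * f p))"
    by (rule cfunctional_comp[OF \<sigma> coperator_mult[OF slow_chirp]])
  have gS: "(\<lambda>x. gaussian x * exp (freq s x)) \<in> schwartz" for s
    using schwartz_mult_slow[OF slow_exp_freq gaussian_schwartz] by (simp add: mult.commute)
  have V1: "?V g (\<lambda>\<xi>. gaussian \<xi> * exp (freq t \<xi>)) = 0" if "g \<in> schwartz" for g t
    by (rule cfunctional_zero_of_modulated_gaussians[OF cfunctional_comp[OF V coperator_tensor_left[OF gS]] _ that])
       (unfold chirp_tensor_gaussian, rule zero)
  have V2: "?V g k = 0" if "g \<in> schwartz" "k \<in> schwartz" for g k
    by (rule cfunctional_zero_of_modulated_gaussians[OF cfunctional_comp[OF V coperator_tensor_right[OF that(1)]] _ that(2)])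
       (rule V1[OF that(1)])
  fix f g :: "real \<Rightarrow> complex" assume f: "f \<in> schwartz" and g: "g \<in> schwartz"
  have "dist_inner (kohn_nirenberg \<sigma> f) g = ?V (\<lambda>x. cnj (g x)) (fourier f)"
    unfolding dist_inner_kohn_nirenberg unfolding dist_inner_def cnj_rihaczek_eq ..
  then show "dist_inner (kohn_nirenberg \<sigma> f) g = 0"
    using V2[OF schwartz_cnj[OF g] coperator_schwartz[OF coperator_fourier f]] by simp
qed

end
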